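(* For every $n\in\mathbb{N}$, $\Phi_n$ is a unitary operator on $L^2(\mathbb{R})$.
   Context: $c_n(\eta)=\sum_{l\ge0}\frac{(-1)^l n}{(2n)^{2l+\frac{1}{2n}}\Gamma(l+\frac{1}{2n})l!}\eta^{2nl}$; $\mathcal{H}$ is the Hilbert transform ($\mathcal{H}f(x)=\frac1\pi\,\mathrm{p.v.}\int\frac{f(t)}{x-t}dt$ on $L^2(\mathbb{R})$, extended to tempered distributions); $s_n=-\mathcal{H}c_n$, $\varphi_n=c_n+is_n$. Let $\phi=\mathbf{1}_{[0,1]}$, $\phi_{j,k}(t)=\phi(2^jt-k)$, $V_j$ the finite linear span of $\{\phi_{j,k}\}_{k\in\mathbb{Z}}$, $V_j^+$ its even elements. On $D_j=V_j^+\oplus\mathcal{H}(V_j^+)$, $\Phi_n g(\omega)=\int\varphi_n(\omega t)g(t)\,dt$ (for even $g$: $\int c_n(\omega t)g(t)dt$; for odd $g\in\mathcal{H}(V_j^+)$: $i\int s_n(\omega t)g(t)dt$ understood distributionally, equal to $i\operatorname{sgn}(\omega)\int c_n(\omega t)(\mathcal{H}g)(t)dt$). $\Phi_n$ is isometric on $\bigcup_j D_j$, whose closed linear span is $L^2(\mathbb{R})$, and $\Phi_n$ denotes its unique bounded (isometric) extension to $L^2(\mathbb{R})$. *)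

theory Defs
  imports "HOL-Analysis.Analysis"
begin

definition cn :: "nat \<Rightarrow> real \<Rightarrow> real" where
  "cn n \<eta> = (\<Sum>l. ((-1) ^ l * real n /
      ((2 * real n) powr (2 * real l + 1 / (2 * real n)) * Gamma (real l + 1 / (2 * real n)) * fact l))
      * \<eta> ^ (2 * n * l))"

definition hilbert :: "(real \<Rightarrow> complex) \<Rightarrow> real \<Rightarrow> complex" where
  "hilbert f x = Lim (at_right 0)
     (\<lambda>\<epsilon>::real. complex_of_real (1 / pi) *
        (LINT t:{t. \<epsilon> < \<bar>x - t\<bar>}|lborel. f t / complex_of_real (x - t)))"

definition haar_phi :: "real \<Rightarrow> real" where
  "haar_phi = indicator {0..1}"

definition Vspace :: "int \<Rightarrow> (real \<Rightarrow> complex) set" where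
  "Vspace j = {f. \<exists>K (a :: int \<Rightarrow> complex). finite K \<and>
      f = (\<lambda>t. \<Sum>k\<in>K. a k * complex_of_real (haar_phi (2 powr real_of_int j * t - real_of_int k)))}"

definition Vplus :: "int \<Rightarrow> (real \<Rightarrow> complex) set" where
  "Vplus j = {f \<in> Vspace j. \<forall>t. f (- t) = f t}"

definition L2 :: "(real \<Rightarrow> complex) set" where
  "L2 = {f. f \<in> borel_measurable lborel \<and> integrable lborel (\<lambda>x. (cmod (f x))\<^sup>2)}"

definition L2norm :: "(real \<Rightarrow> complex) \<Rightarrow> real" where
  "L2norm f = sqrt (LINT x|lborel. (cmod (f x))\<^sup>2)"

definition Phi_even :: "nat \<Rightarrow> (real \<Rightarrow> complex) \<Rightarrow> real \<Rightarrow> complex" where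
  "Phi_even n g \<omega> = (LINT t|lborel. complex_of_real (cn n (\<omega> * t)) * g t)"

definition Phi_odd :: "nat \<Rightarrow> (real \<Rightarrow> complex) \<Rightarrow> real \<Rightarrow> complex" where
  "Phi_odd n g \<omega> = \<i> * complex_of_real (sgn \<omega>) *
      (LINT t|lborel. complex_of_real (cn n (\<omega> * t)) * hilbert g t)"

definition L2_bounded_linear :: "((real \<Rightarrow> complex) \<Rightarrow> (real \<Rightarrow> complex)) \<Rightarrow> bool" where
  "L2_bounded_linear T \<longleftrightarrow>
     (\<forall>f\<in>L2. T f \<in> L2) \<and>
     (\<forall>f\<in>L2. \<forall>g\<in>L2. (AE x in lborel. f x = g x) \<longrightarrow> (AE x in lborel. T f x = T g x)) \<and>
     (\<forall>f\<in>L2. \<forall>g\<in>L2. \<forall>a b. AE x in lborel. T (\<lambda>t. a * f t + b * g t) x = a * T f x + b * T g x) \<and>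
     (\<exists>C. \<forall>f\<in>L2. L2norm (T f) \<le> C * L2norm f)"

text \<open>T extends Phi_n on the union of the D_j = V_j^+ (+) H(V_j^+).\<close>
definition extends_Phi :: "nat \<Rightarrow> ((real \<Rightarrow> complex) \<Rightarrow> (real \<Rightarrow> complex)) \<Rightarrow> bool" where
  "extends_Phi n T \<longleftrightarrow>
     (\<forall>j. \<forall>e\<in>Vplus j. AE \<omega> in lborel. T e \<omega> = Phi_even n e \<omega>) \<and>
     (\<forall>j. \<forall>h\<in>Vplus j. AE \<omega> in lborel. T (hilbert h) \<omega> = Phi_odd n (hilbert h) \<omega>)"

definition L2_unitary :: "((real \<Rightarrow> complex) \<Rightarrow> (real \<Rightarrow> complex)) \<Rightarrow> bool" where
  "L2_unitary T \<longleftrightarrow>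
     (\<forall>f\<in>L2. L2norm (T f) = L2norm f) \<and>
     (\<forall>g\<in>L2. \<exists>f\<in>L2. AE x in lborel. T f x = g x)"

end

theory Submission
  imports Defs
begin

text \<open>
  The moments of the generalized Gaussians \<open>G s t = exp (- s t\<^bsup>2n\<^esup>)\<close> contain the Gamma factors that
  occur in the denominators of the coefficients of \<open>c\<^sub>n\<close>, whence \<open>\<Phi> (G s) = (2ns)\<^bsup>-1/2n\<^esup> G (1 / (4n\<^sup>2s))\<close>.
  The Gaussians and their images have equal Gram matrices, so \<open>\<Phi>\<close> is isometric on their span. Indicators of
  symmetric intervals are dominated limits of elements of this span, and Fatou's lemma extends the
  isometry to even step functions.

  The Hilbert transform of the indicator of \<open>[a, b]\<close> is \<open>ln \<bar>(x - a) / (x - b)\<bar> / \<pi>\<close>. The integral of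
  \<open>ln \<bar>(1 + s) / (1 - s)\<bar> / s\<close> over \<open>s > 0\<close> is \<open>\<pi>\<^sup>2 / 2\<close>; this yields \<open>\<H>\<H>f = - f\<close> for step functions, and
  Fubini's theorem for the truncated kernel then yields that \<open>\<H>\<close> is antisymmetric and isometric on them.

  Hence the pairs \<open>(e + \<H>h, \<Phi>e - i sgn \<Phi>h)\<close> with even step functions \<open>e\<close>, \<open>h\<close> form a linear isometric relation.
  Its domain is dense, and so is its range, whose closure contains all \<open>G s\<close> and \<open>sgn G s\<close> because \<open>\<Phi>\<close>
  permutes the Gaussians up to scalars. Its closure is therefore the graph of a unitary operator,
  with which every bounded extension of \<open>\<Phi>\<close> agrees on a dense set.
\<close>

subsection \<open>The space of square integrable functions\<close>

text \<open>Elements of L2 are kept as functions, not as classes, and \<open>Phi_even\<close> and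
  \<open>hilbert\<close> are formulas that make sense only for special arguments. Relations and
  their closures in L2 x L2 avoid a separate proof that a map given on generators is well defined:
  equal Gram matrices give equal norms for corresponding linear combinations, so a null first
  component forces a null second one. The remaining difficulty is to identify abstract limits with
  the given formulas. For \<Phi>, the coefficients decay so fast that |c_n(\<eta>)| \<le> K
  exp(\<epsilon> \<eta>^(2n)) for every \<epsilon> > 0; hence the integrals converge absolutely
  against anything dominated by some exp(-d t^(2n)), which is why the approximants of a box must
  share one such majorant. For the Hilbert transform, the limits are computed explicitly off the end
  points of the boxes. The Gaussians fit because their inner products are a constant times (s +
  r)^(-p) with p = 1/(2n), and s -> 1/(4 n^2 s) turns s + r into (s + r)/(4 n^2 s r), whose extra
  factors are absorbed by the scalars.\<close>

abbreviation ldist :: "(real \<Rightarrow> complex) \<Rightarrow> (real \<Rightarrow> complex) \<Rightarrow> real" where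
  "ldist f g \<equiv> L2norm (\<lambda>x. f x - g x)"

definition ip :: "(real \<Rightarrow> complex) \<Rightarrow> (real \<Rightarrow> complex) \<Rightarrow> complex" where
  "ip f g = (LINT x|lborel. f x * cnj (g x))"

lemma L2_measurable: "f \<in> L2 \<Longrightarrow> f \<in> borel_measurable borel"
  by (simp add: L2_def)

lemma L2_integrable: "f \<in> L2 \<Longrightarrow> integrable lborel (\<lambda>x. (cmod (f x))\<^sup>2)"
  by (simp add: L2_def)

lemma L2norm_nonneg [simp]: "L2norm f \<ge> 0"
  by (simp add: L2norm_def)

lemma L2norm_power2: "(L2norm f)\<^sup>2 = (LINT x|lborel. (cmod (f x))\<^sup>2)"
  by (simp add: L2norm_def)

lemma L2norm_nn_integral:
  assumes "f \<in> L2"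
  shows "(\<integral>\<^sup>+x. ennreal ((cmod (f x))\<^sup>2) \<partial>lborel) = ennreal ((L2norm f)\<^sup>2)"
  using nn_integral_eq_integral[OF L2_integrable[OF assms]] by (simp add: L2norm_power2)

lemma L2I_bounded:
  assumes "f \<in> borel_measurable borel"
    and "(\<integral>\<^sup>+x. ennreal ((cmod (f x))\<^sup>2) \<partial>lborel) \<le> ennreal (B\<^sup>2)" and "B \<ge> 0"
  shows "f \<in> L2" "L2norm f \<le> B"
proof -
  have "integrable lborel (\<lambda>x. (cmod (f x))\<^sup>2)"
    using assms by (intro integrableI_bounded) (auto simp: less_top intro: le_less_trans top_unique)
  then show f: "f \<in> L2"
    using assms by (simp add: L2_def)
  have "(L2norm f)\<^sup>2 \<le> B\<^sup>2"
    using assms(2) L2norm_nn_integral[OF f] by simp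
  then show "L2norm f \<le> B"
    using assms(3) power2_le_imp_le by blast
qed

lemma L2_dominated:
  assumes "f \<in> borel_measurable borel" "integrable lborel (\<lambda>x. (w x)\<^sup>2)"
    and "AE x in lborel. cmod (f x) \<le> w x"
  shows "f \<in> L2"
proof -
  have "integrable lborel (\<lambda>x. (cmod (f x))\<^sup>2)"
    by (rule Bochner_Integration.integrable_bound[OF assms(2)])
       (use assms in \<open>auto intro!: power_mono elim!: eventually_mono\<close>)
  then show ?thesis
    using assms by (simp add: L2_def)
qed

lemma L2_scale: "f \<in> L2 \<Longrightarrow> (\<lambda>x. c * f x) \<in> L2"
  by (auto simp: L2_def norm_mult power_mult_distrib)

lemma L2_add:
  assumes "f \<in> L2" "g \<in> L2"
  shows "(\<lambda>x. f x + g x) \<in> L2"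
proof -
  have [measurable]: "f \<in> borel_measurable borel" "g \<in> borel_measurable borel"
    using assms by (auto simp: L2_measurable)
  have int: "integrable lborel (\<lambda>x. 2 * (cmod (f x))\<^sup>2 + 2 * (cmod (g x))\<^sup>2)"
    using assms by (auto simp: L2_def)
  have bd: "(cmod (f x + g x))\<^sup>2 \<le> 2 * (cmod (f x))\<^sup>2 + 2 * (cmod (g x))\<^sup>2" for x
  proof -
    have "(cmod (f x + g x))\<^sup>2 \<le> (cmod (f x) + cmod (g x))\<^sup>2"
      by (intro power_mono norm_triangle_ineq) auto
    also have "\<dots> \<le> 2 * (cmod (f x))\<^sup>2 + 2 * (cmod (g x))\<^sup>2"
      using sum_squares_bound[of "cmod (f x)" "cmod (g x)"] by (simp add: power2_sum)
    finally show ?thesis .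
  qed
  have "integrable lborel (\<lambda>x. (cmod (f x + g x))\<^sup>2)"
    by (rule Bochner_Integration.integrable_bound[OF int]) (use bd in auto)
  then show ?thesis by (simp add: L2_def)
qed

lemma L2_zero [simp]: "(\<lambda>x. 0) \<in> L2"
  by (simp add: L2_def)

lemma L2_lincomb: "f \<in> L2 \<Longrightarrow> g \<in> L2 \<Longrightarrow> (\<lambda>x. c * f x + g x) \<in> L2"
  using L2_add[OF L2_scale] by blast

lemma L2_uminus: "f \<in> L2 \<Longrightarrow> (\<lambda>x. - f x) \<in> L2"
  using L2_scale[of f "-1"] by simp

lemma L2_diff: "f \<in> L2 \<Longrightarrow> g \<in> L2 \<Longrightarrow> (\<lambda>x. f x - g x) \<in> L2"
  using L2_add[OF _ L2_uminus] by simp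

lemma L2_cong_AE:
  assumes "f \<in> L2" "g \<in> borel_measurable borel" "AE x in lborel. f x = g x"
  shows "g \<in> L2"
  using assms by (intro L2_dominated[where w = "\<lambda>x. cmod (f x)"]) (auto simp: L2_integrable elim!: eventually_mono)

lemma L2norm_cong_AE:
  assumes "f \<in> borel_measurable borel" "g \<in> borel_measurable borel" "AE x in lborel. f x = g x"
  shows "L2norm f = L2norm g"
  unfolding L2norm_def
  by (intro arg_cong[where f = sqrt] integral_cong_AE) (use assms in \<open>auto elim!: eventually_mono\<close>)

lemma L2norm_scale: "L2norm (\<lambda>x. c * f x) = cmod c * L2norm f"
  by (simp add: L2norm_def norm_mult power_mult_distrib real_sqrt_mult)

lemma L2norm_zero [simp]: "L2norm (\<lambda>x. 0) = 0"
  by (simp add: L2norm_def)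

lemma ldist_commute: "ldist f g = ldist g f"
  by (simp add: L2norm_def norm_minus_commute)

lemma L2norm_eq_0D:
  assumes "f \<in> L2" "L2norm f = 0"
  shows "AE x in lborel. f x = 0"
proof -
  have "(LINT x|lborel. (cmod (f x))\<^sup>2) = 0"
    using assms by (simp add: L2norm_def)
  then have "AE x in lborel. (cmod (f x))\<^sup>2 = 0"
    using integral_nonneg_eq_0_iff_AE[OF L2_integrable[OF assms(1)]] by simp
  then show ?thesis by simp
qed

lemma ldist_AE_zeroI:
  assumes "f \<in> borel_measurable borel" "g \<in> borel_measurable borel" "AE x in lborel. f x = g x"
  shows "ldist f g = 0"
proof -
  have "ldist f g = L2norm (\<lambda>x. 0)"
    by (rule L2norm_cong_AE) (use assms in auto)
  then show ?thesis by simp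
qed

lemma L2_mult_integrable:
  assumes "f \<in> L2" "g \<in> L2"
  shows "integrable lborel (\<lambda>x. f x * g x)"
proof (rule Bochner_Integration.integrable_bound)
  show "integrable lborel (\<lambda>x. (cmod (f x))\<^sup>2 + (cmod (g x))\<^sup>2)"
    using assms by (auto simp: L2_def)
  show "(\<lambda>x. f x * g x) \<in> borel_measurable lborel"
    using assms by (auto simp: L2_def)
  show "AE x in lborel. norm (f x * g x) \<le> norm ((cmod (f x))\<^sup>2 + (cmod (g x))\<^sup>2)"
  proof (rule AE_I2)
    fix x
    have "2 * (cmod (f x) * cmod (g x)) \<le> (cmod (f x))\<^sup>2 + (cmod (g x))\<^sup>2"
      using sum_squares_bound[of "cmod (f x)" "cmod (g x)"] by (simp add: mult.assoc)
    moreover have "0 \<le> cmod (f x) * cmod (g x)"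
      by simp
    ultimately show "norm (f x * g x) \<le> norm ((cmod (f x))\<^sup>2 + (cmod (g x))\<^sup>2)"
      unfolding norm_mult real_norm_def by linarith
  qed
qed

lemma L2_cnj: "f \<in> L2 \<Longrightarrow> (\<lambda>x. cnj (f x)) \<in> L2"
  using measurable_compose[OF _ borel_measurable_continuous_onI[OF continuous_on_cnj[OF continuous_on_id]]]
  by (auto simp: L2_def)

lemma ip_integrable: "f \<in> L2 \<Longrightarrow> g \<in> L2 \<Longrightarrow> integrable lborel (\<lambda>x. f x * cnj (g x))"
  by (intro L2_mult_integrable L2_cnj)

lemma L2_Cauchy_Schwarz:
  assumes "f \<in> L2" "g \<in> L2"
  shows "(LINT x|lborel. cmod (f x) * cmod (g x)) \<le> L2norm f * L2norm g"
proof -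
  have [measurable]: "f \<in> borel_measurable borel" "g \<in> borel_measurable borel"
    using assms by (auto simp: L2_measurable)
  let ?I = "LINT x|lborel. cmod (f x) * cmod (g x)"
  have i: "integrable lborel (\<lambda>x. cmod (f x) * cmod (g x))"
    using integrable_norm[OF L2_mult_integrable[OF assms]] by (simp add: norm_mult)
  have "ennreal (?I\<^sup>2) = (\<integral>\<^sup>+x. ennreal (cmod (f x)) * ennreal (cmod (g x)) \<partial>lborel)\<^sup>2"
    using nn_integral_eq_integral[OF i] by (simp add: ennreal_mult ennreal_power)
  also have "\<dots> \<le> (\<integral>\<^sup>+x. ennreal (cmod (f x)) ^ 2 \<partial>lborel) * (\<integral>\<^sup>+x. ennreal (cmod (g x)) ^ 2 \<partial>lborel)"
    by (rule Cauchy_Schwarz_nn_integral) auto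
  also have "\<dots> = ennreal ((L2norm f)\<^sup>2) * ennreal ((L2norm g)\<^sup>2)"
    using L2norm_nn_integral assms by (simp add: ennreal_power)
  also have "\<dots> = ennreal ((L2norm f * L2norm g)\<^sup>2)"
    by (simp add: ennreal_mult' power_mult_distrib)
  finally have "?I\<^sup>2 \<le> (L2norm f * L2norm g)\<^sup>2"
    by simp
  then show ?thesis
    by (rule power2_le_imp_le) simp
qed

lemma ip_Cauchy_Schwarz:
  assumes "f \<in> L2" "g \<in> L2"
  shows "cmod (ip f g) \<le> L2norm f * L2norm g"
proof -
  have "cmod (ip f g) \<le> (LINT x|lborel. cmod (f x * cnj (g x)))"
    unfolding ip_def by (rule integral_norm_bound)
  then show ?thesis
    using L2_Cauchy_Schwarz[OF assms] by (simp add: norm_mult)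
qed

lemma ip_self: "ip f f = of_real ((L2norm f)\<^sup>2)"
  by (simp only: ip_def complex_norm_square[symmetric] L2norm_power2 integral_complex_of_real)

lemma ip_lincomb_left:
  assumes "f \<in> L2" "g \<in> L2" "h \<in> L2"
  shows "ip (\<lambda>x. c * f x + g x) h = c * ip f h + ip g h"
proof -
  have "ip (\<lambda>x. c * f x + g x) h = (LINT x|lborel. c * (f x * cnj (h x)) + g x * cnj (h x))"
    unfolding ip_def by (intro Bochner_Integration.integral_cong) (auto simp: algebra_simps)
  also have "\<dots> = c * ip f h + ip g h"
    unfolding ip_def using assms ip_integrable by simp
  finally show ?thesis .
qed

lemma ip_cnj: "ip g f = cnj (ip f g)"
  unfolding ip_def by (simp add: mult.commute flip: Bochner_Integration.integral_cnj)

lemma ip_lincomb_right: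
  assumes "f \<in> L2" "g \<in> L2" "h \<in> L2"
  shows "ip h (\<lambda>x. c * f x + g x) = cnj c * ip h f + ip h g"
  using ip_lincomb_left[OF assms, of c] by (simp add: ip_cnj[of h])

lemma L2norm_triangle:
  assumes "f \<in> L2" "g \<in> L2"
  shows "L2norm (\<lambda>x. f x + g x) \<le> L2norm f + L2norm g"
proof (rule power2_le_imp_le)
  have fg: "(\<lambda>x. f x + g x) \<in> L2" using L2_add assms by simp
  have "complex_of_real ((L2norm (\<lambda>x. f x + g x))\<^sup>2) = ip (\<lambda>x. 1 * f x + g x) (\<lambda>x. 1 * f x + g x)"
    by (simp add: ip_self)
  also have "\<dots> = ip f f + ip f g + ip g f + ip g g"
    using assms fg by (subst ip_lincomb_left) (auto simp: ip_lincomb_right[where c = 1, simplified])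
  finally have "(L2norm (\<lambda>x. f x + g x))\<^sup>2 = Re (ip f f + ip f g + ip g f + ip g g)"
    by (metis Re_complex_of_real)
  also have "\<dots> = (L2norm f)\<^sup>2 + (L2norm g)\<^sup>2 + 2 * Re (ip f g)"
    by (simp add: ip_self ip_cnj[of g f])
  also have "\<dots> \<le> (L2norm f)\<^sup>2 + (L2norm g)\<^sup>2 + 2 * (L2norm f * L2norm g)"
    using ip_Cauchy_Schwarz[OF assms] complex_Re_le_cmod[of "ip f g"] by linarith
  finally show "(L2norm (\<lambda>x. f x + g x))\<^sup>2 \<le> (L2norm f + L2norm g)\<^sup>2"
    by (simp add: power2_sum)
qed simp

lemma ldist_triangle:
  assumes "f \<in> L2" "g \<in> L2" "h \<in> L2"
  shows "ldist f h \<le> ldist f g + ldist g h"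
  using L2norm_triangle[OF L2_diff[OF assms(1,2)] L2_diff[OF assms(2,3)]] by simp

lemma ldist_L2norm_diff:
  assumes "f \<in> L2" "g \<in> L2"
  shows "\<bar>L2norm f - L2norm g\<bar> \<le> ldist f g"
  using ldist_triangle[OF assms L2_zero] ldist_triangle[OF assms(2,1) L2_zero] ldist_commute[of f g]
  by simp

text \<open>Fatou's lemma for the squared moduli. It is applied where only norm bounds are at hand,
  as for the images under \<Phi>, so that dominated convergence is not an option.\<close>

lemma L2_Fatou:
  assumes "\<And>k. f k \<in> L2" "g \<in> borel_measurable borel"
    and "AE x in lborel. (\<lambda>k. f k x) \<longlonglongrightarrow> g x"
    and "eventually (\<lambda>k. L2norm (f k) \<le> B) sequentially" "B \<ge> 0"
  shows "g \<in> L2" "L2norm g \<le> B"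
proof -
  have [measurable]: "f k \<in> borel_measurable borel" for k
    using assms by (auto simp: L2_measurable)
  have "(\<integral>\<^sup>+x. ennreal ((cmod (g x))\<^sup>2) \<partial>lborel)
      = (\<integral>\<^sup>+x. liminf (\<lambda>k. ennreal ((cmod (f k x))\<^sup>2)) \<partial>lborel)"
  proof (rule nn_integral_cong_AE)
    show "AE x in lborel. ennreal ((cmod (g x))\<^sup>2) = liminf (\<lambda>k. ennreal ((cmod (f k x))\<^sup>2))"
      using assms(3)
    proof eventually_elim
      case (elim x)
      then have "(\<lambda>k. ennreal ((cmod (f k x))\<^sup>2)) \<longlonglongrightarrow> ennreal ((cmod (g x))\<^sup>2)"
        by (intro tendsto_ennrealI tendsto_intros)
      then show ?case
        by (intro lim_imp_Liminf[symmetric]) simp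
    qed
  qed
  also have "\<dots> \<le> liminf (\<lambda>k. \<integral>\<^sup>+x. ennreal ((cmod (f k x))\<^sup>2) \<partial>lborel)"
    by (rule nn_integral_liminf) auto
  also have "\<dots> = liminf (\<lambda>k. ennreal ((L2norm (f k))\<^sup>2))"
    using L2norm_nn_integral assms by simp
  also have "\<dots> \<le> liminf (\<lambda>k. ennreal (B\<^sup>2))"
    by (rule Liminf_mono, use assms(4) in eventually_elim) (auto intro!: ennreal_leI power_mono)
  also have "\<dots> = ennreal (B\<^sup>2)"
    by (simp add: Liminf_const)
  finally have "(\<integral>\<^sup>+x. ennreal ((cmod (g x))\<^sup>2) \<partial>lborel) \<le> ennreal (B\<^sup>2)" .
  then show "g \<in> L2" "L2norm g \<le> B"
    using L2I_bounded[OF assms(2) _ assms(5)] by auto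
qed

lemma L2_dominated_convergence:
  assumes "\<And>k. f k \<in> borel_measurable borel" "g \<in> borel_measurable borel"
    and "integrable lborel (\<lambda>x. (w x)\<^sup>2)"
    and "\<And>k. AE x in lborel. cmod (f k x) \<le> w x"
    and "AE x in lborel. (\<lambda>k. f k x) \<longlonglongrightarrow> g x"
  shows "\<And>k. f k \<in> L2" "g \<in> L2" "(\<lambda>k. ldist (f k) g) \<longlonglongrightarrow> 0"
proof -
  note [measurable] = assms(1,2)
  show fk: "f k \<in> L2" for k
    using L2_dominated assms by blast
  have all: "AE x in lborel. \<forall>k. cmod (f k x) \<le> w x"
    using assms(4) by (simp add: AE_all_countable)
  have gw: "AE x in lborel. cmod (g x) \<le> w x"
    using all assms(5)
    by eventually_elim (auto intro: tendsto_upperbound[OF tendsto_norm] always_eventually)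
  then show g: "g \<in> L2"
    using L2_dominated assms by blast
  have "(\<lambda>k. LINT x|lborel. (cmod (f k x - g x))\<^sup>2) \<longlonglongrightarrow> (LINT x::real|lborel. 0)"
  proof (rule integral_dominated_convergence)
    show "integrable lborel (\<lambda>x. 4 * (w x)\<^sup>2)"
      using assms(3) by simp
    show "AE x in lborel. (\<lambda>k. (cmod (f k x - g x))\<^sup>2) \<longlonglongrightarrow> 0"
      using assms(5) by eventually_elim (auto intro!: tendsto_eq_intros)
    show "AE x in lborel. norm ((cmod (f k x - g x))\<^sup>2) \<le> 4 * (w x)\<^sup>2" for k
      using all gw
    proof eventually_elim
      case (elim x)
      then have "cmod (f k x - g x) \<le> 2 * w x"
        using norm_triangle_ineq4[of "f k x" "g x"] by (smt (verit))
      then have "(cmod (f k x - g x))\<^sup>2 \<le> (2 * w x)\<^sup>2"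
        by (intro power_mono) auto
      then show ?case by simp
    qed
  qed auto
  then have "(\<lambda>k. sqrt (LINT x|lborel. (cmod (f k x - g x))\<^sup>2)) \<longlonglongrightarrow> sqrt 0"
    by (intro tendsto_real_sqrt) simp
  then show "(\<lambda>k. ldist (f k) g) \<longlonglongrightarrow> 0"
    by (simp add: L2norm_def)
qed

text \<open>Provides a strictly positive weight in L2; multiplying by it turns Cauchy sequences of
  L2 into Cauchy sequences of L1.\<close>

lemma exp_minus_power2_integrable: "integrable lborel (\<lambda>x::real. (exp (- \<bar>x\<bar>))\<^sup>2)"
proof -
  have nn: "(\<integral>\<^sup>+x. ennreal (exp (- 2 * x)) * indicator {0..} x \<partial>lborel) = ennreal (0 - (- exp (- 2 * 0) / 2))"
  proof (rule nn_integral_FTC_atLeast)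
    show "((\<lambda>x::real. - exp (- 2 * x) / 2) \<longlongrightarrow> 0) at_top"
      by real_asymp
  qed (auto intro!: derivative_eq_intros)
  have 1: "integrable lborel (\<lambda>x::real. exp (- 2 * x) * indicator {0..} x)"
    using nn by (intro integrableI_nonneg)
      (auto simp: ennreal_mult' ennreal_indicator less_top[symmetric])
  have 2: "integrable lborel (\<lambda>x::real. exp (- 2 * (- x)) * indicator {0..} (- x))"
    using lborel_integrable_real_affine[OF 1, of "-1" 0] by simp
  show ?thesis
    by (rule Bochner_Integration.integrable_bound[OF Bochner_Integration.integrable_add[OF 1 2]])
       (auto simp: exp_double[symmetric] indicator_def abs_if)
qed

text \<open>Fatou applied to \<open>f k - f (r i)\<close> as \<open>i\<close> grows: the norm limit
  of a Cauchy sequence is the almost everywhere limit of any subsequence that has one. This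
  identifies an abstract limit with a function given by a formula.\<close>

lemma L2_limit_AE:
  assumes f: "\<And>k. f k \<in> L2"
    and cau: "\<And>e. e > 0 \<Longrightarrow> \<exists>N. \<forall>i\<ge>N. \<forall>j\<ge>N. ldist (f i) (f j) < e"
    and r: "strict_mono r" and [measurable]: "g \<in> borel_measurable borel"
    and lim: "AE x in lborel. (\<lambda>i. f (r i) x) \<longlonglongrightarrow> g x"
  shows "g \<in> L2" "(\<lambda>k. ldist (f k) g) \<longlonglongrightarrow> 0"
proof -
  have [measurable]: "f k \<in> borel_measurable borel" for k
    using f by (auto simp: L2_measurable)
  have diff: "(\<lambda>x. f k x - g x) \<in> L2 \<and> ldist (f k) g \<le> e"
    if N: "e \<ge> 0" "\<And>i j. i \<ge> N \<Longrightarrow> j \<ge> N \<Longrightarrow> ldist (f i) (f j) < e" and "k \<ge> N" for e N k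
  proof -
    have "AE x in lborel. (\<lambda>i. f k x - f (r i) x) \<longlonglongrightarrow> f k x - g x"
      using lim by eventually_elim (auto intro!: tendsto_intros)
    moreover have "eventually (\<lambda>i. ldist (f k) (f (r i)) \<le> e) sequentially"
      using eventually_ge_at_top[of N]
    proof eventually_elim
      case (elim i)
      then have "r i \<ge> N"
        using strict_mono_imp_increasing[OF r, of i] by simp
      then show ?case
        using N(2) \<open>k \<ge> N\<close> by (simp add: less_imp_le)
    qed
    ultimately show ?thesis
      using L2_Fatou[of "\<lambda>i x. f k x - f (r i) x" "\<lambda>x. f k x - g x" e] f N(1)
      by (simp add: L2_diff)
  qed
  show "g \<in> L2"
  proof -
    obtain N where "\<And>i j. i \<ge> N \<Longrightarrow> j \<ge> N \<Longrightarrow> ldist (f i) (f j) < 1"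
      using cau[of 1] by auto
    then have "(\<lambda>x. f N x - g x) \<in> L2"
      using diff[of 1 N N] by auto
    from L2_diff[OF f[of N] this] show ?thesis
      by simp
  qed
  show "(\<lambda>k. ldist (f k) g) \<longlonglongrightarrow> 0"
  proof (rule LIMSEQ_I)
    fix e :: real assume "e > 0"
    then obtain N where "\<And>i j. i \<ge> N \<Longrightarrow> j \<ge> N \<Longrightarrow> ldist (f i) (f j) < e / 2"
      using cau[of "e / 2"] by auto
    then have "\<forall>k\<ge>N. norm (ldist (f k) g - 0) < e"
      using diff[of "e / 2" N] \<open>e > 0\<close> by fastforce
    then show "\<exists>N. \<forall>k\<ge>N. norm (ldist (f k) g - 0) < e" ..
  qed
qed

text \<open>Riesz-Fischer. By Cauchy-Schwarz the sequence \<open>f k * w\<close> is Cauchy in L1,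
  hence has a subsequence that is Cauchy almost everywhere; since \<open>w\<close> never vanishes,
  it can be divided out again.\<close>

lemma L2_complete:
  assumes f: "\<And>k. f k \<in> L2"
    and cau: "\<And>e. e > 0 \<Longrightarrow> \<exists>N. \<forall>i\<ge>N. \<forall>j\<ge>N. ldist (f i) (f j) < e"
  shows "\<exists>g\<in>L2. (\<lambda>k. ldist (f k) g) \<longlonglongrightarrow> 0"
proof -
  have [measurable]: "f k \<in> borel_measurable borel" for k
    using f by (auto simp: L2_measurable)
  define w where "w = (\<lambda>x::real. complex_of_real (exp (- \<bar>x\<bar>)))"
  have w: "w \<in> L2"
    using exp_minus_power2_integrable unfolding w_def L2_def by simp
  have w0: "w x \<noteq> 0" for x
    by (simp add: w_def)
  obtain r where r: "strict_mono r" "AE x in lborel. Cauchy (\<lambda>i. f (r i) x * w x)"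
  proof (rule cauchy_L1_AE_cauchy_subseq[of lborel "\<lambda>k x. f k x * w x"])
    show "integrable lborel (\<lambda>x. f n x * w x)" for n
      using f w by (rule L2_mult_integrable)
    fix e :: real assume "e > 0"
    then have "e / (L2norm w + 1) > 0"
      by (simp add: add_nonneg_pos)
    then obtain N where N: "\<And>i j. i \<ge> N \<Longrightarrow> j \<ge> N \<Longrightarrow> ldist (f i) (f j) < e / (L2norm w + 1)"
      using cau by meson
    have "(LINT x|lborel. norm (f i x * w x - f j x * w x)) < e" if "i \<ge> N" "j \<ge> N" for i j
    proof -
      have "(LINT x|lborel. norm (f i x * w x - f j x * w x))
          = (LINT x|lborel. cmod (f i x - f j x) * cmod (w x))"
        by (simp add: norm_mult[symmetric] left_diff_distrib)
      also have "\<dots> \<le> ldist (f i) (f j) * L2norm w"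
        using f w by (intro L2_Cauchy_Schwarz L2_diff)
      also have "\<dots> \<le> ldist (f i) (f j) * (L2norm w + 1)"
        by (intro mult_left_mono) auto
      also have "\<dots> < e"
        using N[OF that] by (simp add: pos_less_divide_eq add_nonneg_pos)
      finally show ?thesis .
    qed
    then show "\<exists>N. \<forall>i\<ge>N. \<forall>j\<ge>N. (LINT x|lborel. norm (f i x * w x - f j x * w x)) < e"
      by blast
  qed
  define g where "g = (\<lambda>x. lim (\<lambda>i. f (r i) x))"
  have [measurable]: "g \<in> borel_measurable borel"
    unfolding g_def by measurable
  have lim: "AE x in lborel. (\<lambda>i. f (r i) x) \<longlonglongrightarrow> g x"
    using r(2)
  proof eventually_elim
    case (elim x)
    then obtain l where "(\<lambda>i. f (r i) x * w x) \<longlonglongrightarrow> l"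
      using Cauchy_convergent convergent_def by blast
    then have "(\<lambda>i. f (r i) x * w x / w x) \<longlonglongrightarrow> l / w x"
      using w0 by (intro tendsto_divide) auto
    then have "convergent (\<lambda>i. f (r i) x)"
      using w0 by (auto simp: convergent_def)
    then show ?case
      unfolding g_def by (rule convergent_LIMSEQ_iff[THEN iffD1])
  qed
  show ?thesis
    using L2_limit_AE[OF f cau r(1) _ lim] by auto
qed

subsection \<open>Spans and closures of sets of functions and of relations\<close>

text \<open>Linear combinations are built by adding one scaled generator at a time, so that
  statements about spans need an induction with a single step. Membership refers to functions, not
  to classes modulo null sets.\<close>

inductive_set cspan :: "(real \<Rightarrow> complex) set \<Rightarrow> (real \<Rightarrow> complex) set" for S where
  cspan_zero: "(\<lambda>x. 0) \<in> cspan S"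
| cspan_step: "f \<in> S \<Longrightarrow> g \<in> cspan S \<Longrightarrow> (\<lambda>x. c * f x + g x) \<in> cspan S"

text \<open>The span in the product space: the graph of a linear map prescribed on generators, with
  no claim that it is single valued. In this form the converse relation is an object of the same
  kind.\<close>

inductive_set rspan :: "((real \<Rightarrow> complex) \<times> (real \<Rightarrow> complex)) set \<Rightarrow> ((real \<Rightarrow> complex) \<times> (real \<Rightarrow> complex)) set" for S where
  rspan_zero: "(\<lambda>x. 0, \<lambda>x. 0) \<in> rspan S"
| rspan_step: "(f, g) \<in> S \<Longrightarrow> (u, v) \<in> rspan S \<Longrightarrow> (\<lambda>x. c * f x + u x, \<lambda>x. c * g x + v x) \<in> rspan S"

definition lcl :: "(real \<Rightarrow> complex) set \<Rightarrow> (real \<Rightarrow> complex) set" where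
  "lcl A = {f \<in> L2. \<forall>e>0. \<exists>u\<in>A. ldist u f < e}"

text \<open>Both components are approximated by one and the same pair, so this is the closure of a
  graph.\<close>

definition rcl :: "((real \<Rightarrow> complex) \<times> (real \<Rightarrow> complex)) set \<Rightarrow> ((real \<Rightarrow> complex) \<times> (real \<Rightarrow> complex)) set" where
  "rcl R = {(f, g). f \<in> L2 \<and> g \<in> L2 \<and> (\<forall>e>0. \<exists>(u, v)\<in>R. ldist u f < e \<and> ldist v g < e)}"

abbreviation clspan :: "(real \<Rightarrow> complex) set \<Rightarrow> (real \<Rightarrow> complex) set" where
  "clspan S \<equiv> lcl (cspan S)"

lemma cspan_L2: 
  assumes "S \<subseteq> L2" shows "cspan S \<subseteq> L2"
proof
  fix f assume "f \<in> cspan S" then show "f \<in> L2"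
    by induction (use assms in \<open>auto intro!: L2_lincomb\<close>)
qed

lemma cspan_base: "f \<in> S \<Longrightarrow> f \<in> cspan S"
  using cspan_step[OF _ cspan_zero, of f S 1] by simp

lemma cspan_lincomb: "f \<in> cspan S \<Longrightarrow> g \<in> cspan S \<Longrightarrow> (\<lambda>x. c * f x + g x) \<in> cspan S"
proof (induction rule: cspan.induct)
  case (cspan_step f h d)
  have "(\<lambda>x. (c * d) * f x + (c * h x + g x)) \<in> cspan S"
    using cspan_step by (auto intro: cspan.cspan_step)
  then show ?case by (simp add: algebra_simps)
qed simp

lemma rspan_base: "p \<in> S \<Longrightarrow> p \<in> rspan S"
  using rspan_step[OF _ rspan_zero, of "fst p" "snd p" S 1] by simp

lemma rspan_lincomb: 
  "(f, g) \<in> rspan S \<Longrightarrow> (u, v) \<in> rspan S \<Longrightarrow> (\<lambda>x. c * f x + u x, \<lambda>x. c * g x + v x) \<in> rspan S"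
proof (induction f g rule: rspan.induct)
  case (rspan_step f g u' v' d)
  have "(\<lambda>x. (c * d) * f x + (c * u' x + u x), \<lambda>x. (c * d) * g x + (c * v' x + v x)) \<in> rspan S"
    using rspan_step by (auto intro: rspan.rspan_step)
  then show ?case by (simp add: algebra_simps)
qed simp

lemma rspan_L2:
  assumes "S \<subseteq> L2 \<times> L2" shows "rspan S \<subseteq> L2 \<times> L2"
proof -
  have "(f, g) \<in> rspan S \<Longrightarrow> f \<in> L2 \<and> g \<in> L2" for f g
    by (induction rule: rspan.induct) (use assms in \<open>auto intro!: L2_lincomb\<close>)
  then show ?thesis by auto
qed

lemma cspan_Domain:
  assumes "f \<in> cspan (Domain S)" shows "\<exists>g. (f, g) \<in> rspan S"
  using assms by induction (auto intro: rspan.intros)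

lemma Domain_rspan: "Domain (rspan S) = cspan (Domain S)"
proof -
  have "(f, g) \<in> rspan S \<Longrightarrow> f \<in> cspan (Domain S)" for f g
    by (induction rule: rspan.induct) (auto intro: cspan.intros)
  then show ?thesis
    using cspan_Domain by blast
qed

lemma Range_rspan: "Range (rspan S) = cspan (Range S)"
proof -
  have "(f, g) \<in> rspan S \<Longrightarrow> g \<in> cspan (Range S)" for f g
    by (induction rule: rspan.induct) (auto intro: cspan.intros)
  moreover have "g \<in> cspan (Range S) \<Longrightarrow> \<exists>f. (f, g) \<in> rspan S" for g
    by (induction rule: cspan.induct) (auto intro: rspan.intros)
  ultimately show ?thesis
    by blast
qed

text \<open>Both sides are linear in the first pair and conjugate linear in the second, hence the
  two nested inductions.\<close>

lemma rspan_ip: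
  assumes S: "S \<subseteq> L2 \<times> L2"
    and gram: "\<And>f g f' g'. (f, g) \<in> S \<Longrightarrow> (f', g') \<in> S \<Longrightarrow> ip g g' = ip f f'"
  shows "(f, g) \<in> rspan S \<Longrightarrow> (f', g') \<in> rspan S \<Longrightarrow> ip g g' = ip f f'"
proof (induction f g rule: rspan.induct)
  case rspan_zero
  then show ?case by (simp add: ip_def)
next
  case (rspan_step f g u v c)
  note R = rspan_L2[OF S]
  have "ip g g' = ip f f'"
    using \<open>(f', g') \<in> rspan S\<close> \<open>(f, g) \<in> S\<close>
  proof (induction f' g' rule: rspan.induct)
    case rspan_zero
    then show ?case by (simp add: ip_def)
  next
    case (rspan_step f' g' u' v' d)
    then have "f \<in> L2" "g \<in> L2" "f' \<in> L2" "g' \<in> L2" "u' \<in> L2" "v' \<in> L2"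
      using S R by auto
    then show ?case
      using rspan_step gram[of f g f' g'] by (simp add: ip_lincomb_right)
  qed
  moreover have "f \<in> L2" "g \<in> L2" "u \<in> L2" "v \<in> L2" "f' \<in> L2" "g' \<in> L2"
    using rspan_step S R by auto
  ultimately show ?case
    using rspan_step by (simp add: ip_lincomb_left)
qed

lemma lclE:
  assumes "f \<in> lcl A" "e > 0" obtains u where "u \<in> A" "ldist u f < e"
  using assms unfolding lcl_def by blast

lemma rclE:
  assumes "(f, g) \<in> rcl R" "e > 0" obtains u v where "(u, v) \<in> R" "ldist u f < e" "ldist v g < e"
  using assms unfolding rcl_def by blast

lemma lcl_L2: "lcl A \<subseteq> L2"
  by (auto simp: lcl_def)

lemma subset_lcl: "A \<subseteq> L2 \<Longrightarrow> A \<subseteq> lcl A"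
  by (force simp: lcl_def)

lemma lcl_mono: "A \<subseteq> B \<Longrightarrow> lcl A \<subseteq> lcl B"
  unfolding lcl_def by blast

lemma lcl_limit:
  assumes "\<And>k. f k \<in> A" "g \<in> L2" "(\<lambda>k. ldist (f k) g) \<longlonglongrightarrow> 0"
  shows "g \<in> lcl A"
proof -
  have "\<exists>u\<in>A. ldist u g < e" if "e > 0" for e
    using order_tendstoD(2)[OF assms(3) that] assms(1) by (meson eventually_sequentially order_refl)
  then show ?thesis
    using assms by (simp add: lcl_def)
qed

lemma lcl_idem:
  assumes "A \<subseteq> L2"
  shows "lcl (lcl A) = lcl A"
proof
  show "lcl (lcl A) \<subseteq> lcl A"
  proof
    fix f assume f: "f \<in> lcl (lcl A)"
    have "\<exists>v\<in>A. ldist v f < e" if "e > 0" for e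
    proof -
      from that have "e / 2 > 0" by simp
      then obtain u where u: "u \<in> lcl A" "ldist u f < e / 2"
        using f lclE by metis
      obtain v where v: "v \<in> A" "ldist v u < e / 2"
        using u(1) \<open>e / 2 > 0\<close> by (rule lclE)
      have "ldist v f \<le> ldist v u + ldist u f"
        using u v f assms lcl_L2 by (intro ldist_triangle) blast+
      with u v show ?thesis by (intro bexI[of _ v]) auto
    qed
    with f show "f \<in> lcl A" unfolding lcl_def by auto
  qed
qed (rule subset_lcl[OF lcl_L2])

lemma lcl_cong_AE:
  assumes "f \<in> lcl A" "A \<subseteq> L2" "g \<in> borel_measurable borel" "AE x in lborel. f x = g x"
  shows "g \<in> lcl A"
proof -
  have fL: "f \<in> L2" using assms lcl_L2 by blast
  have g: "g \<in> L2" by (rule L2_cong_AE[OF fL assms(3,4)])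
  have "ldist f g = 0"
    using assms fL by (intro ldist_AE_zeroI) (auto intro: L2_measurable)
  then have "g \<in> lcl (lcl A)"
    by (intro lcl_limit[where f = "\<lambda>_. f", OF assms(1) g]) simp
  then show ?thesis using lcl_idem assms by simp
qed

lemma ldist_lincomb:
  assumes "f \<in> L2" "g \<in> L2" "u \<in> L2" "v \<in> L2"
  shows "ldist (\<lambda>x. c * u x + v x) (\<lambda>x. c * f x + g x) \<le> cmod c * ldist u f + ldist v g"
proof -
  have "ldist (\<lambda>x. c * u x + v x) (\<lambda>x. c * f x + g x) 
      = L2norm (\<lambda>x. c * (u x - f x) + (v x - g x))"
    by (simp add: algebra_simps)
  also have "\<dots> \<le> L2norm (\<lambda>x. c * (u x - f x)) + L2norm (\<lambda>x. v x - g x)"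
    using assms by (intro L2norm_triangle L2_scale L2_diff)
  finally show ?thesis by (simp add: L2norm_scale)
qed

text \<open>The summand 1 in the denominator lets the estimate cover \<open>c = 0\<close>.\<close>

lemma less_half_scale:
  assumes "a < e / (2 * (cmod c + 1))" "a \<ge> 0"
  shows "cmod c * a < e / 2"
proof -
  have "2 * (cmod c + 1) > 0"
    by (simp add: add_nonneg_pos)
  then have "a * (2 * (cmod c + 1)) < e"
    using assms(1) pos_less_divide_eq by blast
  then have "2 * (cmod c * a) + 2 * a < e"
    by (simp add: algebra_simps)
  then show ?thesis
    using assms(2) by linarith
qed

lemma clspan_lincomb:
  assumes S: "S \<subseteq> L2" and f: "f \<in> clspan S" and g: "g \<in> clspan S"
  shows "(\<lambda>x. c * f x + g x) \<in> clspan S"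
proof -
  have "\<exists>w\<in>cspan S. ldist w (\<lambda>x. c * f x + g x) < e" if "e > 0" for e
  proof -
    have "e / (2 * (cmod c + 1)) > 0"
      using that by (simp add: add_nonneg_pos)
    then obtain u where u: "u \<in> cspan S" "ldist u f < e / (2 * (cmod c + 1))"
      using f unfolding lcl_def by blast
    obtain v where v: "v \<in> cspan S" "ldist v g < e / 2"
      using g half_gt_zero[OF \<open>e > 0\<close>] by (rule lclE)
    have "ldist (\<lambda>x. c * u x + v x) (\<lambda>x. c * f x + g x) \<le> cmod c * ldist u f + ldist v g"
      using u v f g cspan_L2[OF S] lcl_L2 by (intro ldist_lincomb) blast+
    also have "\<dots> < e"
      using less_half_scale[OF u(2)] v(2) by simp
    finally show ?thesis
      by (intro bexI[OF _ cspan_lincomb[OF u(1) v(1)]])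
  qed
  moreover have "(\<lambda>x. c * f x + g x) \<in> L2"
    using f g lcl_L2 by (intro L2_lincomb) blast+
  ultimately show ?thesis by (simp add: lcl_def)
qed

lemma clspan_subset:
  assumes S: "S \<subseteq> L2" and T: "T \<subseteq> clspan S"
  shows "clspan T \<subseteq> clspan S"
proof -
  have "f \<in> cspan T \<Longrightarrow> f \<in> clspan S" for f
  proof (induction rule: cspan.induct)
    case cspan_zero
    then show ?case
      using subset_lcl[OF cspan_L2[OF S]] cspan.cspan_zero by blast
  next
    case (cspan_step f g c)
    then show ?case using T by (intro clspan_lincomb[OF S]) auto
  qed
  then have "cspan T \<subseteq> clspan S" by blast
  then show ?thesis
    using lcl_mono lcl_idem[OF cspan_L2[OF S]] by blast
qed

section \<open>Closures of linear isometric relations\<close>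

lemma rcl_L2: "rcl R \<subseteq> L2 \<times> L2"
  by (auto simp: rcl_def)

lemma subset_rcl: "R \<subseteq> L2 \<times> L2 \<Longrightarrow> R \<subseteq> rcl R"
  by (force simp: rcl_def)

lemma rcl_limit:
  assumes "\<And>k. (f k, g k) \<in> R" "u \<in> L2" "v \<in> L2"
    and "(\<lambda>k. ldist (f k) u) \<longlonglongrightarrow> 0" "(\<lambda>k. ldist (g k) v) \<longlonglongrightarrow> 0"
  shows "(u, v) \<in> rcl R"
proof -
  have "\<exists>(u', v')\<in>R. ldist u' u < e \<and> ldist v' v < e" if "e > 0" for e
    using eventually_happens'[OF _ eventually_conj[OF order_tendstoD(2)[OF assms(4) that] order_tendstoD(2)[OF assms(5) that]]]
      assms(1) by fastforce
  then show ?thesis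
    using assms by (simp add: rcl_def)
qed

lemma rcl_converse: "rcl (R\<inverse>) = (rcl R)\<inverse>"
proof -
  have *: "(g, f) \<in> rcl (R\<inverse>)" if "(f, g) \<in> rcl R" for f g R
  proof -
    have "\<exists>(v, u)\<in>R\<inverse>. ldist v g < e \<and> ldist u f < e" if "e > 0" for e
    proof -
      obtain u v where "(u, v) \<in> R" "ldist u f < e" "ldist v g < e"
        using \<open>(f, g) \<in> rcl R\<close> \<open>e > 0\<close> by (rule rclE)
      then show ?thesis by (intro bexI[of _ "(v, u)"]) auto
    qed
    then show ?thesis
      using that rcl_L2[of R] by (auto simp: rcl_def)
  qed
  from *[of _ _ R] *[of _ _ "R\<inverse>"] show ?thesis by auto
qed

lemma rcl_lincomb:
  assumes S: "S \<subseteq> L2 \<times> L2" and f: "(f, f') \<in> rcl (rspan S)" and g: "(g, g') \<in> rcl (rspan S)"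
  shows "(\<lambda>x. c * f x + g x, \<lambda>x. c * f' x + g' x) \<in> rcl (rspan S)"
proof -
  have L: "f \<in> L2" "f' \<in> L2" "g \<in> L2" "g' \<in> L2"
    using f g rcl_L2 by auto
  have "\<exists>(w, w')\<in>rspan S. ldist w (\<lambda>x. c * f x + g x) < e \<and> ldist w' (\<lambda>x. c * f' x + g' x) < e"
    if "e > 0" for e
  proof -
    have "e / (2 * (cmod c + 1)) > 0"
      using that by (simp add: add_nonneg_pos)
    then obtain u u' where u: "(u, u') \<in> rspan S" 
        "ldist u f < e / (2 * (cmod c + 1))" "ldist u' f' < e / (2 * (cmod c + 1))"
      using f unfolding rcl_def by blast
    obtain v v' where v: "(v, v') \<in> rspan S" "ldist v g < e / 2" "ldist v' g' < e / 2"
      using g half_gt_zero[OF \<open>e > 0\<close>] by (rule rclE)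
    have L': "u \<in> L2" "u' \<in> L2" "v \<in> L2" "v' \<in> L2"
      using u v rspan_L2[OF S] by auto
    have "ldist (\<lambda>x. c * u x + v x) (\<lambda>x. c * f x + g x) < e"
      using ldist_lincomb[of f g u v c] less_half_scale[OF u(2)] v L L' by simp
    moreover have "ldist (\<lambda>x. c * u' x + v' x) (\<lambda>x. c * f' x + g' x) < e"
      using ldist_lincomb[of f' g' u' v' c] less_half_scale[OF u(3)] v L L' by simp
    ultimately show ?thesis
      by (intro bexI[OF _ rspan_lincomb[OF u(1) v(1)]]) simp
  qed
  then show ?thesis
    using L L2_lincomb by (simp add: rcl_def)
qed

lemma rcl_cong_AE:
  assumes R: "R \<subseteq> L2 \<times> L2" and fg: "(f, g) \<in> rcl R"
    and u: "u \<in> borel_measurable borel" "AE x in lborel. f x = u x"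
    and v: "v \<in> borel_measurable borel" "AE x in lborel. g x = v x"
  shows "(u, v) \<in> rcl R"
proof -
  have L: "f \<in> L2" "g \<in> L2"
    using fg rcl_L2 by auto
  then have uv: "u \<in> L2" "v \<in> L2"
    using L2_cong_AE[OF L(1) u] L2_cong_AE[OF L(2) v] by auto
  have 1: "ldist w u = ldist w f" if "w \<in> L2" for w
    using that u L uv by (intro L2norm_cong_AE) (auto intro!: L2_measurable L2_diff elim!: eventually_mono)
  have 2: "ldist w v = ldist w g" if "w \<in> L2" for w
    using that v L uv by (intro L2norm_cong_AE) (auto intro!: L2_measurable L2_diff elim!: eventually_mono)
  have "\<exists>(a, b)\<in>R. ldist a u < e \<and> ldist b v < e" if "e > 0" for e
  proof -
    obtain a b where ab: "(a, b) \<in> R" "ldist a f < e" "ldist b g < e"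
      using fg \<open>e > 0\<close> by (rule rclE)
    moreover have "a \<in> L2" "b \<in> L2" using ab R by auto
    ultimately show ?thesis using 1[of a] 2[of b] by (intro bexI[of _ "(a, b)"]) auto
  qed
  then show ?thesis
    using uv by (simp add: rcl_def)
qed

lemma rcl_isometric:
  assumes R: "R \<subseteq> L2 \<times> L2" and iso: "\<And>f g. (f, g) \<in> R \<Longrightarrow> L2norm g = L2norm f"
    and fg: "(f, g) \<in> rcl R"
  shows "L2norm g = L2norm f"
proof -
  have L: "f \<in> L2" "g \<in> L2"
    using fg rcl_L2 by auto
  have "\<bar>L2norm g - L2norm f\<bar> < e" if "e > 0" for e
  proof -
    obtain u v where uv: "(u, v) \<in> R" "ldist u f < e / 2" "ldist v g < e / 2"
      using fg half_gt_zero[OF \<open>e > 0\<close>] by (rule rclE)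
    then have "u \<in> L2" "v \<in> L2" using R by auto
    then show ?thesis
      using ldist_L2norm_diff[of u f] ldist_L2norm_diff[of v g] iso[OF uv(1)] L uv by linarith
  qed
  then show ?thesis
    by (metis abs_le_zero_iff dense_ge eq_iff_diff_eq_0 order_less_imp_le)
qed

lemma rspan_isometric:
  assumes S: "S \<subseteq> L2 \<times> L2"
    and gram: "\<And>f g f' g'. (f, g) \<in> S \<Longrightarrow> (f', g') \<in> S \<Longrightarrow> ip g g' = ip f f'"
    and "(f, g) \<in> rspan S"
  shows "L2norm g = L2norm f"
proof -
  have "complex_of_real ((L2norm g)\<^sup>2) = of_real ((L2norm f)\<^sup>2)"
    using rspan_ip[OF S gram assms(3,3)] by (simp only: ip_self)
  then have "(L2norm g)\<^sup>2 = (L2norm f)\<^sup>2"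
    by (rule of_real_eq_iff[THEN iffD1])
  then show ?thesis by simp
qed

lemma rcl_rspan_isometric:
  assumes S: "S \<subseteq> L2 \<times> L2"
    and gram: "\<And>f g f' g'. (f, g) \<in> S \<Longrightarrow> (f', g') \<in> S \<Longrightarrow> ip g g' = ip f f'"
    and "(f, g) \<in> rcl (rspan S)"
  shows "L2norm g = L2norm f"
  by (rule rcl_isometric[OF rspan_L2[OF S] _ assms(3)]) (rule rspan_isometric[OF S gram])

text \<open>Differences of pairs are again pairs, so isometry sends a sequence approximating
  \<open>f\<close> to a Cauchy sequence; completeness supplies its limit.\<close>

lemma rcl_total:
  assumes S: "S \<subseteq> L2 \<times> L2" and iso: "\<And>f g. (f, g) \<in> rspan S \<Longrightarrow> L2norm g = L2norm f"
    and f: "f \<in> clspan (Domain S)"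
  shows "\<exists>g. (f, g) \<in> rcl (rspan S)"
proof -
  have fL: "f \<in> L2" using f lcl_L2 by blast
  note R = rspan_L2[OF S]
  have "\<exists>u v. (u, v) \<in> rspan S \<and> ldist u f < 1 / Suc k" for k
    using f unfolding lcl_def Domain_rspan[symmetric] by (force dest!: spec[of _ "1 / Suc k"])
  then obtain u v where uv: "\<And>k. (u k, v k) \<in> rspan S" and d: "\<And>k. ldist (u k) f < 1 / Suc k"
    by metis
  have L: "u k \<in> L2" "v k \<in> L2" for k
    using uv R by auto
  have lim: "(\<lambda>k. ldist (u k) f) \<longlonglongrightarrow> 0"
    by (rule tendsto_sandwich[OF _ _ tendsto_const LIMSEQ_inverse_real_of_nat])
       (use d in \<open>auto intro!: always_eventually simp: inverse_eq_divide less_imp_le\<close>)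
  have "\<exists>g\<in>L2. (\<lambda>k. ldist (v k) g) \<longlonglongrightarrow> 0"
  proof (rule L2_complete)
    fix e :: real assume "e > 0"
    then obtain N where N: "\<And>k. k \<ge> N \<Longrightarrow> ldist (u k) f < e / 2"
      using order_tendstoD(2)[OF lim, of "e / 2"] by (auto simp: eventually_sequentially)
    have "ldist (v i) (v j) < e" if "i \<ge> N" "j \<ge> N" for i j
    proof -
      have "(\<lambda>x. - 1 * u j x + u i x, \<lambda>x. - 1 * v j x + v i x) \<in> rspan S"
        using uv by (intro rspan_lincomb)
      from iso[OF this] have "ldist (v i) (v j) = ldist (u i) (u j)"
        by (simp add: algebra_simps)
      also have "\<dots> \<le> ldist (u i) f + ldist f (u j)"
        using L fL by (intro ldist_triangle)
      also have "\<dots> < e"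
        using N[OF that(1)] N[OF that(2)] by (simp add: ldist_commute[of f])
      finally show ?thesis .
    qed
    then show "\<exists>N. \<forall>i\<ge>N. \<forall>j\<ge>N. ldist (v i) (v j) < e" by blast
  qed (use L in auto)
  then obtain g where g: "g \<in> L2" "(\<lambda>k. ldist (v k) g) \<longlonglongrightarrow> 0" by blast
  show ?thesis
    using rcl_limit[OF uv fL g(1) lim g(2)] by blast
qed

text \<open>Two values at almost equal arguments differ by the second component of a pair whose
  first component is null, so isometry makes the closed relation single valued up to null sets;
  linearity of \<open>T\<close> is then inherited from the relation. Surjectivity is totality of the
  converse relation, which satisfies the same hypotheses.\<close>

lemma unitary_extension:
  assumes S: "S \<subseteq> L2 \<times> L2"
    and gram: "\<And>f g f' g'. (f, g) \<in> S \<Longrightarrow> (f', g') \<in> S \<Longrightarrow> ip g g' = ip f f'"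
    and dom: "clspan (Domain S) = L2" and ran: "clspan (Range S) = L2"
  obtains T where "L2_bounded_linear T" "L2_unitary T"
    "\<And>f g. (f, g) \<in> rcl (rspan S) \<Longrightarrow> AE x in lborel. T f x = g x"
proof -
  let ?R = "rcl (rspan S)"
  note RL = rspan_L2[OF S]
  have iso0: "L2norm g = L2norm f" if "(f, g) \<in> rspan S" for f g
    by (rule rspan_isometric[OF S gram that])
  have iso: "L2norm g = L2norm f" if "(f, g) \<in> ?R" for f g
    by (rule rcl_rspan_isometric[OF S gram that])
  have unique: "AE x in lborel. g x = h x" if "(f, g) \<in> ?R" "(f', h) \<in> ?R" "AE x in lborel. f x = f' x" for f f' g h
  proof -
    have L: "f \<in> L2" "f' \<in> L2" "g \<in> L2" "h \<in> L2"
      using that rcl_L2 by auto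
    have "(\<lambda>x. - 1 * f' x + f x, \<lambda>x. - 1 * h x + g x) \<in> ?R"
      using that by (intro rcl_lincomb[OF S])
    from iso[OF this] have "ldist g h = ldist f f'"
      by (simp add: algebra_simps)
    also have "\<dots> = 0"
      using L that by (intro ldist_AE_zeroI L2_measurable)
    finally have "AE x in lborel. g x - h x = 0"
      using L by (intro L2norm_eq_0D L2_diff)
    then show ?thesis by simp
  qed
  have "\<exists>g. (f, g) \<in> ?R" if "f \<in> L2" for f
    using rcl_total[OF S iso0] dom that by blast
  \<comment> \<open>An arbitrary representative is chosen for each \<open>f\<close>; pointwise
    equations for \<open>T\<close> can therefore hold only almost everywhere.\<close>
  then obtain T where T: "\<And>f. f \<in> L2 \<Longrightarrow> (f, T f) \<in> ?R"
    by metis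
  have surj: "\<exists>f\<in>L2. AE x in lborel. T f x = g x" if g: "g \<in> L2" for g
  proof -
    have conv: "rspan (S\<inverse>) = (rspan S)\<inverse>"
    proof -
      have "(f, g) \<in> rspan (S\<inverse>) \<Longrightarrow> (g, f) \<in> rspan S" for f g S
        by (induction rule: rspan.induct) (auto intro: rspan.intros)
      from this[of _ _ S] this[of _ _ "S\<inverse>"] show ?thesis by auto
    qed
    have "\<exists>f. (g, f) \<in> rcl (rspan (S\<inverse>))"
      by (rule rcl_total) (use S iso0 ran g in \<open>auto simp: conv\<close>)
    then obtain f where f: "(f, g) \<in> ?R"
      by (auto simp: conv rcl_converse)
    then have fL: "f \<in> L2" using rcl_L2 by auto
    show ?thesis
      using unique[OF T[OF fL] f] fL by auto
  qed
  show ?thesis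
  proof (rule that[of T])
    have TL: "T f \<in> L2" if "f \<in> L2" for f
      using T[OF that] rcl_L2 by auto
    have norm: "L2norm (T f) = L2norm f" if "f \<in> L2" for f
      using iso[OF T[OF that]] .
    show "L2_unitary T"
      unfolding L2_unitary_def using norm surj by blast
    have lin: "AE x in lborel. T (\<lambda>t. a * f t + b * g t) x = a * T f x + b * T g x"
      if fg: "f \<in> L2" "g \<in> L2" for f g a b
    proof -
      have 0: "(\<lambda>x. 0, \<lambda>x. 0) \<in> ?R"
        using subset_rcl[OF RL] rspan_zero by blast
      have b: "(\<lambda>x. b * g x, \<lambda>x. b * T g x) \<in> ?R"
        using rcl_lincomb[OF S T[OF fg(2)] 0, of b] by simp
      have A: "(\<lambda>x. a * f x + b * g x, \<lambda>x. a * T f x + b * T g x) \<in> ?R"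
        using rcl_lincomb[OF S T[OF fg(1)] b, of a] .
      have B: "(\<lambda>x. a * f x + b * g x, T (\<lambda>x. a * f x + b * g x)) \<in> ?R"
        using fg by (intro T L2_lincomb L2_scale)
      show ?thesis
        by (rule unique[OF B A]) simp
    qed
    show "L2_bounded_linear T"
      unfolding L2_bounded_linear_def
    proof (intro conjI ballI allI impI)
      show "\<exists>C. \<forall>f\<in>L2. L2norm (T f) \<le> C * L2norm f"
        using norm by (intro exI[of _ 1]) simp
      show "AE x in lborel. T f x = T g x" if "f \<in> L2" "g \<in> L2" "AE x in lborel. f x = g x" for f g
        by (rule unique[OF T T]) (use that in auto)
    qed (use TL lin in auto)
    show "AE x in lborel. T f x = g x" if "(f, g) \<in> ?R" for f g
    proof -
      have "f \<in> L2" using that rcl_L2 by auto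
      then show ?thesis
        using unique[OF T that] by auto
    qed
  qed
qed

lemma L2norm_lincomb_power2:
  assumes "f \<in> L2" "g \<in> L2"
  shows "(L2norm (\<lambda>x. c * f x + g x))\<^sup>2 = (cmod c)\<^sup>2 * (L2norm f)\<^sup>2 + (L2norm g)\<^sup>2 + 2 * Re (c * ip f g)"
proof -
  have "complex_of_real ((L2norm (\<lambda>x. c * f x + g x))\<^sup>2) = ip (\<lambda>x. c * f x + g x) (\<lambda>x. c * f x + g x)"
    by (simp add: ip_self)
  also have "\<dots> = c * cnj c * ip f f + c * ip f g + cnj (c * ip f g) + ip g g"
    unfolding ip_lincomb_left[OF assms L2_lincomb[OF assms]] ip_lincomb_right[OF assms assms(1)] ip_lincomb_right[OF assms assms(2)]
    by (simp add: ip_cnj[of g f] algebra_simps)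
  finally have "(L2norm (\<lambda>x. c * f x + g x))\<^sup>2 = Re (c * cnj c * ip f f + c * ip f g + cnj (c * ip f g) + ip g g)"
    by (metis Re_complex_of_real)
  also have "\<dots> = Re (of_real ((cmod c)\<^sup>2) * of_real ((L2norm f)\<^sup>2)) + (L2norm g)\<^sup>2 + 2 * Re (c * ip f g)"
    by (simp add: ip_self complex_norm_square del: of_real_power)
  finally show ?thesis
    by (simp flip: of_real_mult)
qed

text \<open>Polarization: the norms of c g + g' and c f + f' agree because the closed relation is
  linear and isometric, and expanding their squares leaves the real parts of c times the inner
  products. The choices 1 and -i for c give the real and the imaginary part.\<close>

lemma rcl_ip:
  assumes S: "S \<subseteq> L2 \<times> L2"
    and gram: "\<And>f g f' g'. (f, g) \<in> S \<Longrightarrow> (f', g') \<in> S \<Longrightarrow> ip g g' = ip f f'"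
    and fg: "(f, g) \<in> rcl (rspan S)" and fg': "(f', g') \<in> rcl (rspan S)"
  shows "ip g g' = ip f f'"
proof -
  have L: "f \<in> L2" "g \<in> L2" "f' \<in> L2" "g' \<in> L2"
    using fg fg' rcl_L2 by auto
  have "Re (c * ip g g') = Re (c * ip f f')" for c
  proof -
    have "L2norm (\<lambda>x. c * g x + g' x) = L2norm (\<lambda>x. c * f x + f' x)"
      by (rule rcl_rspan_isometric[OF S gram rcl_lincomb[OF S fg fg']])
    then show ?thesis
      using L2norm_lincomb_power2[OF L(1,3), of c] L2norm_lincomb_power2[OF L(2,4), of c]
        rcl_rspan_isometric[OF S gram fg] rcl_rspan_isometric[OF S gram fg'] by simp
  qed
  from this[of 1] this[of "- \<i>"] show ?thesis
    by (simp add: complex_eq_iff)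
qed

lemma cspan_sum:
  assumes "finite I" "\<And>i. i \<in> I \<Longrightarrow> f i \<in> cspan S"
  shows "(\<lambda>x. \<Sum>i\<in>I. c i * f i x) \<in> cspan S"
  using assms by (induction I rule: finite_induct) (auto intro!: cspan_lincomb cspan_zero)

subsection \<open>Density of step functions\<close>

text \<open>The box between 0 and \<open>a\<close>, for \<open>a\<close> of either sign. One free
  end point per generator suffices, since every interval is up to null sets a combination of two
  such boxes.\<close>

definition sbox :: "real \<Rightarrow> real \<Rightarrow> complex" where
  "sbox a x = of_real (indicator {min 0 a..max 0 a} x)"

definition ebox :: "real \<Rightarrow> real \<Rightarrow> complex" where
  "ebox a x = of_real (indicator {- a..a} x)"

lemma integrable_indicator_Icc_power2: "integrable lborel (\<lambda>x::real. (indicator {a..b} x :: real)\<^sup>2)"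
proof -
  have "(\<lambda>x::real. (indicator {a..b} x :: real)\<^sup>2) = indicator {a..b}"
    by (auto simp: indicator_def)
  moreover have "integrable lborel (indicator {a..b} :: real \<Rightarrow> real)"
    by (intro integrable_real_indicator) (auto simp: emeasure_lborel_Icc_eq)
  ultimately show ?thesis by simp
qed

lemma indicator_dominated_L2:
  assumes "A \<in> sets borel" "A \<subseteq> {a..b}"
  shows "(\<lambda>x. complex_of_real (indicator A x)) \<in> L2"
proof (rule L2_dominated)
  show "integrable lborel (\<lambda>x. (indicator {a..b} x :: real)\<^sup>2)"
    by (rule integrable_indicator_Icc_power2)
  show "AE x in lborel. cmod (complex_of_real (indicator A x)) \<le> indicator {a..b} x"
    using assms by (intro AE_I2) (auto simp: indicator_def)
qed (use assms in auto)

lemma sbox_L2: "sbox a \<in> L2"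
  using indicator_dominated_L2[of "{min 0 a..max 0 a}" "min 0 a" "max 0 a"] by (simp add: sbox_def[abs_def])

lemma ebox_L2: "ebox a \<in> L2"
  using indicator_dominated_L2[of "{-a..a}" "- a" a] by (simp add: ebox_def[abs_def])

text \<open>Moving the free end point is continuous in L2: only \<open>x = a\<close> escapes the
  pointwise limit, and the boxes whose end point is within 1 of \<open>a\<close> all lie under one
  larger box.\<close>

lemma sbox_limit:
  assumes "\<And>e. e > 0 \<Longrightarrow> \<exists>d\<in>D. \<bar>d - a\<bar> < e"
  shows "sbox a \<in> lcl (sbox ` D)"
proof -
  have "\<exists>d\<in>D. \<bar>d - a\<bar> < 1 / Suc k" for k
    using assms by simp
  then obtain d where d: "\<And>k. d k \<in> D" "\<And>k. \<bar>d k - a\<bar> < 1 / Suc k"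
    by metis
  have "(\<lambda>k. \<bar>d k - a\<bar>) \<longlonglongrightarrow> 0"
    by (rule tendsto_sandwich[OF _ _ tendsto_const LIMSEQ_inverse_real_of_nat])
       (use d in \<open>auto intro!: always_eventually simp: inverse_eq_divide less_imp_le\<close>)
  then have lim: "d \<longlonglongrightarrow> a"
    by (simp add: tendsto_rabs_zero_iff LIM_zero_iff)
  have meas: "sbox c \<in> borel_measurable borel" for c
    using sbox_L2 by (rule L2_measurable)
  show ?thesis
  proof (rule lcl_limit[where f = "\<lambda>k. sbox (d k)"])
    show "(\<lambda>k. ldist (sbox (d k)) (sbox a)) \<longlonglongrightarrow> 0"
    proof (rule L2_dominated_convergence(3))
      show "integrable lborel (\<lambda>x. (indicator {- \<bar>a\<bar> - 1..\<bar>a\<bar> + 1} x :: real)\<^sup>2)"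
        by (rule integrable_indicator_Icc_power2)
      show "AE x in lborel. cmod (sbox (d k) x) \<le> indicator {- \<bar>a\<bar> - 1..\<bar>a\<bar> + 1} x" for k
      proof (rule AE_I2)
        fix x
        have "\<bar>d k - a\<bar> < 1"
          using d(2)[of k] by (rule less_le_trans) simp
        then show "cmod (sbox (d k) x) \<le> indicator {- \<bar>a\<bar> - 1..\<bar>a\<bar> + 1} x"
          by (auto simp: sbox_def indicator_def split: if_splits)
      qed
      show "AE x in lborel. (\<lambda>k. sbox (d k) x) \<longlonglongrightarrow> sbox a x"
        using AE_lborel_singleton[of a]
      proof eventually_elim
        case (elim x)
        have "eventually (\<lambda>k. sbox (d k) x = sbox a x) sequentially"
        proof (cases "x < a")
          case True
          show ?thesis
            using order_tendstoD(1)[OF lim True] by eventually_elim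
              (use True in \<open>auto simp: sbox_def indicator_def\<close>)
        next
          case False
          then have "a < x" using elim by simp
          show ?thesis
            using order_tendstoD(2)[OF lim \<open>a < x\<close>] by eventually_elim
              (use \<open>a < x\<close> in \<open>auto simp: sbox_def indicator_def\<close>)
        qed
        then show ?case by (rule tendsto_eventually)
      qed
    qed (use meas in auto)
  qed (use d sbox_L2 in auto)
qed

lemma clspan_zero: "S \<subseteq> L2 \<Longrightarrow> (\<lambda>x. 0) \<in> clspan S"
  using subset_lcl[OF cspan_L2] cspan_zero by blast

lemma clspan_scale:
  assumes "S \<subseteq> L2" "f \<in> clspan S" shows "(\<lambda>x. c * f x) \<in> clspan S"
  using clspan_lincomb[OF assms clspan_zero[OF assms(1)], of c] by simp

lemma clspan_add:
  assumes "S \<subseteq> L2" "f \<in> clspan S" "g \<in> clspan S" shows "(\<lambda>x. f x + g x) \<in> clspan S"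
  using clspan_lincomb[OF assms, of 1] by simp

lemma clspan_base: "S \<subseteq> L2 \<Longrightarrow> f \<in> S \<Longrightarrow> f \<in> clspan S"
  using subset_lcl[OF cspan_L2] cspan_base by blast

lemma clspan_sum:
  assumes "S \<subseteq> L2" "finite I" "\<And>i. i \<in> I \<Longrightarrow> f i \<in> clspan S"
  shows "(\<lambda>x. \<Sum>i\<in>I. c i * f i x) \<in> clspan S"
  using assms(2,3)
  by (induction I rule: finite_induct) (auto intro!: clspan_lincomb clspan_zero assms(1))

lemma clspan_limit:
  assumes "S \<subseteq> L2" "\<And>k. f k \<in> clspan S" "g \<in> L2" "(\<lambda>k. ldist (f k) g) \<longlonglongrightarrow> 0"
  shows "g \<in> clspan S"
  using lcl_limit[OF assms(2-4)] lcl_idem[OF cspan_L2[OF assms(1)]] by simp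

text \<open>The sets whose truncated indicators lie in the closed span contain the half lines and
  are closed under complements and countable disjoint unions; by Dynkin's theorem they are all Borel
  sets. Truncation to (-N, N] keeps the indicators in L2. Truncated simple functions bounded by
  \<open>2 * cmod (f x)\<close> then reach \<open>f\<close>.\<close>

lemma sbox_dense: "clspan (range sbox) = L2"
proof
  let ?M = "clspan (range sbox)"
  have S: "range sbox \<subseteq> L2"
    using sbox_L2 by auto
  have set: "(\<lambda>x. complex_of_real (indicator (A \<inter> {- real N<..real N}) x)) \<in> ?M"
    if A: "A \<in> sets borel" for A N
  proof -
    let ?N = "{- real N<..real N}" and ?c = "\<lambda>A x. complex_of_real (indicator A x)"
    have Aset: "A \<in> sigma_sets UNIV (range atMost)"
      using A unfolding borel_eq_atMost by simp
    \<comment> \<open>For \<open>c > 0\<close> the interval is the union of the boxes of -N and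
      \<open>c\<close>, for \<open>c < 0\<close> their difference; \<open>sgn c\<close> selects the
      sign, and its value 0 at 0 settles \<open>c = 0\<close>.\<close>
    have whole: "(\<lambda>x. complex_of_real (indicator {- real N<..c} x)) \<in> ?M" if "- real N \<le> c" for c
    proof (rule lcl_cong_AE)
      show "(\<lambda>x. of_real (sgn c) * sbox c x + sbox (- real N) x) \<in> ?M"
        by (intro clspan_lincomb clspan_base S) auto
      show "AE x in lborel. of_real (sgn c) * sbox c x + sbox (- real N) x = complex_of_real (indicator {- real N<..c} x)"
        using AE_lborel_singleton[of c] AE_lborel_singleton[of "0::real"] AE_lborel_singleton[of "- real N"]
        by eventually_elim (use that in \<open>auto simp: sbox_def indicator_def sgn_if\<close>)
    qed (use cspan_L2[OF S] in auto)
    have st: "Int_stable (range (atMost :: real \<Rightarrow> _))" and sub: "range (atMost :: real \<Rightarrow> _) \<subseteq> Pow UNIV"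
      by (auto simp: Int_stable_def)
    show ?thesis
      using st sub Aset
    proof (induction rule: sigma_sets_induct_disjoint)
      case (basic A)
      then obtain a where a: "A = {..a}" by auto
      show ?case
      proof (cases "min a (real N) \<ge> - real N")
        case True
        have "A \<inter> ?N = {- real N<..min a (real N)}"
          by (auto simp: a)
        then show ?thesis using whole[OF True] by simp
      next
        case False
        then have "A \<inter> ?N = {}"
          by (auto simp: a)
        then show ?thesis using clspan_zero[OF S] by simp
      qed
    next
      case empty
      then show ?case using clspan_zero[OF S] by simp
    next
      case (compl A)
      have "(\<lambda>x. - 1 * ?c (A \<inter> ?N) x + of_real (indicator ?N x)) \<in> ?M"
        by (intro clspan_lincomb[OF S] compl.IH whole) auto
      also have "(\<lambda>x. - 1 * ?c (A \<inter> ?N) x + of_real (indicator ?N x))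
          = (\<lambda>x. ?c ((UNIV - A) \<inter> ?N) x)"
        by (auto simp: indicator_def)
      finally show ?case .
    next
      case (union A)
      have Ab: "A i \<in> sets borel" for i
        using union unfolding borel_eq_atMost by auto
      have U: "(\<Union>i<k. A i) \<inter> ?N \<in> sets borel" for k
        using Ab by auto
      show ?case
      proof (rule clspan_limit[OF S])
        show "(\<lambda>x. ?c ((\<Union>i<k. A i) \<inter> ?N) x) \<in> ?M" for k
        proof -
          have "(\<lambda>x. \<Sum>i<k. 1 * ?c (A i \<inter> ?N) x) \<in> ?M"
            by (intro clspan_sum[OF S] union.IH) auto
          also have "(\<lambda>x. \<Sum>i<k. 1 * ?c (A i \<inter> ?N) x)
              = (\<lambda>x. ?c ((\<Union>i<k. A i) \<inter> ?N) x)"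
          proof
            fix x
            have "disjoint_family_on (\<lambda>i. A i \<inter> ?N) {..<k}"
              using union.hyps unfolding disjoint_family_on_def by blast
            then have "indicator (\<Union>i<k. A i \<inter> ?N) x 
                = (\<Sum>i<k. indicator (A i \<inter> ?N) x :: real)"
              by (intro indicator_UN_disjoint) auto
            then show "(\<Sum>i<k. 1 * ?c (A i \<inter> ?N) x)
              = ?c ((\<Union>i<k. A i) \<inter> ?N) x"
              by (simp flip: of_real_sum)
          qed
          finally show ?thesis .
        qed
        have UU: "(\<Union>i. A i) \<inter> ?N \<in> sets borel"
          using Ab by auto
        then show "(\<lambda>x. ?c ((\<Union>i. A i) \<inter> ?N) x) \<in> L2"
          by (rule indicator_dominated_L2[where a = "- real N" and b = "real N"]) auto
        show "(\<lambda>k. ldist (\<lambda>x. ?c ((\<Union>i<k. A i) \<inter> ?N) x)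
            (\<lambda>x. ?c ((\<Union>i. A i) \<inter> ?N) x)) \<longlonglongrightarrow> 0"
        proof (rule L2_dominated_convergence(3))
          show "integrable lborel (\<lambda>x. (indicator {- real N..real N} x :: real)\<^sup>2)"
            by (rule integrable_indicator_Icc_power2)
          show "AE x in lborel. (\<lambda>k. ?c ((\<Union>i<k. A i) \<inter> ?N) x)
             \<longlonglongrightarrow> ?c ((\<Union>i. A i) \<inter> ?N) x"
          proof (rule AE_I2)
            fix x
            have "eventually (\<lambda>k. x \<in> (\<Union>i<k. A i) \<longleftrightarrow> x \<in> (\<Union>i. A i)) sequentially"
            proof (cases "x \<in> (\<Union>i. A i)")
              case True
              then obtain i where "x \<in> A i" by blast
              show ?thesis
                using eventually_gt_at_top[of i] by eventually_elim (use \<open>x \<in> A i\<close> in auto)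
            qed auto
            then show "(\<lambda>k. ?c ((\<Union>i<k. A i) \<inter> ?N) x)
             \<longlonglongrightarrow> ?c ((\<Union>i. A i) \<inter> ?N) x"
              by (intro tendsto_eventually) (auto elim!: eventually_mono simp: indicator_def)
          qed
          show "AE x in lborel. cmod (?c ((\<Union>i<k. A i) \<inter> ?N) x)
              \<le> indicator {- real N..real N} x" for k
            by (intro AE_I2) (auto simp: indicator_def)
        qed (use U UU in \<open>auto simp del: indicator_simps\<close>)
      qed
    qed
  qed
  show "L2 \<subseteq> ?M"
  proof
    fix f assume f: "f \<in> L2"
    then have fm: "f \<in> borel_measurable borel" by (rule L2_measurable)
    obtain F where F: "\<And>i. simple_function borel (F i)" "\<And>x. (\<lambda>i. F i x) \<longlonglongrightarrow> f x"
      "\<And>i x. cmod (F i x) \<le> 2 * cmod (f x)"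
      using borel_measurable_implies_sequence_metric[OF fm, of 0] by auto
    define I where "I = (\<lambda>N::nat. {- real N<..real N})"
    have Fm: "F i \<in> borel_measurable borel" for i
      using F(1) by (rule borel_measurable_simple_function)
    show "f \<in> ?M"
    proof (rule clspan_limit[OF S _ f])
      show "(\<lambda>x. F i x * of_real (indicator (I i) x)) \<in> ?M" for i
      proof -
        have fin: "finite (range (F i))"
          using F(1)[of i] by (simp add: simple_function_def)
        have "(\<lambda>x. \<Sum>y\<in>range (F i). y * of_real (indicator (F i -` {y} \<inter> I i) x)) \<in> ?M"
          using set[OF measurable_sets_borel[OF Fm]] by (intro clspan_sum[OF S fin]) (auto simp: I_def)
        also have "(\<lambda>x. \<Sum>y\<in>range (F i). y * of_real (indicator (F i -` {y} \<inter> I i) x))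
            = (\<lambda>x. F i x * of_real (indicator (I i) x))"
        proof
          fix x
          have "(\<Sum>y\<in>range (F i). y * of_real (indicator (F i -` {y} \<inter> I i) x))
              = (\<Sum>y\<in>range (F i). if y = F i x then y * of_real (indicator (I i) x) else 0)"
            by (intro sum.cong) (auto simp: indicator_def)
          then show "(\<Sum>y\<in>range (F i). y * of_real (indicator (F i -` {y} \<inter> I i) x)) = F i x * of_real (indicator (I i) x)"
            using fin by simp
        qed
        finally show ?thesis .
      qed
      have bound: "cmod (F k x * of_real (indicator (I k) x)) \<le> 2 * cmod (f x)" for k x
        using F(3)[of k x] by (cases "x \<in> I k") simp_all
      have lim: "(\<lambda>k. F k x * of_real (indicator (I k) x)) \<longlonglongrightarrow> f x" for x
      proof -
        obtain n :: nat where n: "\<bar>x\<bar> < n" using reals_Archimedean2 by blast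
        have "eventually (\<lambda>k. F k x = F k x * of_real (indicator (I k) x)) sequentially"
          using eventually_ge_at_top[of n]
        proof eventually_elim
          case (elim k)
          then have "x \<in> I k"
            using n by (auto simp: I_def)
          then show ?case by simp
        qed
        then show ?thesis
          by (rule Lim_transform_eventually[OF F(2)])
      qed
      have meas: "(\<lambda>x. F k x * of_real (indicator (I k) x)) \<in> borel_measurable borel" for k
        using Fm[of k] by (intro borel_measurable_times) (auto simp: I_def)
      have int: "integrable lborel (\<lambda>x. (2 * cmod (f x))\<^sup>2)"
        using L2_integrable[OF f] by (simp add: power_mult_distrib)
      show "(\<lambda>k. ldist (\<lambda>x. F k x * of_real (indicator (I k) x)) f) \<longlonglongrightarrow> 0"
        by (rule L2_dominated_convergence(3)[OF meas fm int AE_I2[OF bound] AE_I2[OF lim]])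
    qed
  qed
qed (rule lcl_L2)

text \<open>Two sets of end points occur: all positive reals when the unitary operator is
  constructed, and the dyadic rationals, which are the ones realized in the spaces
  \<open>Vplus j\<close>, when two extensions are compared.\<close>

locale dense_pos =
  fixes D :: "real set"
  assumes pos: "\<And>d. d \<in> D \<Longrightarrow> d > 0"
    and approx: "\<And>x e. x > 0 \<Longrightarrow> e > 0 \<Longrightarrow> \<exists>d\<in>D. \<bar>d - x\<bar> < e"
begin

lemma sbox_dense_D: "clspan (sbox ` (D \<union> uminus ` D)) = L2"
proof -
  let ?B = "D \<union> uminus ` D"
  have S: "sbox ` ?B \<subseteq> L2" using sbox_L2 by auto
  have dn: "\<exists>d\<in>?B. \<bar>d - a\<bar> < e" if "e > 0" for a e
  proof -
    consider "a > 0" | "a < 0" | "a = 0" by linarith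
    then show ?thesis
    proof cases
      case 1
      then show ?thesis using approx[OF 1 that] by auto
    next
      case 2
      then obtain d where "d \<in> D" "\<bar>d - - a\<bar> < e" using approx[of "- a" e] \<open>e > 0\<close> by auto
      then show ?thesis by (intro bexI[of _ "- d"]) auto
    next
      case 3
      obtain d where "d \<in> D" "\<bar>d - e / 2\<bar> < e / 2" using approx[of "e / 2" "e / 2"] \<open>e > 0\<close> by auto
      then have "\<bar>d\<bar> < e" by arith
      then show ?thesis using 3 \<open>d \<in> D\<close> by (intro bexI[of _ d]) auto
    qed
  qed
  have "sbox a \<in> clspan (sbox ` ?B)" for a
    by (rule subsetD[OF lcl_mono[OF subsetI[OF cspan_base]] sbox_limit[OF dn]])
  then have "clspan (range sbox) \<subseteq> clspan (sbox ` ?B)"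
    by (intro clspan_subset[OF S]) auto
  then show ?thesis
    using sbox_dense lcl_L2 by blast
qed

text \<open>Up to null sets the boxes \<open>sbox\<close> are the sums of the even and the odd boxes.\<close>

lemma total_if_even_odd:
  assumes S: "S \<subseteq> L2"
    and e: "\<And>a. a \<in> D \<Longrightarrow> ebox a \<in> clspan S"
    and o: "\<And>a. a \<in> D \<Longrightarrow> (\<lambda>x. of_real (sgn x) * ebox a x) \<in> clspan S"
  shows "clspan S = L2"
proof -
  have "sbox (s * a) \<in> clspan S" if a: "a \<in> D" and s: "s = 1 \<or> s = - 1" for a s
  proof (rule lcl_cong_AE)
    show "(\<lambda>x. 1 / 2 * ebox a x + of_real (s / 2) * (of_real (sgn x) * ebox a x)) \<in> clspan S"
      using a e o by (intro clspan_add clspan_scale S) auto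
    show "AE x in lborel. 1 / 2 * ebox a x + of_real (s / 2) * (of_real (sgn x) * ebox a x) = sbox (s * a) x"
      using AE_lborel_singleton[of "0::real"]
      by eventually_elim (use s pos[OF a] in \<open>auto simp: sbox_def ebox_def indicator_def sgn_if\<close>)
  qed (use cspan_L2[OF S] L2_measurable[OF sbox_L2] in auto)
  from this[of _ 1] this[of _ "-1"] have "sbox ` (D \<union> uminus ` D) \<subseteq> clspan S"
    by auto
  then have "clspan (sbox ` (D \<union> uminus ` D)) \<subseteq> clspan S"
    by (rule clspan_subset[OF S])
  then show ?thesis
    using sbox_dense_D lcl_L2 by blast
qed

lemma L2_reflect: "f \<in> L2 \<Longrightarrow> (\<lambda>x. f (- x)) \<in> L2"
  using lborel_integrable_real_affine[of "\<lambda>x. (cmod (f x))\<^sup>2" "-1" 0]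
  by (auto simp: L2_def)

lemma L2norm_reflect: "L2norm (\<lambda>x. f (- x)) = L2norm f"
  using lborel_integral_real_affine[of "-1" "\<lambda>x. (cmod (f x))\<^sup>2" 0]
  by (simp add: L2norm_def)

text \<open>Approximate by one-sided boxes, then take even parts: this fixes \<open>f\<close>, does
  not increase the distance, and turns the box of \<open>a\<close> or \<open>- a\<close> into half
  the symmetric box of \<open>a\<close> almost everywhere.\<close>

lemma even_dense:
  assumes f: "f \<in> L2" and even: "\<And>x. f (- x) = f x"
  shows "f \<in> clspan (ebox ` D)"
proof -
  let ?B = "D \<union> uminus ` D"
  have S: "ebox ` D \<subseteq> L2" using ebox_L2 by auto
  have sym: "(\<lambda>x. (u x + u (- x)) / 2) \<in> clspan (ebox ` D)" if "u \<in> cspan (sbox ` ?B)" for u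
    using that
  proof (induction rule: cspan.induct)
    case cspan_zero
    then show ?case using clspan_zero[OF S] by simp
  next
    case (cspan_step u v c)
    then obtain b where b: "b \<in> ?B" "u = sbox b"
      by blast
    have "\<exists>a s. a \<in> D \<and> b = s * a \<and> (s = 1 \<or> s = - 1)"
    proof (cases "b \<in> D")
      case True
      then show ?thesis by (intro exI[of _ b] exI[of _ 1]) simp
    next
      case False
      then show ?thesis using b(1) by (intro exI[of _ "- b"] exI[of _ "- 1"]) auto
    qed
    then obtain a s where a: "a \<in> D" "u = sbox (s * a)" "s = 1 \<or> s = - 1"
      using b(2) by blast
    have "(\<lambda>x. (u x + u (- x)) / 2) \<in> clspan (ebox ` D)"
    proof (rule lcl_cong_AE)
      show "(\<lambda>x. 1 / 2 * ebox a x) \<in> clspan (ebox ` D)"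
        using a by (intro clspan_scale clspan_base S) auto
      show "AE x in lborel. 1 / 2 * ebox a x = (u x + u (- x)) / 2"
        using AE_lborel_singleton[of "0::real"]
        by eventually_elim (use a pos[OF a(1)] in \<open>auto simp: sbox_def ebox_def indicator_def\<close>)
      show "(\<lambda>x. (u x + u (- x)) / 2) \<in> borel_measurable borel"
        unfolding a(2) using L2_measurable[OF L2_reflect[OF sbox_L2[of "s * a"]]] L2_measurable[OF sbox_L2[of "s * a"]]
        by (intro borel_measurable_divide borel_measurable_add) auto
    qed (use cspan_L2[OF S] in auto)
    then have "(\<lambda>x. c * ((u x + u (- x)) / 2) + (v x + v (- x)) / 2) \<in> clspan (ebox ` D)"
      using cspan_step by (intro clspan_lincomb[OF S])
    then show ?case by (simp add: algebra_simps add_divide_distrib)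
  qed
  have "\<exists>w\<in>clspan (ebox ` D). ldist w f < e" if "e > 0" for e
  proof -
    have "f \<in> clspan (sbox ` ?B)"
      using f sbox_dense_D by simp
    then obtain u where u: "u \<in> cspan (sbox ` ?B)" "ldist u f < e"
      using \<open>e > 0\<close> by (rule lclE)
    have uL: "u \<in> L2"
      using u cspan_L2[of "sbox ` ?B"] sbox_L2 by auto
    have "ldist (\<lambda>x. (u x + u (- x)) / 2) f = L2norm (\<lambda>x. 1 / 2 * (u x - f x) + 1 / 2 * (u (- x) - f (- x)))"
      by (rule arg_cong[where f = L2norm], rule ext) (simp add: even diff_divide_distrib add_divide_distrib)
    also have "\<dots> \<le> L2norm (\<lambda>x. 1 / 2 * (u x - f x)) + L2norm (\<lambda>x. 1 / 2 * (u (- x) - f (- x)))"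
      using uL f by (intro L2norm_triangle L2_scale L2_diff L2_reflect)
    also have "\<dots> = ldist u f"
      unfolding L2norm_scale using L2norm_reflect[of "\<lambda>x. u x - f x"] by simp
    finally show ?thesis
      using u(2) sym[OF u(1)] by (intro bexI) auto
  qed
  then have "f \<in> lcl (clspan (ebox ` D))"
    using f by (simp add: lcl_def[of "lcl _"])
  then show ?thesis
    using lcl_idem[OF cspan_L2[OF S]] by simp
qed

end

subsection \<open>The kernel and its action on generalized Gaussians\<close>

text \<open>Nonnegativity makes the gauge integral a Lebesgue integral. The Gamma integral,
  integrals of powers and changes of variables enter as gauge integrals and are transferred through
  this lemma.\<close>

lemma has_bochner_integral_of_has_integral:
  fixes f :: "real \<Rightarrow> real"
  assumes H: "(f has_integral I) S" and "S \<in> sets borel" "(\<lambda>x. indicator S x * f x) \<in> borel_measurable borel"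
    and nn: "\<And>x. x \<in> S \<Longrightarrow> 0 \<le> f x"
  shows "has_bochner_integral lborel (\<lambda>x. indicator S x * f x) I"
proof -
  have eq: "(\<lambda>x. indicator S x * f x) = (\<lambda>x. if x \<in> S then f x else 0)"
    by (auto simp: indicator_def)
  have H': "((\<lambda>x. indicator S x * f x) has_integral I) UNIV"
    unfolding eq has_integral_restrict_UNIV by (rule H)
  have n: "0 \<le> indicator S x * f x" for x
    using nn by (auto simp: indicator_def)
  have "I \<ge> 0"
    using has_integral_nonneg[OF H'] n by simp
  then show ?thesis
    using nn_integral_has_integral_lborel[OF assms(3) n H'] n assms(3)
    by (intro has_bochner_integral_nn_integral) auto
qed

lemma has_bochner_integral_even:
  fixes f :: "real \<Rightarrow> real"
  assumes f: "has_bochner_integral lborel (\<lambda>t. indicator {0<..} t * f t) I" and even: "\<And>t. f (- t) = f t"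
  shows "has_bochner_integral lborel f (2 * I)"
proof -
  have "has_bochner_integral lborel (\<lambda>t. indicator {0<..} (0 + - 1 * t) * f (0 + - 1 * t)) (I /\<^sub>R \<bar>- 1\<bar>)"
    using f by (subst lborel_has_bochner_integral_real_affine_iff[symmetric]) auto
  then have g: "has_bochner_integral lborel (\<lambda>t. indicator {0<..} (- t) * f t) I"
    by (simp add: even)
  have "has_bochner_integral lborel (\<lambda>t. indicator {0<..} t * f t + indicator {0<..} (- t) * f t) (I + I)"
    by (rule has_bochner_integral_add[OF f g])
  moreover have "f \<in> borel_measurable borel"
  proof -
    have [measurable]: "(\<lambda>t. indicator {0<..} t * f t) \<in> borel_measurable borel" "(\<lambda>t. indicator {0<..} (- t) * f t) \<in> borel_measurable borel"
      using borel_measurable_has_bochner_integral[OF f] borel_measurable_has_bochner_integral[OF g] by simp_all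
    have "f = (\<lambda>t. indicator {0<..} t * f t + indicator {0<..} (- t) * f t + indicator {0} t * f 0)"
      by (auto simp: indicator_def)
    also have "\<dots> \<in> borel_measurable borel" by measurable
    finally show ?thesis .
  qed
  ultimately have "has_bochner_integral lborel f (I + I)"
  proof (subst has_bochner_integral_cong_AE)
    show "AE t in lborel. f t = indicator {0<..} t * f t + indicator {0<..} (- t) * f t"
      using AE_lborel_singleton[of "0::real"] by eventually_elim (auto simp: indicator_def)
  qed (auto dest: borel_measurable_has_bochner_integral)
  then show ?thesis by simp
qed

locale kernel =
  fixes n :: nat
  assumes n: "n \<ge> 1"
begin

definition p :: real where "p = 1 / (2 * real n)"

definition cf :: "nat \<Rightarrow> real" where
  "cf l = (-1) ^ l * real n / ((2 * real n) powr (2 * real l + p) * Gamma (real l + p) * fact l)"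

definition G :: "real \<Rightarrow> real \<Rightarrow> complex" where
  "G s t = of_real (exp (- (s * t ^ (2 * n))))"

lemma p_pos: "p > 0"
  using n by (simp add: p_def)

lemma power_nonneg: "(t::real) ^ (2 * n) \<ge> 0"
  by (simp add: power_mult)

lemma cn_eq: "cn n \<eta> = (\<Sum>l. cf l * (\<eta> ^ (2 * n)) ^ l)"
  by (simp add: cn_def cf_def p_def power_mult)

text \<open>\<open>A l\<close> is |cf l| l! / \<epsilon>^l. By the functional equation of Gamma its
  successive quotients are 1 / ((2n)^2 (l + p) \<epsilon>), which is at most 1/2 from l \<ge>
  1/\<epsilon> on, so \<open>A\<close> is summable and in particular bounded.\<close>

lemma cf_bound:
  assumes "\<epsilon> > 0"
  shows "\<exists>K>0. \<forall>l. \<bar>cf l\<bar> \<le> K * (\<epsilon> ^ l / fact l)"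
proof -
  define A where "A = (\<lambda>l. real n / ((2 * real n) powr (2 * real l + p) * Gamma (real l + p)) / \<epsilon> ^ l)"
  have G: "Gamma (real l + p) > 0" for l
    using p_pos by (intro Gamma_real_pos) (simp add: add_nonneg_pos)
  have A: "A l > 0" for l
    using n assms G[of l] by (simp add: A_def)
  have ratio: "A (Suc l) = A l / ((2 * real n)\<^sup>2 * (real l + p) * \<epsilon>)" for l
  proof -
    have "Gamma (real (Suc l) + p) = (real l + p) * Gamma (real l + p)"
      using Gamma_plus1[of "real l + p"] p_pos G[of l] 
      by (metis Gamma_eq_zero_iff add.assoc add.commute less_irrefl of_nat_Suc)
    moreover have "(2 * real n) powr (2 * real (Suc l) + p) = (2 * real n)\<^sup>2 * (2 * real n) powr (2 * real l + p)"
    proof -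
      have "(2 * real n) powr (2 * real (Suc l) + p) = (2 * real n) powr (2 + (2 * real l + p))"
        by (simp add: algebra_simps)
      then show ?thesis
        using n by (simp only: powr_add) simp
    qed
    ultimately show ?thesis
      by (simp add: A_def)
  qed
  have "summable A"
  proof (rule summable_ratio_test[where c = "1 / 2" and N = "nat \<lceil>1 / \<epsilon>\<rceil> + 1"])
    fix l assume "nat \<lceil>1 / \<epsilon>\<rceil> + 1 \<le> l"
    then have "1 / \<epsilon> \<le> real l" by linarith
    then have l1: "1 \<le> real l * \<epsilon>"
      using assms by (simp add: field_simps)
    have "(2::real) * 1 \<le> (2 * real n)\<^sup>2 * (real l * \<epsilon>)"
    proof (rule mult_mono)
      have "(2::real)\<^sup>2 \<le> (2 * real n)\<^sup>2" using n by (intro power_mono) auto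
      then show "2 \<le> (2 * real n)\<^sup>2" by simp
    qed (use l1 in auto)
    also have "\<dots> \<le> (2 * real n)\<^sup>2 * ((real l + p) * \<epsilon>)"
      using p_pos assms by (intro mult_left_mono mult_right_mono) auto
    finally have "2 \<le> (2 * real n)\<^sup>2 * (real l + p) * \<epsilon>"
      by (simp add: mult.assoc)
    then have "A l / ((2 * real n)\<^sup>2 * (real l + p) * \<epsilon>) \<le> A l / 2"
      using A[of l] by (intro divide_left_mono) auto
    then have "A (Suc l) \<le> 1 / 2 * A l"
      unfolding ratio by simp
    then show "norm (A (Suc l)) \<le> 1 / 2 * norm (A l)"
      unfolding real_norm_def abs_of_pos[OF A] .
  qed simp
  then have "Bseq A"
    using summable_LIMSEQ_zero convergentI convergent_imp_Bseq by metis
  then obtain K where K: "K > 0" "\<And>l. norm (A l) \<le> K"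
    by (auto simp: Bseq_def)
  have "\<bar>cf l\<bar> = A l * (\<epsilon> ^ l / fact l)" for l
    using assms n G[of l] by (simp add: cf_def A_def abs_mult)
  moreover have "A l * (\<epsilon> ^ l / fact l) \<le> K * (\<epsilon> ^ l / fact l)" for l
    using K(2)[of l] A[of l] assms by (intro mult_right_mono) auto
  ultimately show ?thesis
    using K(1) by (intro exI[of _ K]) auto
qed

lemma cf_term_le:
  assumes "\<bar>cf l\<bar> \<le> K * (\<epsilon> ^ l / fact l)"
  shows "\<bar>cf l * (\<eta> ^ (2 * n)) ^ l\<bar> \<le> K * ((\<epsilon> * \<eta> ^ (2 * n)) ^ l / fact l)"
proof -
  have "\<bar>cf l * (\<eta> ^ (2 * n)) ^ l\<bar> = \<bar>cf l\<bar> * (\<eta> ^ (2 * n)) ^ l"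
    using power_nonneg[of \<eta>] by (simp add: abs_mult)
  also have "\<dots> \<le> K * (\<epsilon> ^ l / fact l) * (\<eta> ^ (2 * n)) ^ l"
    using assms power_nonneg[of \<eta>] by (intro mult_right_mono) auto
  finally show ?thesis by (simp add: power_mult_distrib)
qed

lemma exp_sums: "(\<lambda>l. K * ((\<epsilon> * \<eta> ^ (2 * n)) ^ l / fact l)) sums (K * exp (\<epsilon> * \<eta> ^ (2 * n)))"
  for \<eta> :: real
  using exp_converges[of "\<epsilon> * \<eta> ^ (2 * n)"] by (intro sums_mult) (simp add: field_simps)

lemma cn_summable: "summable (\<lambda>l. \<bar>cf l * (\<eta> ^ (2 * n)) ^ l\<bar>)"
proof -
  obtain K where K: "\<forall>l. \<bar>cf l\<bar> \<le> K * (1 ^ l / fact l)"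
    using cf_bound[of 1] by auto
  show ?thesis
    by (rule summable_comparison_test'[OF sums_summable[OF exp_sums[of K 1 \<eta>]]])
       (use cf_term_le[OF K[rule_format]] in simp)
qed

lemma cn_bound:
  assumes "\<epsilon> > 0"
  shows "\<exists>K>0. \<forall>\<eta>. \<bar>cn n \<eta>\<bar> \<le> K * exp (\<epsilon> * \<eta> ^ (2 * n))"
proof -
  obtain K where K: "K > 0" "\<forall>l. \<bar>cf l\<bar> \<le> K * (\<epsilon> ^ l / fact l)"
    using cf_bound[OF assms] by auto
  have "\<bar>cn n \<eta>\<bar> \<le> K * exp (\<epsilon> * \<eta> ^ (2 * n))" for \<eta>
  proof -
    have "\<bar>cn n \<eta>\<bar> \<le> (\<Sum>l. \<bar>cf l * (\<eta> ^ (2 * n)) ^ l\<bar>)"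
      unfolding cn_eq using summable_norm[of "\<lambda>l. cf l * (\<eta> ^ (2 * n)) ^ l"] cn_summable[of \<eta>] by simp
    also have "\<dots> \<le> (\<Sum>l. K * ((\<epsilon> * \<eta> ^ (2 * n)) ^ l / fact l))"
      by (intro suminf_le cf_term_le K(2)[rule_format] cn_summable sums_summable[OF exp_sums])
    also have "\<dots> = K * exp (\<epsilon> * \<eta> ^ (2 * n))"
      using exp_sums by (simp add: sums_iff)
    finally show ?thesis .
  qed
  then show ?thesis
    using K(1) by blast
qed

lemma cn_measurable [measurable]: "cn n \<in> borel_measurable borel"
  unfolding cn_eq[abs_def] by measurable

lemma cn_even: "cn n (- \<eta>) = cn n \<eta>"
  by (simp add: cn_eq)

text \<open>Substitute u = s t^(2n) in the Gamma integral at l + p: the exponents 2n - 1 of the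
  derivative and 2n (l + p - 1) of the power add up to 2nl because 2np = 1. Passing from the half
  line to the line by evenness turns the factor 2n of the derivative into n.\<close>

lemma moment:
  assumes s: "s > 0"
  shows "has_bochner_integral lborel (\<lambda>t. (t ^ (2 * n)) ^ l * exp (- (s * t ^ (2 * n))))
           (Gamma (real l + p) / (n * s powr (real l + p)))"
proof -
  define x where "x = real l + p"
  have x: "x > 0" using p_pos by (simp add: x_def add_nonneg_pos)
  have n0: "2 * n > 0" using n by simp
  let ?f = "\<lambda>u::real. u powr (x - 1) / exp u"
  let ?g = "\<lambda>t::real. s * t ^ (2 * n)"
  let ?h = "\<lambda>t::real. (t ^ (2 * n)) ^ l * exp (- (s * t ^ (2 * n)))"
  have hf: "(?f has_integral Gamma x) {0<..}"
  proof -
    have "(?f has_integral Gamma x) {0..}"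
      by (rule Gamma_integral_real[OF x])
    then show ?thesis
      by (subst (asm) has_integral_spike_set_eq[where T = "{0<..}"]) (auto intro: negligible_subset[of "{0}"])
  qed
  then have fa: "?f absolutely_integrable_on {0<..}"
    by (intro nonnegative_absolutely_integrable_1) auto
  have inj: "inj_on ?g {0<..}"
    using s n0 by (auto intro!: inj_onI dest!: power_eq_imp_eq_base)
  have img: "?g ` {0<..} = {0<..}"
  proof
    show "?g ` {0<..} \<subseteq> {0<..}" using s by auto
    show "{0<..} \<subseteq> ?g ` {0<..}"
    proof
      fix u :: real assume "u \<in> {0<..}"
      then have "u = ?g (root (2 * n) (u / s))" "root (2 * n) (u / s) > 0"
        using s n0 by (auto simp: real_root_pow_pos)
      then show "u \<in> ?g ` {0<..}" by blast
    qed
  qed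
  have der: "(?g has_field_derivative s * (real (2 * n) * t ^ (2 * n - 1))) (at t within {0<..})" for t
    by (auto intro!: derivative_eq_intros)
  have "(\<lambda>t. \<bar>s * (real (2 * n) * t ^ (2 * n - 1))\<bar> * ?f (?g t)) absolutely_integrable_on {0<..} \<and>
      integral {0<..} (\<lambda>t. \<bar>s * (real (2 * n) * t ^ (2 * n - 1))\<bar> * ?f (?g t)) = Gamma x"
    using fa integral_unique[OF hf]
    by (subst has_absolute_integral_change_of_variables_1'[OF _ der inj]) (auto simp: img)
  then have "((\<lambda>t. \<bar>s * (real (2 * n) * t ^ (2 * n - 1))\<bar> * ?f (?g t)) has_integral Gamma x) {0<..}"
    by (auto simp: has_integral_iff dest: set_lebesgue_integral_eq_integral(1))
  moreover have "\<bar>s * (real (2 * n) * t ^ (2 * n - 1))\<bar> * ?f (?g t) = 2 * n * s powr x * ?h t"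
    if "t \<in> {0<..}" for t
  proof -
    have t: "t > 0" using that by simp
    have "?g t powr (x - 1) = s powr (x - 1) * t powr (2 * n * (x - 1))"
      using t s by (simp add: powr_mult powr_powr flip: powr_realpow)
    moreover have "t ^ (2 * n - 1) * t powr (2 * n * (x - 1)) = (t ^ (2 * n)) ^ l"
    proof -
      have "t ^ (2 * n - 1) * t powr (2 * n * (x - 1)) = t powr (real (2 * n - 1) + 2 * n * (x - 1))"
        using t by (simp add: powr_add flip: powr_realpow)
      also have "real (2 * n - 1) + 2 * n * (x - 1) = real (2 * n * l)"
        using n by (simp add: x_def p_def of_nat_diff field_simps)
      also have "t powr real (2 * n * l) = t ^ (2 * n * l)"
        by (rule powr_realpow[OF t])
      also have "\<dots> = (t ^ (2 * n)) ^ l"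
        by (rule power_mult)
      finally show ?thesis .
    qed
    moreover have "s * s powr (x - 1) = s powr x"
      using s by (simp add: powr_mult_base)
    ultimately show ?thesis
      using t s by (simp add: exp_minus field_simps)
  qed
  ultimately have "((\<lambda>t. 2 * n * s powr x * ?h t) has_integral Gamma x) {0<..}"
    by (rule has_integral_eq[rotated])
  from has_integral_mult_right[OF this, of "1 / (2 * n * s powr x)"]
  have hh: "(?h has_integral (Gamma x / (2 * n * s powr x))) {0<..}"
    using n s by simp
  have "has_bochner_integral lborel (\<lambda>t. indicator {0<..} t * ?h t) (Gamma x / (2 * n * s powr x))"
    by (rule has_bochner_integral_of_has_integral[OF hh]) (use power_nonneg in auto)
  from has_bochner_integral_even[OF this] show ?thesis
    by (simp add: x_def)
qed

lemma G_measurable [measurable]: "G s \<in> borel_measurable borel"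
  unfolding G_def[abs_def] by measurable

lemma exp_integrable: "s > 0 \<Longrightarrow> integrable lborel (\<lambda>t::real. exp (- (s * t ^ (2 * n))))"
  using moment[of s 0] by (auto simp: has_bochner_integral_iff)

lemma exp_integrable_power2: "s > 0 \<Longrightarrow> integrable lborel (\<lambda>t::real. (K * exp (- (s * t ^ (2 * n))))\<^sup>2)"
  using exp_integrable[of "2 * s"] by (simp add: power_mult_distrib exp_double[symmetric] mult.assoc)

lemma G_L2: "s > 0 \<Longrightarrow> G s \<in> L2"
  by (rule L2_dominated[OF _ exp_integrable_power2[of s 1]]) (auto simp: G_def)

lemma integrable_cn:
  assumes f: "f \<in> borel_measurable borel" and d: "d > 0" and b: "AE t in lborel. cmod (f t) \<le> K * exp (- (d * t ^ (2 * n)))"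
  shows "\<exists>C. integrable lborel (\<lambda>t. C * exp (- (d / 2 * t ^ (2 * n)))) \<and>
    (AE t in lborel. cmod (complex_of_real (cn n (\<omega> * t)) * f t) \<le> C * exp (- (d / 2 * t ^ (2 * n))))"
proof -
  \<comment> \<open>Chosen so that \<epsilon> \<omega>^(2n) \<le> d / 2: half of the decay of
    \<open>f\<close> pays for the growth of the kernel. The summand 1 covers
    \<open>\<omega> = 0\<close>.\<close>
  define \<epsilon> where "\<epsilon> = d / (2 * (\<omega> ^ (2 * n) + 1))"
  have w: "\<omega> ^ (2 * n) + 1 > 0"
    using power_nonneg[of \<omega>] by linarith
  then have e: "\<epsilon> > 0" using d by (simp add: \<epsilon>_def)
  have ew: "\<epsilon> * \<omega> ^ (2 * n) \<le> d / 2"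
  proof -
    have "\<epsilon> * \<omega> ^ (2 * n) \<le> \<epsilon> * (\<omega> ^ (2 * n) + 1)"
      using e by (intro mult_left_mono) auto
    also have "\<dots> = d / 2"
    proof -
      have "d / (2 * u) * u = d / 2" if "u > 0" for u :: real
        using that by simp
      from this[OF w] show ?thesis unfolding \<epsilon>_def .
    qed
    finally show ?thesis .
  qed
  obtain M where M: "M > 0" "\<forall>\<eta>. \<bar>cn n \<eta>\<bar> \<le> M * exp (\<epsilon> * \<eta> ^ (2 * n))"
    using cn_bound[OF e] by auto
  have "AE t in lborel. cmod (complex_of_real (cn n (\<omega> * t)) * f t) \<le> M * K * exp (- (d / 2 * t ^ (2 * n)))"
    using b
  proof eventually_elim
    case (elim t)
    have K: "0 \<le> K * exp (- (d * t ^ (2 * n)))"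
      using elim norm_ge_zero order_trans by blast
    have "\<epsilon> * (\<omega> * t) ^ (2 * n) \<le> d / 2 * t ^ (2 * n)"
      using mult_right_mono[OF ew power_nonneg[of t]] by (simp add: power_mult_distrib mult.assoc)
    then have "M * exp (\<epsilon> * (\<omega> * t) ^ (2 * n)) \<le> M * exp (d / 2 * t ^ (2 * n))"
      using M(1) by (intro mult_left_mono) auto
    then have "\<bar>cn n (\<omega> * t)\<bar> \<le> M * exp (d / 2 * t ^ (2 * n))"
      using M(2)[rule_format, of "\<omega> * t"] by linarith
    then have "\<bar>cn n (\<omega> * t)\<bar> * cmod (f t) \<le> (M * exp (d / 2 * t ^ (2 * n))) * (K * exp (- (d * t ^ (2 * n))))"
      using elim K M(1) by (intro mult_mono) auto
    also have "\<dots> = M * K * (exp (d / 2 * t ^ (2 * n)) * exp (- (d * t ^ (2 * n))))"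
      by simp
    also have "exp (d / 2 * t ^ (2 * n)) * exp (- (d * t ^ (2 * n))) = exp (- (d / 2 * t ^ (2 * n)))"
      by (simp add: exp_add[symmetric])
    finally show ?case by (simp add: norm_mult)
  qed
  moreover have "integrable lborel (\<lambda>t. M * K * exp (- (d / 2 * t ^ (2 * n))))"
    using exp_integrable[of "d / 2"] d by (intro integrable_mult_right) auto
  ultimately show ?thesis by blast
qed

lemma integrable_cn':
  assumes "f \<in> borel_measurable borel" "d > 0" "AE t in lborel. cmod (f t) \<le> K * exp (- (d * t ^ (2 * n)))"
  shows "integrable lborel (\<lambda>t. complex_of_real (cn n (\<omega> * t)) * f t)"
proof -
  obtain C where C: "integrable lborel (\<lambda>t. C * exp (- (d / 2 * t ^ (2 * n))))"
    "AE t in lborel. cmod (complex_of_real (cn n (\<omega> * t)) * f t) \<le> C * exp (- (d / 2 * t ^ (2 * n)))"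
    using integrable_cn[OF assms, of \<omega>] by blast
  show ?thesis
    by (rule Bochner_Integration.integrable_bound[OF C(1)]) (use assms(1) C(2) in \<open>auto elim!: eventually_mono\<close>)
qed

text \<open>Termwise integration. The factor Gamma(l + p) of the moment cancels the one in
  \<open>cf l\<close>; what remains is the exponential series at -\<omega>^(2n) / (4 n^2 s). The
  integrals of the absolute values form the exponential series at the opposite sign, which justifies
  the interchange.\<close>

lemma Phi_G:
  fixes s :: real
  assumes s: "s > 0"
  shows "Phi_even n (G s) = (\<lambda>\<omega>. of_real ((2 * n * s) powr - p) * G (1 / (4 * (real n)\<^sup>2 * s)) \<omega>)"
proof
  fix \<omega> :: real
  let ?f = "\<lambda>l (t::real). cf l * ((\<omega> * t) ^ (2 * n)) ^ l * exp (- (s * t ^ (2 * n)))"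
  let ?W = "\<omega> ^ (2 * n)" and ?z = "1 / (4 * (real n)\<^sup>2 * s)"
  let ?c = "(2 * n * s) powr - p"
  have n0: "real n > 0" using n by simp
  have fh: "has_bochner_integral lborel (?f l) (cf l * ?W ^ l * (Gamma (real l + p) / (n * s powr (real l + p))))" for l
    using has_bochner_integral_mult_right[OF moment[OF s, of l], of "cf l * ?W ^ l"]
    by (simp add: power_mult_distrib mult_ac)
  have G: "Gamma (real l + p) > 0" for l
    using p_pos by (intro Gamma_real_pos) (simp add: add_nonneg_pos)
  have val: "cf l * ?W ^ l * (Gamma (real l + p) / (n * s powr (real l + p))) = ?c * ((- (?z * ?W)) ^ l / fact l)" for l
  proof -
    have e1: "(2 * real n) powr (2 * real l + p) = (4 * (real n)\<^sup>2) ^ l * (2 * real n) powr p"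
      unfolding powr_add using powr_realpow[of "2 * real n" "2 * l"] n0
      by (simp add: power_mult power_mult_distrib)
    have e2: "s powr (real l + p) = s ^ l * s powr p"
      using s by (simp add: powr_add powr_realpow)
    have e3: "?c = 1 / ((2 * real n) powr p * s powr p)"
      using n0 s by (simp add: powr_minus powr_mult field_simps)
    have e4: "(- (?z * ?W)) ^ l = (-1) ^ l * ?W ^ l / ((4 * (real n)\<^sup>2) ^ l * s ^ l)"
      unfolding power_minus[of "?z * ?W"] by (simp add: power_divide power_mult_distrib)
    have "(2 * real n) powr p > 0" "s powr p > 0"
      using n0 s by auto
    then show ?thesis
      unfolding cf_def e1 e2 e3 e4 using G[of l] n0 s by (simp add: divide_simps)
  qed
  have absval: "\<bar>cf l * ?W ^ l * (Gamma (real l + p) / (n * s powr (real l + p)))\<bar> = ?c * ((?z * ?W) ^ l / fact l)" for l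
    unfolding val using power_nonneg[of \<omega>] s by (simp add: abs_mult power_abs[symmetric])
  have norm: "(LINT t|lborel. norm (?f l t)) = ?c * ((?z * ?W) ^ l / fact l)" for l
  proof -
    have "(LINT t|lborel. norm (?f l t)) = (LINT t|lborel. \<bar>cf l * ?W ^ l\<bar> * ((t ^ (2 * n)) ^ l * exp (- (s * t ^ (2 * n)))))"
      using power_nonneg by (intro Bochner_Integration.integral_cong) (auto simp: abs_mult power_mult_distrib)
    also have "\<dots> = \<bar>cf l * ?W ^ l\<bar> * (Gamma (real l + p) / (n * s powr (real l + p)))"
      using moment[OF s, of l] by (simp add: has_bochner_integral_iff)
    also have "\<dots> = \<bar>cf l * ?W ^ l * (Gamma (real l + p) / (n * s powr (real l + p)))\<bar>"
      using G[of l] by (simp add: abs_mult)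
    finally show ?thesis using absval by simp
  qed
  have "summable (\<lambda>l. ?c * ((?z * ?W) ^ l / fact l))"
    using summable_exp[of "?z * ?W"] by (intro summable_mult) (simp add: field_simps)
  then have sumn: "summable (\<lambda>l. LINT t|lborel. norm (?f l t))"
    unfolding norm .
  have sumf: "summable (\<lambda>l. norm (?f l t))" for t
    using summable_mult2[OF cn_summable, of "\<omega> * t" "exp (- (s * t ^ (2 * n)))"] by (simp add: abs_mult)
  have "(\<lambda>l. integral\<^sup>L lborel (?f l)) sums (LINT t|lborel. (\<Sum>l. ?f l t))"
    by (rule sums_integral) (use fh sumf sumn in \<open>auto simp: has_bochner_integral_iff\<close>)
  moreover have "(\<Sum>l. ?f l t) = cn n (\<omega> * t) * exp (- (s * t ^ (2 * n)))" for t
  proof -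
    have "summable (\<lambda>l. cf l * ((\<omega> * t) ^ (2 * n)) ^ l)"
      by (rule summable_rabs_cancel[OF cn_summable])
    then show ?thesis
      unfolding cn_eq by (rule suminf_mult2[symmetric])
  qed
  ultimately have "(\<lambda>l. ?c * ((- (?z * ?W)) ^ l / fact l)) sums (LINT t|lborel. cn n (\<omega> * t) * exp (- (s * t ^ (2 * n))))"
    using has_bochner_integral_integral_eq[OF fh] val by simp
  moreover have "(\<lambda>l. ?c * ((- (?z * ?W)) ^ l / fact l)) sums (?c * exp (- (?z * ?W)))"
    using exp_converges[of "- (?z * ?W)"] by (intro sums_mult) (simp add: field_simps)
  ultimately have "(LINT t|lborel. cn n (\<omega> * t) * exp (- (s * t ^ (2 * n)))) = ?c * exp (- (?z * ?W))"
    by (rule sums_unique2)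
  then show "Phi_even n (G s) \<omega> = of_real ?c * G ?z \<omega>"
    by (simp add: Phi_even_def G_def flip: of_real_mult)
qed

end

section \<open>Isometry of \<Phi> on Gaussians and on symmetric boxes\<close>

context kernel
begin

definition Gauss :: "(real \<Rightarrow> complex) set" where
  "Gauss = {G s | s. s > 0}"

definition Gauss_pairs :: "((real \<Rightarrow> complex) \<times> (real \<Rightarrow> complex)) set" where
  "Gauss_pairs = {(G s, Phi_even n (G s)) | s. s > 0}"

lemma Gauss_L2: "Gauss \<subseteq> L2"
  by (auto simp: Gauss_def G_L2)

lemma ip_G:
  assumes "s > 0" "r > 0"
  shows "ip (G s) (G r) = of_real (Gamma p / (n * (s + r) powr p))"
proof -
  have "ip (G s) (G r) = (LINT t|lborel. complex_of_real (exp (- ((s + r) * t ^ (2 * n)))))"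
    unfolding ip_def G_def
    by (intro Bochner_Integration.integral_cong) (auto simp: algebra_simps simp flip: of_real_mult exp_add)
  also have "\<dots> = of_real (Gamma p / (n * (s + r) powr p))"
    using moment[of "s + r" 0] assms by (simp add: has_bochner_integral_iff)
  finally show ?thesis .
qed

lemma ip_scale: "ip (\<lambda>x. of_real a * f x) (\<lambda>x. of_real b * g x) = of_real (a * b) * ip f g"
proof -
  have "ip (\<lambda>x. of_real a * f x) (\<lambda>x. of_real b * g x) = (LINT x|lborel. of_real (a * b) * (f x * cnj (g x)))"
    unfolding ip_def by (intro Bochner_Integration.integral_cong) auto
  then show ?thesis
    by (simp add: ip_def del: of_real_mult)
qed

lemma inverse_scale_pos: "(s::real) > 0 \<Longrightarrow> 1 / (4 * (real n)\<^sup>2 * s) > 0"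
  using n by simp

lemma Gauss_pairs_L2: "Gauss_pairs \<subseteq> L2 \<times> L2"
  using L2_scale[OF G_L2[OF inverse_scale_pos]] by (auto simp: Gauss_pairs_def Phi_G G_L2)

text \<open>With A = 2ns and B = 2nr the parameters of the two images add up to (s + r) / (A B). By
  \<open>ip_G\<close> this contributes A^p B^p (s + r)^(-p), and the scalars A^(-p) and B^(-p) of
  \<open>Phi_G\<close> cancel the first two factors.\<close>

lemma Gauss_pairs_gram:
  assumes "(f, g) \<in> Gauss_pairs" "(f', g') \<in> Gauss_pairs"
  shows "ip g g' = ip f f'"
proof -
  obtain s r where s: "s > 0" "f = G s" "g = Phi_even n (G s)" and r: "r > 0" "f' = G r" "g' = Phi_even n (G r)"
    using assms by (auto simp: Gauss_pairs_def)
  have n0: "real n > 0" using n by simp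
  let ?S = "1 / (4 * (real n)\<^sup>2 * s)" and ?R = "1 / (4 * (real n)\<^sup>2 * r)"
  have e: "(2 * n * s) powr - p * (2 * n * r) powr - p / (?S + ?R) powr p = 1 / (s + r) powr p"
  proof -
    define A B where "A = 2 * n * s" and "B = 2 * n * r"
    have AB: "A > 0" "B > 0" using s r n0 by (auto simp: A_def B_def)
    have "?S + ?R = (s + r) / (A * B)"
      using s r n0 by (simp add: A_def B_def field_simps power2_eq_square)
    then have SR: "(?S + ?R) powr p = (s + r) powr p / (A powr p * B powr p)"
      using s r AB by (simp add: powr_divide powr_mult)
    have "A powr p > 0" "B powr p > 0" "(s + r) powr p > 0"
      using s r AB by auto
    then have "A powr - p * B powr - p / (?S + ?R) powr p = 1 / (s + r) powr p"
      unfolding SR powr_minus by (simp add: divide_simps)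
    then show ?thesis unfolding A_def B_def .
  qed
  have "ip g g' = of_real ((2 * n * s) powr - p * (2 * n * r) powr - p) * of_real (Gamma p / (n * (?S + ?R) powr p))"
    unfolding s(3) r(3) Phi_G[OF s(1)] Phi_G[OF r(1)] ip_scale ip_G[OF inverse_scale_pos[OF s(1)] inverse_scale_pos[OF r(1)]] ..
  also have "\<dots> = of_real (((2 * n * s) powr - p * (2 * n * r) powr - p / (?S + ?R) powr p) * (Gamma p / n))"
    by (simp only: of_real_mult[symmetric]) simp
  also have "\<dots> = ip f f'"
    unfolding e s(2) r(2) ip_G[OF s(1) r(1)] by simp
  finally show ?thesis .
qed

lemma Gauss_bounded:
  assumes "s > 0"
  shows "cmod (G s t) \<le> 1 * exp (- (s * t ^ (2 * n)))"
  by (simp add: G_def)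

text \<open>Integrability is carried through the induction because the linearity of
  \<open>Phi_even\<close> rests on it.\<close>

lemma cspan_Gauss:
  assumes "u \<in> cspan Gauss"
  shows "(u, Phi_even n u) \<in> rspan Gauss_pairs \<and> (\<forall>\<omega>. integrable lborel (\<lambda>t. complex_of_real (cn n (\<omega> * t)) * u t))"
  using assms
proof (induction rule: cspan.induct)
  case cspan_zero
  then show ?case
    using rspan_zero by (simp add: Phi_even_def[abs_def])
next
  case (cspan_step f u c)
  then obtain s where s: "s > 0" "f = G s" by (auto simp: Gauss_def)
  have i: "integrable lborel (\<lambda>t. complex_of_real (cn n (\<omega> * t)) * f t)" for \<omega>
    unfolding s(2) by (rule integrable_cn'[OF G_measurable s(1) AE_I2[OF Gauss_bounded[OF s(1)]]])
  have eq: "complex_of_real (cn n (\<omega> * t)) * (c * f t + u t)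
      = c * (complex_of_real (cn n (\<omega> * t)) * f t) + complex_of_real (cn n (\<omega> * t)) * u t" for \<omega> t
    by (simp add: algebra_simps)
  have "Phi_even n (\<lambda>x. c * f x + u x) = (\<lambda>\<omega>. c * Phi_even n f \<omega> + Phi_even n u \<omega>)"
    unfolding Phi_even_def eq using i cspan_step.IH by simp
  moreover have "(f, Phi_even n f) \<in> Gauss_pairs"
    using s by (auto simp: Gauss_pairs_def)
  ultimately show ?case
    using cspan_step.IH i unfolding eq by (auto intro!: rspan_step)
qed

text \<open>The images of the approximants have two limits: a pointwise one by dominated
  convergence, since the common majorant stays integrable after multiplication by the kernel, and a
  norm limit, since isometry on the span makes them Cauchy. \<open>L2_limit_AE\<close> identifies
  the two, so the closed relation is still given by the integral formula at
  \<open>f\<close>.\<close>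

lemma Phi_rcl:
  assumes u: "\<And>k. u k \<in> cspan Gauss" and d: "d > 0"
    and b: "\<And>k t. cmod (u k t) \<le> K * exp (- (d * t ^ (2 * n)))"
    and f: "f \<in> borel_measurable borel"
    and lim: "AE t in lborel. (\<lambda>k. u k t) \<longlonglongrightarrow> f t"
  shows "(f, Phi_even n f) \<in> rcl (rspan Gauss_pairs)" "f \<in> clspan Gauss"
proof -
  have uL: "u k \<in> L2" for k
    using u cspan_L2[OF Gauss_L2] by blast
  have um: "u k \<in> borel_measurable borel" for k
    using uL by (rule L2_measurable)
  have uP: "(u k, Phi_even n (u k)) \<in> rspan Gauss_pairs" for k
    using cspan_Gauss[OF u] by blast
  have PL: "Phi_even n (u k) \<in> L2" for k
    using uP rspan_L2[OF Gauss_pairs_L2] by blast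
  note conv = L2_dominated_convergence[OF um f exp_integrable_power2[OF d] AE_I2[OF b] lim]
  show "f \<in> clspan Gauss"
    by (rule lcl_limit[OF u conv(2,3)])
  have pt: "(\<lambda>k. Phi_even n (u k) \<omega>) \<longlonglongrightarrow> Phi_even n f \<omega>" for \<omega>
  proof -
    define v where "v = (\<lambda>t::real. complex_of_real (K * exp (- (d * t ^ (2 * n)))))"
    have vm: "v \<in> borel_measurable borel" unfolding v_def by measurable
    have K: "K \<ge> 0"
      using order_trans[OF norm_ge_zero b[of 0 0]] n by (simp add: power_0_left)
    have vb: "cmod (v t) \<le> K * exp (- (d * t ^ (2 * n)))" for t
      unfolding v_def norm_of_real using K by simp
    have vi: "integrable lborel (\<lambda>t. complex_of_real (cn n (\<omega> * t)) * v t)"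
      by (rule integrable_cn'[OF vm d AE_I2[OF vb]])
    show ?thesis
      unfolding Phi_even_def
    proof (rule integral_dominated_convergence)
      show "integrable lborel (\<lambda>t. cmod (complex_of_real (cn n (\<omega> * t)) * v t))"
        using vi by (rule integrable_norm)
      show "AE t in lborel. (\<lambda>k. complex_of_real (cn n (\<omega> * t)) * u k t) \<longlonglongrightarrow> complex_of_real (cn n (\<omega> * t)) * f t"
        using lim by eventually_elim (auto intro!: tendsto_intros)
      show "AE t in lborel. norm (complex_of_real (cn n (\<omega> * t)) * u k t) \<le> cmod (complex_of_real (cn n (\<omega> * t)) * v t)" for k
        using b[of k] K by (intro AE_I2) (auto simp: norm_mult v_def intro!: mult_left_mono)
    qed (use f um in auto)
  qed
  have pm: "Phi_even n f \<in> borel_measurable borel"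
    by (rule borel_measurable_LIMSEQ_metric[OF L2_measurable[OF PL] pt])
  have pc: "\<exists>N. \<forall>i\<ge>N. \<forall>j\<ge>N. ldist (Phi_even n (u i)) (Phi_even n (u j)) < e" if "e > 0" for e
  proof -
    obtain N where N: "\<And>k. k \<ge> N \<Longrightarrow> ldist (u k) f < e / 2"
      using order_tendstoD(2)[OF conv(3) half_gt_zero[OF \<open>e > 0\<close>]] by (auto simp: eventually_sequentially)
    have "ldist (Phi_even n (u i)) (Phi_even n (u j)) < e" if "i \<ge> N" "j \<ge> N" for i j
    proof -
      have "(\<lambda>x. - 1 * u j x + u i x, \<lambda>x. - 1 * Phi_even n (u j) x + Phi_even n (u i) x) \<in> rspan Gauss_pairs"
        by (rule rspan_lincomb[OF uP uP])
      from rspan_isometric[OF Gauss_pairs_L2 Gauss_pairs_gram this]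
      have "ldist (Phi_even n (u i)) (Phi_even n (u j)) = ldist (u i) (u j)"
        by simp
      also have "\<dots> \<le> ldist (u i) f + ldist f (u j)"
        by (rule ldist_triangle[OF uL conv(2) uL])
      also have "\<dots> < e"
        using N[OF that(1)] N[OF that(2)] by (simp add: ldist_commute[of f])
      finally show ?thesis .
    qed
    then show ?thesis by blast
  qed
  have "AE x in lborel. (\<lambda>i. Phi_even n (u (id i)) x) \<longlonglongrightarrow> Phi_even n f x"
    using pt by simp
  note L = L2_limit_AE[OF PL pc strict_mono_id pm this]
  show "(f, Phi_even n f) \<in> rcl (rspan Gauss_pairs)"
    by (rule rcl_limit[OF uP conv(2) L(1) conv(3) L(2)])
qed

lemma Phi_G_rcl: "s > 0 \<Longrightarrow> (G s, Phi_even n (G s)) \<in> rcl (rspan Gauss_pairs)"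
  using subset_rcl[OF rspan_L2[OF Gauss_pairs_L2]] rspan_base[of "(G s, Phi_even n (G s))" Gauss_pairs] by (auto simp: Gauss_pairs_def)

text \<open>In the variable \<open>y = exp (- t\<^bsup>2n\<^esup>)\<close> the elements of the span of \<open>G 1, G 2, \<dots>\<close> are the polynomials
  vanishing at 0, and \<open>ebox a\<close> is the indicator of \<open>{b..1}\<close> with \<open>b = exp (- a\<^bsup>2n\<^esup>)\<close>; the Weierstrass
  theorem is applied to the indicator divided by \<open>y\<close>.\<close>

lemma ebox_approx:
  assumes a: "a > 0"
  shows "\<exists>u K. (\<forall>k::nat. u k \<in> cspan Gauss) \<and> (\<forall>k t. cmod (u k t) \<le> K * exp (- (1 * t ^ (2 * n)))) \<and>
    (AE t in lborel. (\<lambda>k. u k t) \<longlonglongrightarrow> ebox a t)"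
proof -
  define b where "b = exp (- (a ^ (2 * n)))"
  have b: "b > 0" by (simp add: b_def)
  \<comment> \<open>A ramp of slope \<open>k\<close> starting at \<open>b\<close>, divided by
    \<open>y\<close>. Having \<open>max y b\<close> in the denominator keeps the quotient continuous
    at 0 and does not alter it, as the numerator vanishes for y \<le> b.\<close>
  define h where "h = (\<lambda>(k::nat) (y::real). max 0 (min 1 (real k * (y - b))) / max y b)"
  have hc: "continuous_on {0..1} (h k)" for k
    unfolding h_def using b by (intro continuous_intros) (auto simp: max_def)
  have hb: "\<bar>h k y\<bar> \<le> 1 / b" for k y
  proof -
    have "max 0 (min 1 (real k * (y - b))) / max y b \<le> 1 / b"
      using b by (intro frac_le) auto
    then show ?thesis using b by (simp add: h_def)
  qed
  have "\<exists>q. (\<exists>N c. q = (\<lambda>x. \<Sum>i\<le>N. c i * x ^ i)) \<and> (\<forall>y\<in>{0..1}. \<bar>h k y - q y\<bar> < 1 / Suc k)" for k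
  proof -
    obtain q where "real_polynomial_function q" "\<And>y. y \<in> {0..1} \<Longrightarrow> \<bar>h k y - q y\<bar> < 1 / Suc k"
      using Stone_Weierstrass_real_polynomial_function[OF compact_Icc hc, of "1 / Suc k"] by auto
    then show ?thesis
      unfolding real_polynomial_function_iff_sum by blast
  qed
  then obtain q where qp: "\<And>k. \<exists>N c. q k = (\<lambda>x. \<Sum>i\<le>N. c i * x ^ i)"
    and q: "\<And>k y. y \<in> {0..1} \<Longrightarrow> \<bar>h k y - q k y\<bar> < 1 / Suc k"
    by metis
  define Y where "Y = (\<lambda>t::real. exp (- (t ^ (2 * n))))"
  have Y: "Y t > 0" "Y t \<in> {0..1}" for t
    using power_nonneg[of t] by (auto simp: Y_def)
  \<comment> \<open>Multiplication by \<open>Y t\<close> raises every power by one, hence the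
    Gaussians \<open>G (Suc i)\<close>, and also supplies the common majorant, since the polynomials
    are bounded by 1 / b + 1 on the unit interval.\<close>
  define u where "u = (\<lambda>k t. complex_of_real (Y t * q k (Y t)))"
  show ?thesis
  proof (rule exI[of _ u], rule exI[of _ "1 / b + 1"], intro conjI allI)
    show "u k \<in> cspan Gauss" for k
    proof -
      obtain N c where qk: "q k = (\<lambda>x. \<Sum>i\<le>N. c i * x ^ i)"
        using qp by blast
      have "u k = (\<lambda>t. \<Sum>i\<le>N. complex_of_real (c i) * G (Suc i) t)"
      proof
        fix t
        have Yp: "Y t ^ Suc i = exp (- (real (Suc i) * t ^ (2 * n)))" for i
          unfolding Y_def exp_of_nat_mult[symmetric] by simp
        have "Y t * q k (Y t) = (\<Sum>i\<le>N. c i * Y t ^ Suc i)"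
          by (simp add: qk sum_distrib_left mult_ac)
        then show "u k t = (\<Sum>i\<le>N. complex_of_real (c i) * G (Suc i) t)"
          unfolding Yp u_def G_def by (simp only: of_real_sum of_real_mult)
      qed
      moreover have "G (Suc i) \<in> cspan Gauss" for i
        by (rule cspan_base) (force simp: Gauss_def)
      ultimately show ?thesis
        by (simp add: cspan_sum)
    qed
    show "cmod (u k t) \<le> (1 / b + 1) * exp (- (1 * t ^ (2 * n)))" for k t
    proof -
      have "\<bar>q k (Y t)\<bar> \<le> \<bar>h k (Y t)\<bar> + \<bar>h k (Y t) - q k (Y t)\<bar>"
        by linarith
      also have "\<dots> \<le> 1 / b + 1"
      proof (rule add_mono[OF hb])
        have "1 / real (Suc k) \<le> 1" by simp
        then show "\<bar>h k (Y t) - q k (Y t)\<bar> \<le> 1"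
          using q[OF Y(2), of k t] by linarith
      qed
      finally have "Y t * \<bar>q k (Y t)\<bar> \<le> Y t * (1 / b + 1)"
        using Y(1)[of t] by (intro mult_left_mono) auto
      then show ?thesis
        using Y(1)[of t] by (simp add: u_def abs_mult mult.commute Y_def del: of_real_mult)
    qed
    show "AE t in lborel. (\<lambda>k. u k t) \<longlonglongrightarrow> ebox a t"
      using AE_lborel_singleton[of a] AE_lborel_singleton[of "- a"]
    proof eventually_elim
      case (elim t)
      have abs_iff: "\<bar>t\<bar> < a \<longleftrightarrow> Y t > b" "a < \<bar>t\<bar> \<longleftrightarrow> Y t < b"
        using a n power_mono_iff[of "\<bar>t\<bar>" a "2 * n"] power_mono_iff[of a "\<bar>t\<bar>" "2 * n"]
        by (auto simp: Y_def b_def power_even_abs not_le[symmetric])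
      have hlim: "(\<lambda>k. h k (Y t)) \<longlonglongrightarrow> (if \<bar>t\<bar> < a then 1 / Y t else 0)"
      proof (cases "\<bar>t\<bar> < a")
        case True
        then have yb: "Y t > b" using abs_iff by simp
        obtain m :: nat where m: "1 / (Y t - b) < m" using reals_Archimedean2 by blast
        have "eventually (\<lambda>k. h k (Y t) = 1 / Y t) sequentially"
          using eventually_ge_at_top[of m]
        proof eventually_elim
          case (elim k)
          have "1 / (Y t - b) \<le> real k" using m elim by linarith
          then have "1 \<le> real k * (Y t - b)"
            using yb by (simp add: field_simps)
          then show ?case using yb by (simp add: h_def)
        qed
        then show ?thesis using True by (simp add: tendsto_eventually)
      next
        case False
        then have "Y t < b" using abs_iff elim by auto
        have "h k (Y t) = 0" for k
        proof -
          have "real k * (Y t - b) \<le> 0"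
            using \<open>Y t < b\<close> by (intro mult_nonneg_nonpos) auto
          then show ?thesis by (simp add: h_def)
        qed
        then show ?thesis using False by simp
      qed
      have "(\<lambda>k. q k (Y t) - h k (Y t)) \<longlonglongrightarrow> 0"
      proof (rule Lim_null_comparison[OF _ LIMSEQ_inverse_real_of_nat])
        show "\<forall>\<^sub>F k in sequentially. norm (q k (Y t) - h k (Y t)) \<le> inverse (real (Suc k))"
          using q[OF Y(2)] by (intro always_eventually allI) (simp add: abs_minus_commute inverse_eq_divide less_imp_le)
      qed
      from tendsto_add[OF this hlim]
      have "(\<lambda>k. q k (Y t)) \<longlonglongrightarrow> (if \<bar>t\<bar> < a then 1 / Y t else 0)"
        by simp
      then have "(\<lambda>k. u k t) \<longlonglongrightarrow> complex_of_real (Y t * (if \<bar>t\<bar> < a then 1 / Y t else 0))"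
        unfolding u_def by (intro tendsto_intros)
      moreover have "complex_of_real (Y t * (if \<bar>t\<bar> < a then 1 / Y t else 0)) = ebox a t"
        using Y(1)[of t] elim by (auto simp: ebox_def indicator_def abs_if split: if_splits)
      ultimately show ?case by simp
    qed
  qed
qed

lemma ebox_Phi:
  assumes "a > 0"
  shows "(ebox a, Phi_even n (ebox a)) \<in> rcl (rspan Gauss_pairs)" "ebox a \<in> clspan Gauss"
proof -
  obtain u K where u: "\<forall>k::nat. u k \<in> cspan Gauss" "\<forall>k t. cmod (u k t) \<le> K * exp (- (1 * t ^ (2 * n)))"
    "AE t in lborel. (\<lambda>k. u k t) \<longlonglongrightarrow> ebox a t"
    using ebox_approx[OF assms] by blast
  show "(ebox a, Phi_even n (ebox a)) \<in> rcl (rspan Gauss_pairs)" "ebox a \<in> clspan Gauss"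
    by (rule Phi_rcl[OF u(1)[rule_format] zero_less_one u(2)[rule_format] L2_measurable[OF ebox_L2] u(3)])+
qed

lemma Phi_ebox_L2: "a > 0 \<Longrightarrow> Phi_even n (ebox a) \<in> L2"
  using ebox_Phi(1) rcl_L2 by blast

text \<open>A box lies under a multiple of a Gaussian, as exp(a^(2n)) exp(-t^(2n)) is at least 1 on
  [-a, a].\<close>

lemma integrable_cn_ebox: "integrable lborel (\<lambda>t. complex_of_real (cn n (\<omega> * t)) * ebox a t)"
proof (rule integrable_cn')
  show "AE t in lborel. cmod (ebox a t) \<le> exp (1 * a ^ (2 * n)) * exp (- (1 * t ^ (2 * n)))"
  proof (rule AE_I2)
    fix t
    show "cmod (ebox a t) \<le> exp (1 * a ^ (2 * n)) * exp (- (1 * t ^ (2 * n)))"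
    proof (cases "t \<in> {- a..a}")
      case True
      then have "\<bar>t\<bar> ^ (2 * n) \<le> \<bar>a\<bar> ^ (2 * n)"
        by (intro power_mono) auto
      then have "1 \<le> exp (1 * a ^ (2 * n)) * exp (- (1 * t ^ (2 * n)))"
        by (simp add: exp_add[symmetric] power_even_abs)
      moreover have "cmod (ebox a t) = 1"
        using True by (simp add: ebox_def)
      ultimately show ?thesis by simp
    qed (simp add: ebox_def)
  qed
qed (use L2_measurable[OF ebox_L2] in auto)

lemma ip_Phi_ebox:
  "a > 0 \<Longrightarrow> b > 0 \<Longrightarrow> ip (Phi_even n (ebox a)) (Phi_even n (ebox b)) = ip (ebox a) (ebox b)"
  by (rule rcl_ip[OF Gauss_pairs_L2 Gauss_pairs_gram ebox_Phi(1) ebox_Phi(1)])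

lemma Phi_even_even: "Phi_even n f (- \<omega>) = Phi_even n f \<omega>"
  unfolding Phi_even_def using cn_even by simp

end

subsection \<open>The Hilbert transform of step functions\<close>

text \<open>At the end points \<open>ln 0 = 0\<close> makes \<open>logr\<close> a junk value; statements about it hold off these points.\<close>

definition logr :: "real \<Rightarrow> real \<Rightarrow> real \<Rightarrow> real" where
  "logr a b x = ln \<bar>x - a\<bar> - ln \<bar>x - b\<bar>"

text \<open>For \<open>\<epsilon> > 0\<close> and \<open>a \<le> b\<close> this is the integral of 1
  / (x - t) over the part of [a, b] with |x - t| > \<epsilon>: truncating the kernel amounts to
  clipping both distances at \<open>\<epsilon>\<close>.\<close>

definition logr_trunc :: "real \<Rightarrow> real \<Rightarrow> real \<Rightarrow> real \<Rightarrow> real" where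
  "logr_trunc \<epsilon> a b x = ln (max \<bar>x - a\<bar> \<epsilon>) - ln (max \<bar>x - b\<bar> \<epsilon>)"

definition itrunc :: "real \<Rightarrow> real \<Rightarrow> real" where
  "itrunc \<epsilon> v = (if \<epsilon> < \<bar>v\<bar> then 1 / v else 0)"

text \<open>The truncated integral of \<open>hilbert\<close> without the factor 1 / pi, written over
  the whole line so that linearity, Fubini's theorem and dominated convergence apply
  directly.\<close>

definition trunc :: "real \<Rightarrow> (real \<Rightarrow> complex) \<Rightarrow> real \<Rightarrow> complex" where
  "trunc \<epsilon> f x = (LINT t|lborel. f t * of_real (itrunc \<epsilon> (x - t)))"

lemma hilbert_trunc: "hilbert f x = Lim (at_right 0) (\<lambda>\<epsilon>. of_real (1 / pi) * trunc \<epsilon> f x)"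
proof -
  have "(LINT t:{t. \<epsilon> < \<bar>x - t\<bar>}|lborel. f t / complex_of_real (x - t)) = trunc \<epsilon> f x" for \<epsilon>
    unfolding trunc_def set_lebesgue_integral_def
    by (intro Bochner_Integration.integral_cong) (auto simp: itrunc_def divide_inverse indicator_def)
  then show ?thesis
    unfolding hilbert_def by simp
qed

lemma itrunc_measurable [measurable]: "itrunc \<epsilon> \<in> borel_measurable borel"
  unfolding itrunc_def[abs_def] by measurable

lemma logr_measurable [measurable]: "logr a b \<in> borel_measurable borel"
  unfolding logr_def[abs_def] by measurable

lemma logr_trunc_measurable [measurable]: "logr_trunc \<epsilon> a b \<in> borel_measurable borel"
  unfolding logr_trunc_def[abs_def] by measurable

lemma inverse_one_plus_abs_power2_integrable: "integrable lborel (\<lambda>t::real. (C / (1 + \<bar>t\<bar>))\<^sup>2)"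
proof -
  have "(\<integral>\<^sup>+t. ennreal (1 / (1 + t)\<^sup>2) * indicator {0..} t \<partial>lborel) = ennreal (0 - (- 1 / (1 + 0)))"
  proof (rule nn_integral_FTC_atLeast)
    show "((\<lambda>t::real. - 1 / (1 + t)) \<longlongrightarrow> 0) at_top"
      by real_asymp
    show "((\<lambda>t::real. - 1 / (1 + t)) has_real_derivative 1 / (1 + t)\<^sup>2) (at t)" if "0 \<le> t" for t
      using that by (auto intro!: derivative_eq_intros simp: power2_eq_square)
  qed auto
  moreover have "ennreal (1 / (1 + t)\<^sup>2 * indicator {0..} t) = ennreal (1 / (1 + t)\<^sup>2) * indicator {0..} t" for t :: real
    by (simp add: indicator_def)
  ultimately have 1: "integrable lborel (\<lambda>t::real. 1 / (1 + t)\<^sup>2 * indicator {0..} t)"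
    by (intro integrableI_nonneg) simp_all
  have 2: "integrable lborel (\<lambda>t::real. 1 / (1 - t)\<^sup>2 * indicator {0..} (- t))"
    using lborel_integrable_real_affine[OF 1, of "-1" 0] by simp
  have "integrable lborel (\<lambda>t::real. 1 / (1 + \<bar>t\<bar>)\<^sup>2)"
    by (rule Bochner_Integration.integrable_bound[OF Bochner_Integration.integrable_add[OF 1 2]])
       (auto simp: indicator_def abs_if)
  from integrable_mult_right[OF this, of "C\<^sup>2"] show ?thesis
    by (simp add: power_divide)
qed

text \<open>For \<open>u\<close> in a bounded set the truncated kernel decays uniformly: 1 + |t|
  \<le> (1 + M) + |u - t|, and where the kernel is nonzero, 1 + M \<le> (1 + M) / \<epsilon> times
  |u - t|. The majorant is square integrable in \<open>t\<close>.\<close>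

lemma itrunc_bound:
  assumes "\<epsilon> > 0" "\<bar>u\<bar> \<le> M"
  shows "\<bar>itrunc \<epsilon> (u - t)\<bar> \<le> ((1 + M) / \<epsilon> + 1) / (1 + \<bar>t\<bar>)"
proof (cases "\<epsilon> < \<bar>u - t\<bar>")
  case True
  have "1 + \<bar>t\<bar> \<le> (1 + M) + \<bar>u - t\<bar>"
    using assms by linarith
  also have "1 + M \<le> (1 + M) / \<epsilon> * \<bar>u - t\<bar>"
  proof -
    have "(1 + M) * \<epsilon> \<le> (1 + M) * \<bar>u - t\<bar>"
      using True assms by (intro mult_left_mono) auto
    then show ?thesis using assms by (simp add: field_simps)
  qed
  finally have "1 + \<bar>t\<bar> \<le> ((1 + M) / \<epsilon> + 1) * \<bar>u - t\<bar>"
    by (simp add: algebra_simps)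
  then have "1 / \<bar>u - t\<bar> \<le> ((1 + M) / \<epsilon> + 1) / (1 + \<bar>t\<bar>)"
    using True assms by (simp add: divide_simps mult.commute)
  then show ?thesis using True by (simp add: itrunc_def)
next
  case False
  have "0 \<le> (1 + M) / \<epsilon> + 1"
    using assms by (intro add_nonneg_nonneg divide_nonneg_pos) auto
  then show ?thesis using False by (simp add: itrunc_def)
qed

lemma itrunc_L2: "\<epsilon> > 0 \<Longrightarrow> (\<lambda>t. complex_of_real (itrunc \<epsilon> (x - t))) \<in> L2"
  by (rule L2_dominated[OF _ inverse_one_plus_abs_power2_integrable, OF _ AE_I2])
     (use itrunc_bound[of \<epsilon> x "\<bar>x\<bar>"] in auto)

lemma trunc_integrable: "f \<in> L2 \<Longrightarrow> \<epsilon> > 0 \<Longrightarrow> integrable lborel (\<lambda>t. f t * complex_of_real (itrunc \<epsilon> (x - t)))"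
  by (intro L2_mult_integrable itrunc_L2)

lemma trunc_lincomb:
  assumes "f \<in> L2" "g \<in> L2" "\<epsilon> > 0"
  shows "trunc \<epsilon> (\<lambda>t. c * f t + g t) x = c * trunc \<epsilon> f x + trunc \<epsilon> g x"
proof -
  have "trunc \<epsilon> (\<lambda>t. c * f t + g t) x 
      = (LINT t|lborel. c * (f t * of_real (itrunc \<epsilon> (x - t))) + g t * of_real (itrunc \<epsilon> (x - t)))"
    unfolding trunc_def by (intro Bochner_Integration.integral_cong) (auto simp: algebra_simps)
  also have "\<dots> = c * trunc \<epsilon> f x + trunc \<epsilon> g x"
    unfolding trunc_def using assms trunc_integrable by simp
  finally show ?thesis .
qed

lemma trunc_cong_AE:
  assumes "f \<in> borel_measurable borel" "g \<in> borel_measurable borel" "AE t in lborel. f t = g t"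
  shows "trunc \<epsilon> f x = trunc \<epsilon> g x"
  unfolding trunc_def by (rule integral_cong_AE) (use assms in \<open>auto elim!: eventually_mono\<close>)

definition ibox :: "real \<Rightarrow> real \<Rightarrow> real \<Rightarrow> complex" where
  "ibox a b x = of_real (indicator {a..b} x)"

lemma ibox_L2: "ibox a b \<in> L2"
  using indicator_dominated_L2[of "{a..b}" a b] by (simp add: ibox_def[abs_def])

text \<open>The antiderivative - ln (max |x - t| \<epsilon>) is continuous and is constant exactly
  where the kernel is cut off, so the fundamental theorem applies with the exceptional points x -
  \<epsilon> and x + \<epsilon>, whatever the position of \<open>x\<close> relative to
  [a, b].\<close>

lemma integral_itrunc:
  assumes e: "\<epsilon> > 0" and ab: "a \<le> b"
  shows "has_bochner_integral lborel (\<lambda>t. indicator {a..b} t * itrunc \<epsilon> (x - t)) (logr_trunc \<epsilon> a b x)"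
proof -
  let ?F = "\<lambda>t. - ln (max \<bar>x - t\<bar> \<epsilon>)"
  have der: "(?F has_vector_derivative itrunc \<epsilon> (x - t)) (at t)" if t: "t \<notin> {x - \<epsilon>, x + \<epsilon>}" for t
  proof -
    consider "\<bar>x - t\<bar> < \<epsilon>" | "x - t > \<epsilon>" | "x - t < - \<epsilon>"
      using t by fastforce
    then have "(?F has_real_derivative itrunc \<epsilon> (x - t)) (at t)"
    proof cases
      case 1
      have "((\<lambda>t. - ln \<epsilon>) has_real_derivative 0) (at t)" by simp
      then have "(?F has_real_derivative 0) (at t)"
      proof (rule has_field_derivative_transform_within_open[where S = "{x - \<epsilon><..<x + \<epsilon>}"])
        show "- ln \<epsilon> = ?F s" if "s \<in> {x - \<epsilon><..<x + \<epsilon>}" for s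
        proof -
          have "\<bar>x - s\<bar> \<le> \<epsilon>" using that by auto
          then show ?thesis by (simp add: max_absorb2)
        qed
      qed (use 1 in auto)
      then show ?thesis using 1 by (simp add: itrunc_def)
    next
      case 2
      have "((\<lambda>t. - ln (x - t)) has_real_derivative 1 / (x - t)) (at t)"
        using 2 e by (auto intro!: derivative_eq_intros simp: field_simps)
      then have "(?F has_real_derivative 1 / (x - t)) (at t)"
        by (rule has_field_derivative_transform_within_open[where S = "{..<x - \<epsilon>}"])
           (use 2 e in \<open>auto simp: max_def\<close>)
      then show ?thesis using 2 e by (simp add: itrunc_def)
    next
      case 3
      have "((\<lambda>t. - ln (t - x)) has_real_derivative 1 / (x - t)) (at t)"
        using 3 e by (auto intro!: derivative_eq_intros simp: divide_simps)
      then have "(?F has_real_derivative 1 / (x - t)) (at t)"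
        by (rule has_field_derivative_transform_within_open[where S = "{x + \<epsilon><..}"])
           (use 3 e in \<open>auto simp: max_def\<close>)
      then show ?thesis using 3 e by (simp add: itrunc_def)
    qed
    then show ?thesis by (simp add: has_real_derivative_iff_has_vector_derivative)
  qed
  have cont: "continuous_on {a..b} ?F"
    using e by (intro continuous_intros) (auto simp: max_def)
  have "((\<lambda>t. itrunc \<epsilon> (x - t)) has_integral (?F b - ?F a)) {a..b}"
    by (rule fundamental_theorem_of_calculus_interior_strong[where S = "{x - \<epsilon>, x + \<epsilon>}"])
       (use ab cont der in auto)
  then have HK: "((\<lambda>t. itrunc \<epsilon> (x - t)) has_integral logr_trunc \<epsilon> a b x) {a..b}"
    by (simp add: logr_trunc_def)
  have eq: "(\<lambda>t. indicator {a..b} t * itrunc \<epsilon> (x - t)) = (\<lambda>t. if t \<in> {a..b} then itrunc \<epsilon> (x - t) else 0)"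
    by (auto simp: indicator_def)
  have HK': "((\<lambda>t. indicator {a..b} t * itrunc \<epsilon> (x - t)) has_integral logr_trunc \<epsilon> a b x) UNIV"
    unfolding eq has_integral_restrict_UNIV by (rule HK)
  have int: "integrable lborel (\<lambda>t. indicator {a..b} t * itrunc \<epsilon> (x - t))"
  proof (rule Bochner_Integration.integrable_bound)
    show "integrable lborel (\<lambda>t. 1 / \<epsilon> * indicator {a..b} t :: real)"
      by (intro integrable_mult_right integrable_real_indicator) (auto simp: emeasure_lborel_Icc_eq)
    show "AE t in lborel. norm (indicator {a..b} t * itrunc \<epsilon> (x - t)) \<le> norm (1 / \<epsilon> * indicator {a..b} t :: real)"
    proof (rule AE_I2)
      fix t
      have "\<bar>itrunc \<epsilon> (x - t)\<bar> \<le> 1 / \<epsilon>"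
        using e by (auto simp: itrunc_def intro!: divide_left_mono)
      then show "norm (indicator {a..b} t * itrunc \<epsilon> (x - t)) \<le> norm (1 / \<epsilon> * indicator {a..b} t :: real)"
        using e by (auto simp: indicator_def)
    qed
  qed simp
  have "integral\<^sup>L lborel (\<lambda>t. indicator {a..b} t * itrunc \<epsilon> (x - t)) = logr_trunc \<epsilon> a b x"
    using has_integral_unique[OF has_integral_integral_lborel[OF int] HK'] .
  then show ?thesis
    using int by (simp add: has_bochner_integral_iff)
qed

lemma trunc_ibox:
  assumes "\<epsilon> > 0" "a \<le> b"
  shows "trunc \<epsilon> (ibox a b) x = of_real (logr_trunc \<epsilon> a b x)"
proof -
  have "trunc \<epsilon> (ibox a b) x = (LINT t|lborel. complex_of_real (indicator {a..b} t * itrunc \<epsilon> (x - t)))"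
    by (simp add: trunc_def ibox_def)
  also have "\<dots> = of_real (logr_trunc \<epsilon> a b x)"
    using has_bochner_integral_integral_eq[OF integral_itrunc[OF assms]] by (simp only: integral_complex_of_real)
  finally show ?thesis .
qed

lemma logr_trunc_eq_logr: "\<epsilon> \<le> \<bar>x - a\<bar> \<Longrightarrow> \<epsilon> \<le> \<bar>x - b\<bar> \<Longrightarrow> logr_trunc \<epsilon> a b x = logr a b x"
  by (simp add: logr_trunc_def logr_def max_absorb1)

lemma logr_trunc_tendsto:
  assumes "x \<noteq> a" "x \<noteq> b"
  shows "((\<lambda>\<epsilon>. logr_trunc \<epsilon> a b x) \<longlongrightarrow> logr a b x) (at_right 0)"
proof (rule tendsto_eventually)
  have "min \<bar>x - a\<bar> \<bar>x - b\<bar> > 0" using assms by simp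
  then show "\<forall>\<^sub>F \<epsilon> in at_right 0. logr_trunc \<epsilon> a b x = logr a b x"
    by (intro eventually_at_rightI[where b = "min \<bar>x - a\<bar> \<bar>x - b\<bar>"] logr_trunc_eq_logr) auto
qed

text \<open>Clipping two numbers from below at the same level can only bring their logarithms
  closer. This dominates all truncations by the untruncated logarithm, uniformly in
  \<open>\<epsilon>\<close>.\<close>

lemma ln_max_diff_le:
  assumes "p > 0" "q > 0" "(\<epsilon>::real) > 0"
  shows "\<bar>ln (max p \<epsilon>) - ln (max q \<epsilon>)\<bar> \<le> \<bar>ln p - ln q\<bar>"
proof -
  have mono: "ln x \<le> ln y" if "0 < x" "x \<le> y" for x y :: real
    using that by simp
  consider "\<epsilon> \<le> p" "\<epsilon> \<le> q" | "p \<le> \<epsilon>" "q \<le> \<epsilon>" | "p \<le> \<epsilon>" "\<epsilon> \<le> q" | "\<epsilon> \<le> p" "q \<le> \<epsilon>"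
    by linarith
  then show ?thesis
    by cases (use assms mono[of p \<epsilon>] mono[of \<epsilon> q] mono[of \<epsilon> p] mono[of q \<epsilon>] in
      \<open>auto simp: max_absorb1 max_absorb2\<close>)
qed

lemma logr_trunc_le_logr:
  assumes "x \<noteq> a" "x \<noteq> b" "\<epsilon> > 0"
  shows "\<bar>logr_trunc \<epsilon> a b x\<bar> \<le> \<bar>logr a b x\<bar>"
  unfolding logr_trunc_def logr_def by (rule ln_max_diff_le) (use assms in auto)

text \<open>Both bounds come from |ln p - ln q| \<le> ln (1 + D / m). The first gives the decay for
  large \<open>m\<close>. The second serves near the singularity: ln y = 4 ln (y^(1/4)) \<le> 4
  y^(1/4), whose square is of the integrable order m^(-1/2).\<close>

lemma ln_diff_bounds:
  assumes "p > 0" "q > 0" "\<bar>p - q\<bar> \<le> (D::real)" "m = min p q"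
  shows "\<bar>ln p - ln q\<bar> \<le> D / m" "(ln p - ln q)\<^sup>2 \<le> 16 * sqrt (1 + D / m)"
proof -
  have m: "m > 0" using assms by simp
  have D: "D \<ge> 0" using assms by linarith
  have le: "\<bar>ln p - ln q\<bar> \<le> ln (1 + D / m)"
  proof -
    have *: "\<bar>ln x - ln y\<bar> \<le> ln (1 + D / y)" if "0 < y" "y \<le> x" "x \<le> y + D" for x y
    proof -
      have "\<bar>ln x - ln y\<bar> = ln (x / y)"
        using that by (simp add: ln_div)
      also have "\<dots> \<le> ln (1 + D / y)"
        using that by (subst ln_le_cancel_iff) (auto simp: field_simps add_pos_nonneg D)
      finally show ?thesis .
    qed
    show ?thesis
    proof (cases "p \<le> q")
      case True
      then show ?thesis using *[of p q] assms by (simp add: abs_minus_commute)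
    next
      case False
      then show ?thesis using *[of q p] assms by simp
    qed
  qed
  have y: "1 + D / m > 0" using m D by (simp add: add_pos_nonneg)
  show "\<bar>ln p - ln q\<bar> \<le> D / m"
    using le ln_add_one_self_le_self[of "D / m"] m D by simp
  let ?r = "sqrt (sqrt (1 + D / m))"
  have r: "?r > 0" using y by simp
  have "?r ^ 4 = (?r\<^sup>2)\<^sup>2"
    by (simp flip: power_mult)
  then have "1 + D / m = ?r ^ 4"
    using y by simp
  then have "ln (1 + D / m) = 4 * ln ?r"
    using r by (metis ln_realpow of_nat_numeral)
  also have "\<dots> \<le> 4 * ?r"
    using ln_le_minus_one[OF r] by simp
  finally have "\<bar>ln p - ln q\<bar> \<le> 4 * ?r" using le by simp
  then have "\<bar>ln p - ln q\<bar>\<^sup>2 \<le> (4 * ?r)\<^sup>2"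
    by (intro power_mono) auto
  also have "\<dots> = 16 * sqrt (1 + D / m)"
    using y by (simp add: power_mult_distrib)
  finally show "(ln p - ln q)\<^sup>2 \<le> 16 * sqrt (1 + D / m)" by simp
qed

text \<open>A majorant for the square of \<open>logr\<close> around one end point, \<open>D\<close>
  being the length of the interval. The factor 32 is the 16 of \<open>ln_diff_bounds\<close> times
  the 2 of sqrt (1 + D / m) \<le> 2 sqrt (D / m), valid for m \<le> D.\<close>

lemma logr_dominating_integrable:
  fixes D :: real
  assumes D: "D > 0"
  shows "integrable lborel (\<lambda>y. if \<bar>y\<bar> \<le> D then 32 * sqrt D * \<bar>y\<bar> powr (- 1 / 2) else D\<^sup>2 * \<bar>y\<bar> powr - 2)"
proof -
  let ?\<phi> = "\<lambda>y. if \<bar>y\<bar> \<le> D then 32 * sqrt D * \<bar>y\<bar> powr (- 1 / 2) else D\<^sup>2 * \<bar>y\<bar> powr - 2"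
  have "((\<lambda>y. y powr (- 1 / 2)) has_integral (D powr (- 1 / 2 + 1) / (- 1 / 2 + 1))) {0..D}"
    using D by (intro has_integral_powr_from_0) auto
  then have i1: "has_bochner_integral lborel (\<lambda>y. indicator {0..D} y * y powr (- 1 / 2)) (D powr (- 1 / 2 + 1) / (- 1 / 2 + 1))"
    by (rule has_bochner_integral_of_has_integral) auto
  have "((\<lambda>y. y powr - 2) has_integral (- (D powr (- 2 + 1)) / (- 2 + 1))) {D..}"
    using D by (intro has_integral_powr_to_inf) auto
  then have i2: "has_bochner_integral lborel (\<lambda>y. indicator {D..} y * y powr - 2) (- (D powr (- 2 + 1)) / (- 2 + 1))"
    by (rule has_bochner_integral_of_has_integral) auto
  have int: "integrable lborel (\<lambda>y. 32 * sqrt D * (indicator {0..D} y * y powr (- 1 / 2)) + D\<^sup>2 * (indicator {D..} y * y powr - 2))"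
    using i1 i2 by (auto simp: has_bochner_integral_iff)
  have "integrable lborel (\<lambda>y. indicator {0<..} y * ?\<phi> y)"
  proof (rule Bochner_Integration.integrable_bound[OF int])
    show "AE y in lborel. norm (indicator {0<..} y * ?\<phi> y) \<le> norm (32 * sqrt D * (indicator {0..D} y * y powr (- 1 / 2)) + D\<^sup>2 * (indicator {D..} y * y powr - 2))"
      using D by (intro AE_I2) (auto simp: indicator_def)
  qed auto
  then have "has_bochner_integral lborel (\<lambda>y. indicator {0<..} y * ?\<phi> y) (integral\<^sup>L lborel (\<lambda>y. indicator {0<..} y * ?\<phi> y))"
    by (rule has_bochner_integral_integrable)
  from has_bochner_integral_even[OF this] show ?thesis
    by (simp add: has_bochner_integral_iff)
qed

text \<open>The smaller of the distances to \<open>a\<close> and \<open>b\<close> controls the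
  square; the bound it gives is one of two translates of the majorant, hence below their
  sum.\<close>

lemma logr_L2: "(\<lambda>x. complex_of_real (logr a b x)) \<in> L2"
proof (cases "a = b")
  case True
  then show ?thesis by (simp add: logr_def)
next
  case False
  define D where "D = \<bar>b - a\<bar>"
  have D: "D > 0" using False by (simp add: D_def)
  let ?\<phi> = "\<lambda>y::real. if \<bar>y\<bar> \<le> D then 32 * sqrt D * \<bar>y\<bar> powr (- 1 / 2) else D\<^sup>2 * \<bar>y\<bar> powr - 2"
  have nn: "?\<phi> y \<ge> 0" for y using D by simp
  have i: "integrable lborel (\<lambda>x. ?\<phi> (x - c))" for c
  proof -
    have "- c + 1 * x = x - c" for x :: real by simp
    then show ?thesis
      using lborel_integrable_real_affine[OF logr_dominating_integrable[OF D], of 1 "- c"] by (simp only:)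
  qed
  have bd: "(ln p - ln q)\<^sup>2 \<le> ?\<phi> (min p q)" if "p > 0" "q > 0" "\<bar>p - q\<bar> \<le> D" for p q
  proof -
    define m where "m = min p q"
    have m: "m > 0" using that by (simp add: m_def)
    show ?thesis
    proof (cases "m \<le> D")
      case True
      then have "1 + D / m \<le> 4 * (D / m)"
        using m by (simp add: field_simps)
      then have "sqrt (1 + D / m) \<le> 2 * sqrt (D / m)"
        by (metis real_sqrt_four real_sqrt_le_mono real_sqrt_mult)
      moreover have "sqrt (D / m) = sqrt D * m powr (- 1 / 2)"
        using m by (simp add: real_sqrt_divide powr_minus_divide powr_half_sqrt)
      ultimately show ?thesis
        using ln_diff_bounds(2)[OF that m_def] True m by (simp flip: m_def)
    next
      case False
      have "(ln p - ln q)\<^sup>2 \<le> (D / m)\<^sup>2"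
        using ln_diff_bounds(1)[OF that m_def] by (metis abs_ge_zero power2_abs power_mono)
      also have "\<dots> = D\<^sup>2 * m powr - 2"
        using m by (simp add: powr_minus powr_numeral field_simps)
      finally show ?thesis using False m by (simp flip: m_def)
    qed
  qed
  have "integrable lborel (\<lambda>x. (logr a b x)\<^sup>2)"
  proof (rule Bochner_Integration.integrable_bound[OF Bochner_Integration.integrable_add[OF i[of a] i[of b]]])
    show "AE x in lborel. norm ((logr a b x)\<^sup>2) \<le> norm (?\<phi> (x - a) + ?\<phi> (x - b))"
      using AE_lborel_singleton[of a] AE_lborel_singleton[of b]
    proof eventually_elim
      case (elim x)
      have "\<bar>\<bar>x - a\<bar> - \<bar>x - b\<bar>\<bar> \<le> D"
        unfolding D_def by linarith
      then have "(logr a b x)\<^sup>2 \<le> ?\<phi> (min \<bar>x - a\<bar> \<bar>x - b\<bar>)"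
        unfolding logr_def using elim by (intro bd) auto
      also have "\<dots> \<le> ?\<phi> (x - a) + ?\<phi> (x - b)"
        using nn[of "x - a"] nn[of "x - b"] by (auto simp: min_def)
      finally have le: "(logr a b x)\<^sup>2 \<le> ?\<phi> (x - a) + ?\<phi> (x - b)" .
      have "norm u \<le> norm v" if "0 \<le> u" "u \<le> v" for u v :: real
        using that by simp
      from this[OF zero_le_power2 le] show ?case .
    qed
  qed auto
  then show ?thesis by (simp add: L2_def)
qed

section \<open>The integral of the logarithmic kernel\<close>

text \<open>Folding the principal value integral of \<open>logr a b\<close> at \<open>x\<close> onto \<open>s > 0\<close> leaves
  the difference of the kernels \<open>logk A s / s\<close> for \<open>A = x - b\<close> and \<open>A = x - a\<close>.\<close>

definition logk :: "real \<Rightarrow> real \<Rightarrow> real" where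
  "logk A s = ln \<bar>A + s\<bar> - ln \<bar>A - s\<bar>"

lemma logk_measurable [measurable]: "logk A \<in> borel_measurable borel"
  unfolding logk_def[abs_def] by measurable

text \<open>The numerator keeps the odd squares with weight 2: the value is twice the difference of
  pi^2 / 6 and its even part pi^2 / 24.\<close>

lemma odd_inverse_squares_sums: "(\<lambda>n. (1 + (- 1) ^ n) / (real n + 1)\<^sup>2) sums (pi\<^sup>2 / 4)"
proof -
  have isq: "(\<lambda>n. 1 / (real n + 1)\<^sup>2) sums (pi\<^sup>2 / 6)"
    using inverse_squares_sums by (simp add: add.commute)
  define b where "b = (\<lambda>n::nat. if odd n then 1 / (real n + 1)\<^sup>2 else 0)"
  have "(\<lambda>k. 1 / 4 * (1 / (real k + 1)\<^sup>2)) sums (1 / 4 * (pi\<^sup>2 / 6))"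
    by (intro sums_mult isq)
  also have "(\<lambda>k. 1 / 4 * (1 / (real k + 1)\<^sup>2)) = (\<lambda>k. b (2 * k + 1))"
  proof
    fix k
    have "(real (2 * k + 1) + 1)\<^sup>2 = 4 * (real k + 1)\<^sup>2"
      by (simp add: power2_eq_square algebra_simps)
    then show "1 / 4 * (1 / (real k + 1)\<^sup>2) = b (2 * k + 1)"
      by (simp add: b_def)
  qed
  finally have "b sums (1 / 4 * (pi\<^sup>2 / 6))"
  proof (subst (asm) sums_mono_reindex)
    show "strict_mono (\<lambda>k::nat. 2 * k + 1)" by (rule strict_monoI) simp
    show "b n = 0" if "n \<notin> range (\<lambda>k. 2 * k + 1)" for n
    proof (cases "odd n")
      case True
      then obtain k where "n = 2 * k + 1" by (rule oddE)
      then show ?thesis using that by blast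
    qed (simp add: b_def)
  qed
  then have "(\<lambda>n. 2 * (1 / (real n + 1)\<^sup>2 - b n)) sums (2 * (pi\<^sup>2 / 6 - 1 / 4 * (pi\<^sup>2 / 6)))"
    by (intro sums_mult sums_diff isq)
  moreover have "(\<lambda>n. 2 * (1 / (real n + 1)\<^sup>2 - b n)) = (\<lambda>n. (1 + (- 1) ^ n) / (real n + 1)\<^sup>2)"
    by (auto simp: b_def fun_eq_iff)
  ultimately show ?thesis by simp
qed

text \<open>The logarithm series at \<open>u\<close> and at \<open>- u\<close> are subtracted;
  shifting the index by one absorbs the division by \<open>u\<close>.\<close>

lemma logk_series:
  assumes "0 < u" "u < 1"
  shows "(\<lambda>n. (1 + (- 1) ^ n) / (real n + 1) * u ^ n) sums (logk 1 u / u)"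
proof -
  have "(\<lambda>n. - ((- u) ^ n) / real n - (- ((- (- u)) ^ n) / real n)) sums (ln (1 + u) - ln (1 + - u))"
    using assms by (intro sums_diff ln_series') auto
  then have "(\<lambda>n. - ((- u) ^ Suc n) / real (Suc n) - (- ((- (- u)) ^ Suc n) / real (Suc n))) sums (ln (1 + u) - ln (1 + - u))"
    by (subst sums_Suc_iff) simp
  then have "(\<lambda>n. (- ((- u) ^ Suc n) / real (Suc n) - (- ((- (- u)) ^ Suc n) / real (Suc n))) / u) sums ((ln (1 + u) - ln (1 + - u)) / u)"
    by (rule sums_divide)
  also have "(\<lambda>n. (- ((- u) ^ Suc n) / real (Suc n) - (- ((- (- u)) ^ Suc n) / real (Suc n))) / u) = (\<lambda>n. (1 + (- 1) ^ n) / (real n + 1) * u ^ n)"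
  proof
    fix n
    have *: "(A * u / m - (- (B * u) / m)) / u = (B + A) / m" if "m \<noteq> 0" for A B m
      using that assms by (simp add: field_simps)
    have "- ((- u) ^ Suc n) = ((- 1) ^ n * u ^ n) * u" "(- (- u)) ^ Suc n = u ^ n * u"
      using power_minus[of u n] by simp_all
    then have "(- ((- u) ^ Suc n) / real (Suc n) - (- ((- (- u)) ^ Suc n) / real (Suc n))) / u = (u ^ n + (- 1) ^ n * u ^ n) / real (Suc n)"
      using *[of "real (Suc n)" "(- 1) ^ n * u ^ n" "u ^ n"] by (simp only: of_nat_neq_0 not_False_eq_True)
    also have "\<dots> = (1 + (- 1) ^ n) / (real n + 1) * u ^ n"
      by (simp add: distrib_right add.commute)
    finally show "(- ((- u) ^ Suc n) / real (Suc n) - (- ((- (- u)) ^ Suc n) / real (Suc n))) / u = (1 + (- 1) ^ n) / (real n + 1) * u ^ n" .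
  qed
  also have "(ln (1 + u) - ln (1 + - u)) / u = logk 1 u / u"
    using assms by (simp add: logk_def)
  finally show ?thesis .
qed

text \<open>Termwise integration of the power series. All coefficients are nonnegative, so the norms
  of the terms have the same sum as their integrals.\<close>

lemma logk_integral_01: "has_bochner_integral lborel (\<lambda>u. indicator {0..1} u * (logk 1 u / u)) (pi\<^sup>2 / 4)"
proof -
  define c where "c = (\<lambda>n::nat. (1 + (- 1) ^ n) / (real n + 1))"
  have c: "c n \<ge> 0" for n
    by (cases "even n") (auto simp: c_def)
  let ?f = "\<lambda>n u::real. indicator {0..1} u * (c n * u ^ n)"
  have f: "has_bochner_integral lborel (?f n) (c n / (real n + 1))" for n
  proof (rule has_bochner_integral_of_has_integral)
    have "((\<lambda>u. c n * u ^ n) has_integral (c n * 1 ^ Suc n / Suc n - c n * 0 ^ Suc n / Suc n)) {0..1}"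
    proof (rule fundamental_theorem_of_calculus)
      show "((\<lambda>u. c n * u ^ Suc n / Suc n) has_vector_derivative c n * u ^ n) (at u within {0..1})" for u :: real
        unfolding has_real_derivative_iff_has_vector_derivative[symmetric]
        by (auto intro!: derivative_eq_intros simp del: power_Suc of_nat_Suc)
    qed simp
    then show "((\<lambda>u. c n * u ^ n) has_integral (c n / (real n + 1))) {0..1}"
      by (simp add: add.commute)
  qed (use c in auto)
  have norm: "(LINT u|lborel. norm (?f n u)) = c n / (real n + 1)" for n
  proof -
    have "(LINT u|lborel. norm (?f n u)) = integral\<^sup>L lborel (?f n)"
      using c[of n] by (intro Bochner_Integration.integral_cong) (auto simp: indicator_def)
    then show ?thesis using has_bochner_integral_integral_eq[OF f] by simp
  qed
  have val: "(\<lambda>n. c n / (real n + 1)) sums (pi\<^sup>2 / 4)"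
    using odd_inverse_squares_sums by (simp add: c_def power2_eq_square)
  have sm: "AE u in lborel. summable (\<lambda>n. norm (?f n u)) \<and> (\<Sum>n. ?f n u) = indicator {0..1} u * (logk 1 u / u)"
    using AE_lborel_singleton[of "0::real"] AE_lborel_singleton[of "1::real"]
  proof eventually_elim
    case (elim u)
    show ?case
    proof (cases "u \<in> {0..1}")
      case True
      then have u: "0 < u" "u < 1" using elim by auto
      have s: "(\<lambda>n. c n * u ^ n) sums (logk 1 u / u)"
        unfolding c_def by (rule logk_series[OF u])
      have "norm (?f n u) = c n * u ^ n" for n
        using c[of n] True by simp
      then show ?thesis
        using s True by (simp add: sums_iff)
    qed simp
  qed
  have sum1: "AE u in lborel. summable (\<lambda>n. norm (?f n u))"
    using sm by eventually_elim simp
  have sum2: "summable (\<lambda>n. LINT u|lborel. norm (?f n u))"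
    unfolding norm using val by (rule sums_summable)
  have fi: "integrable lborel (?f n)" for n
    using f[of n] by (simp add: has_bochner_integral_iff)
  have "(\<lambda>n. integral\<^sup>L lborel (?f n)) sums (LINT u|lborel. (\<Sum>n. ?f n u))"
    by (rule sums_integral[OF fi sum1 sum2])
  then have "(\<lambda>n. c n / (real n + 1)) sums (LINT u|lborel. (\<Sum>n. ?f n u))"
    using has_bochner_integral_integral_eq[OF f] by simp
  then have "(LINT u|lborel. (\<Sum>n. ?f n u)) = pi\<^sup>2 / 4"
    using val sums_unique2 by blast
  then have "has_bochner_integral lborel (\<lambda>u. \<Sum>n. ?f n u) (pi\<^sup>2 / 4)"
    using integrable_suminf[OF fi sum1 sum2] by (simp add: has_bochner_integral_iff)
  then show ?thesis
  proof (subst (asm) has_bochner_integral_cong_AE)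
    show "AE u in lborel. (\<Sum>n. ?f n u) = indicator {0..1} u * (logk 1 u / u)"
      using sm by eventually_elim simp
  qed auto
qed

lemma logk_nonneg: "A > 0 \<Longrightarrow> s > 0 \<Longrightarrow> s \<noteq> A \<Longrightarrow> logk A s \<ge> 0"
  unfolding logk_def by (simp add: abs_if)

text \<open>The substitution u -> 1/u preserves du / u and |(1 + u) / (1 - u)| and exchanges (0, 1)
  with (1, infinity), so both halves contribute equally.\<close>

lemma logk_integral_1_inf: "has_bochner_integral lborel (\<lambda>u. indicator {1<..} u * (logk 1 u / u)) (pi\<^sup>2 / 4)"
proof (rule has_bochner_integral_of_has_integral)
  let ?k = "\<lambda>u. logk 1 u / u"
  have eq: "(\<lambda>u. indicator {0..1} u * ?k u) = (\<lambda>u. if u \<in> {0..1} then ?k u else 0)"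
    by (auto simp: indicator_def)
  have "((\<lambda>u. indicator {0..1} u * ?k u) has_integral pi\<^sup>2 / 4) UNIV"
    using has_integral_integral_lborel[OF integrable.intros[OF logk_integral_01]]
    unfolding has_bochner_integral_integral_eq[OF logk_integral_01] .
  then have "(?k has_integral pi\<^sup>2 / 4) {0..1}"
    unfolding eq has_integral_restrict_UNIV .
  then have k: "(?k has_integral pi\<^sup>2 / 4) {0<..<1}"
    by (simp add: has_integral_Icc_iff_Ioo)
  then have ka: "?k absolutely_integrable_on {0<..<1}"
    by (intro nonnegative_absolutely_integrable_1) (auto intro!: divide_nonneg_pos logk_nonneg)
  have img: "(\<lambda>u. 1 / u) ` {1<..} = {0<..<1::real}"
  proof
    show "{0<..<1::real} \<subseteq> (\<lambda>u. 1 / u) ` {1<..}"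
    proof
      fix v :: real assume "v \<in> {0<..<1}"
      then have "v = 1 / (1 / v)" "1 / v \<in> {1<..}" by auto
      then show "v \<in> (\<lambda>u. 1 / u) ` {1<..}" by blast
    qed
  qed auto
  have der: "((\<lambda>u. 1 / u) has_field_derivative (- 1 / u\<^sup>2)) (at u within {1<..})" if "u \<in> {1<..}" for u :: real
    using that by (auto intro!: derivative_eq_intros simp: power2_eq_square)
  have inj: "inj_on (\<lambda>u::real. 1 / u) {1<..}"
    by (auto intro!: inj_onI)
  have "(\<lambda>u. \<bar>- 1 / u\<^sup>2\<bar> * ?k (1 / u)) absolutely_integrable_on {1<..} \<and>
      integral {1<..} (\<lambda>u. \<bar>- 1 / u\<^sup>2\<bar> * ?k (1 / u)) = pi\<^sup>2 / 4"
    using ka integral_unique[OF k]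
    by (subst has_absolute_integral_change_of_variables_1'[OF _ der inj]) (auto simp: img)
  then have "((\<lambda>u. \<bar>- 1 / u\<^sup>2\<bar> * ?k (1 / u)) has_integral pi\<^sup>2 / 4) {1<..}"
    by (auto simp: has_integral_iff dest: set_lebesgue_integral_eq_integral(1))
  moreover have "\<bar>- 1 / u\<^sup>2\<bar> * ?k (1 / u) = ?k u" if "u \<in> {1<..}" for u
  proof -
    have u: "u > 1" using that by simp
    have "1 + 1 / u = (1 + u) / u" "1 - 1 / u = (u - 1) / u"
      using u by (simp_all add: field_simps)
    then have "logk 1 (1 / u) = logk 1 u"
      using u by (simp add: logk_def ln_div)
    then show ?thesis
      using u by (simp add: power2_eq_square)
  qed
  ultimately show "(?k has_integral pi\<^sup>2 / 4) {1<..}"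
    by (rule has_integral_eq[rotated])
qed (auto intro!: divide_nonneg_pos logk_nonneg)

lemma logk_integral_1: "has_bochner_integral lborel (\<lambda>u. indicator {0<..} u * (logk 1 u / u)) (pi\<^sup>2 / 2)"
proof -
  have "has_bochner_integral lborel (\<lambda>u. indicator {0..1} u * (logk 1 u / u) + indicator {1<..} u * (logk 1 u / u)) (pi\<^sup>2 / 4 + pi\<^sup>2 / 4)"
    by (rule has_bochner_integral_add[OF logk_integral_01 logk_integral_1_inf])
  moreover have "AE u in lborel. indicator {0..1} u * (logk 1 u / u) + indicator {1<..} u * (logk 1 u / u) = indicator {0<..} u * (logk 1 u / u)"
    using AE_lborel_singleton[of "0::real"] by eventually_elim (auto simp: indicator_def)
  ultimately show ?thesis
    by (subst (asm) has_bochner_integral_cong_AE) auto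
qed

text \<open>The measure ds / s is scale invariant and \<open>logk A\<close> at A u equals
  \<open>logk 1\<close> at u away from the singularity, so the value does not depend on
  \<open>A\<close>.\<close>

lemma logk_integral_pos:
  assumes A: "A > 0"
  shows "has_bochner_integral lborel (\<lambda>s. indicator {0<..} s * (logk A s / s)) (pi\<^sup>2 / 2)"
proof -
  have "has_bochner_integral lborel (\<lambda>s. indicator {0<..} (0 + 1 / A * s) * (logk 1 (0 + 1 / A * s) / (0 + 1 / A * s))) ((pi\<^sup>2 / 2) /\<^sub>R \<bar>1 / A\<bar>)"
    using logk_integral_1 A by (subst lborel_has_bochner_integral_real_affine_iff[symmetric]) auto
  from has_bochner_integral_mult_right[OF this, of "1 / A"]
  have "has_bochner_integral lborel (\<lambda>s. 1 / A * (indicator {0<..} (0 + 1 / A * s) * (logk 1 (0 + 1 / A * s) / (0 + 1 / A * s)))) (pi\<^sup>2 / 2)"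
    using A by simp
  moreover have "AE s in lborel. 1 / A * (indicator {0<..} (0 + 1 / A * s) * (logk 1 (0 + 1 / A * s) / (0 + 1 / A * s))) = indicator {0<..} s * (logk A s / s)"
    using AE_lborel_singleton[of A]
  proof eventually_elim
    case (elim s)
    show ?case
    proof (cases "s > 0")
      case True
      have "1 + 1 / A * s = (A + s) / A" "1 - 1 / A * s = (A - s) / A"
        using A by (simp_all add: field_simps)
      then have "logk 1 (1 / A * s) = logk A s"
        using A True elim by (simp add: logk_def abs_divide ln_div)
      then show ?thesis
        using A True by simp
    next
      case False
      then have "\<not> 1 / A * s > 0" using A by (simp add: zero_less_divide_iff)
      then show ?thesis using False by simp
    qed
  qed
  ultimately show ?thesis
    by (subst (asm) has_bochner_integral_cong_AE) auto
qed

lemma logk_minus: "logk (- A) s = - logk A s"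
  by (simp add: logk_def abs_minus_commute add.commute)

lemma logk_integral:
  assumes "A \<noteq> 0"
  shows "has_bochner_integral lborel (\<lambda>s. indicator {0<..} s * (logk A s / s)) (sgn A * (pi\<^sup>2 / 2))"
proof (cases "A > 0")
  case True
  then show ?thesis using logk_integral_pos by simp
next
  case False
  then have A: "- A > 0" "A < 0" using assms by auto
  have "has_bochner_integral lborel (\<lambda>s. - (indicator {0<..} s * (logk (- A) s / s))) (- (pi\<^sup>2 / 2))"
    by (rule has_bochner_integral_minus[OF logk_integral_pos[OF A(1)]])
  then show ?thesis
    using A by (simp add: logk_minus)
qed

text \<open>Almost everywhere on the half line \<open>logk A\<close> has the sign of
  \<open>A\<close>, so its modulus arises by multiplication with \<open>sgn A\<close>. The modulus
  serves as the majorant for all truncations.\<close>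

lemma logk_abs_integral:
  assumes "A \<noteq> 0"
  shows "has_bochner_integral lborel (\<lambda>s. \<bar>indicator {0<..} s * (logk A s / s)\<bar>) (pi\<^sup>2 / 2)"
proof -
  have "has_bochner_integral lborel (\<lambda>s. sgn A * (indicator {0<..} s * (logk A s / s))) (sgn A * (sgn A * (pi\<^sup>2 / 2)))"
    by (rule has_bochner_integral_mult_right) (use logk_integral[OF assms] in auto)
  moreover have "sgn A * (sgn A * (pi\<^sup>2 / 2)) = pi\<^sup>2 / 2"
    using assms by (simp add: sgn_if)
  moreover have "AE s in lborel. sgn A * (indicator {0<..} s * (logk A s / s)) = \<bar>indicator {0<..} s * (logk A s / s)\<bar>"
    using AE_lborel_singleton[of A] AE_lborel_singleton[of "- A"]
  proof eventually_elim
    case (elim s)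
    show ?case
    proof (cases "s > 0")
      case True
      show ?thesis
      proof (cases "A > 0")
        case True
        then show ?thesis using logk_nonneg[of A s] \<open>s > 0\<close> elim by simp
      next
        case False
        then have "logk (- A) s \<ge> 0" using \<open>s > 0\<close> elim assms by (intro logk_nonneg) auto
        then show ?thesis using False \<open>s > 0\<close> assms by (simp add: logk_minus abs_of_nonpos divide_nonpos_pos)
      qed
    qed simp
  qed
  ultimately show ?thesis
    by (subst (asm) has_bochner_integral_cong_AE) auto
qed

definition logk_int :: "real \<Rightarrow> real \<Rightarrow> real" where
  "logk_int \<epsilon> A = (LINT s|lborel. indicator {\<epsilon><..} s * (logk A s / s))"

lemma logk_int_integrable:
  assumes "A \<noteq> 0" "\<epsilon> \<ge> 0"
  shows "integrable lborel (\<lambda>s. indicator {\<epsilon><..} s * (logk A s / s))"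
  by (rule Bochner_Integration.integrable_bound[OF integrable.intros[OF logk_integral[OF assms(1)]]])
     (use assms(2) in \<open>auto simp: indicator_def\<close>)

text \<open>The bound is independent of \<open>\<epsilon>\<close> and of \<open>A\<close>; this
  uniformity makes a constant majorant available when the truncation is removed under the integral
  in \<open>ip_Hbox\<close>.\<close>

lemma logk_int_bound:
  assumes "A \<noteq> 0" "\<epsilon> \<ge> 0"
  shows "\<bar>logk_int \<epsilon> A\<bar> \<le> pi\<^sup>2 / 2"
proof -
  have "\<bar>logk_int \<epsilon> A\<bar> \<le> (LINT s|lborel. \<bar>indicator {\<epsilon><..} s * (logk A s / s)\<bar>)"
    unfolding logk_int_def by (rule integral_abs_bound)
  also have "\<dots> \<le> (LINT s|lborel. \<bar>indicator {0<..} s * (logk A s / s)\<bar>)"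
    by (rule integral_mono[OF integrable_abs[OF logk_int_integrable[OF assms]] integrable.intros[OF logk_abs_integral[OF assms(1)]]])
       (use assms in \<open>auto simp: indicator_def\<close>)
  also have "\<dots> = pi\<^sup>2 / 2"
    using has_bochner_integral_integral_eq[OF logk_abs_integral[OF assms(1)]] .
  finally show ?thesis .
qed

lemma logk_int_tendsto:
  assumes "A \<noteq> 0"
  shows "((\<lambda>\<epsilon>. logk_int \<epsilon> A) \<longlongrightarrow> sgn A * (pi\<^sup>2 / 2)) (at_right 0)"
proof (rule tendsto_at_right_sequentially[where b = 1])
  fix S :: "nat \<Rightarrow> real"
  assume S: "\<And>n. 0 < S n" "S \<longlonglongrightarrow> 0"
  have "(\<lambda>n. logk_int (S n) A) \<longlonglongrightarrow> (LINT s|lborel. indicator {0<..} s * (logk A s / s))"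
    unfolding logk_int_def
  proof (rule integral_dominated_convergence)
    show "integrable lborel (\<lambda>s. \<bar>indicator {0<..} s * (logk A s / s)\<bar>)"
      using logk_abs_integral[OF assms] by (simp add: has_bochner_integral_iff)
    show "AE s in lborel. (\<lambda>n. indicator {S n<..} s * (logk A s / s)) \<longlonglongrightarrow> indicator {0<..} s * (logk A s / s)"
    proof (rule AE_I2)
      fix s
      have "eventually (\<lambda>n. indicator {S n<..} s * (logk A s / s) = indicator {0<..} s * (logk A s / s)) sequentially"
      proof (cases "s > 0")
        case True
        show ?thesis
          using order_tendstoD(2)[OF S(2) True] by eventually_elim (use True in \<open>auto simp: indicator_def\<close>)
      next
        case False
        have "\<not> S n < s" for n using S(1)[of n] False by linarith
        then show ?thesis using False by (simp add: indicator_def)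
      qed
      then show "(\<lambda>n. indicator {S n<..} s * (logk A s / s)) \<longlonglongrightarrow> indicator {0<..} s * (logk A s / s)"
        by (rule tendsto_eventually)
    qed
    show "AE s in lborel. norm (indicator {S n<..} s * (logk A s / s)) \<le> \<bar>indicator {0<..} s * (logk A s / s)\<bar>" for n
      using S(1)[of n] by (intro AE_I2) (auto simp: indicator_def)
  qed auto
  then show "(\<lambda>n. logk_int (S n) A) \<longlonglongrightarrow> sgn A * (pi\<^sup>2 / 2)"
    unfolding has_bochner_integral_integral_eq[OF logk_integral[OF assms]] .
qed simp

lemma integral_fold:
  fixes k :: "real \<Rightarrow> real"
  assumes "integrable lborel k"
  shows "integral\<^sup>L lborel k = (LINT s|lborel. indicator {0<..} s * (k s + k (- s)))"
proof -
  have km: "k \<in> borel_measurable borel" using assms by auto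
  have i1: "integrable lborel (\<lambda>s. indicator {0<..} s * k s)"
    by (rule Bochner_Integration.integrable_bound[OF assms]) (use km in \<open>auto simp: indicator_def\<close>)
  have i2: "integrable lborel (\<lambda>s. indicator {..<0} s * k s)"
    by (rule Bochner_Integration.integrable_bound[OF assms]) (use km in \<open>auto simp: indicator_def\<close>)
  have "integral\<^sup>L lborel k = (LINT s|lborel. indicator {0<..} s * k s + indicator {..<0} s * k s)"
  proof (rule integral_cong_AE)
    show "AE s in lborel. k s = indicator {0<..} s * k s + indicator {..<0} s * k s"
      using AE_lborel_singleton[of "0::real"] by eventually_elim (auto simp: indicator_def)
  qed (use km in auto)
  also have "\<dots> = (LINT s|lborel. indicator {0<..} s * k s) + (LINT s|lborel. indicator {..<0} s * k s)"
    using i1 i2 by simp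
  also have "(LINT s|lborel. indicator {..<0} s * k s) = (LINT s|lborel. indicator {..<0} (- s) * k (- s))"
    using lborel_integral_real_affine[of "-1" "\<lambda>s. indicator {..<0} s * k s" 0] by simp
  also have "(\<lambda>s. indicator {..<0} (- s) * k (- s)) = (\<lambda>s::real. indicator {0<..} s * k (- s))"
    by (auto simp: indicator_def)
  also have "(LINT s|lborel. indicator {0<..} s * k s) + (LINT s|lborel. indicator {0<..} s * k (- s))
      = (LINT s|lborel. indicator {0<..} s * k s + indicator {0<..} s * k (- s))"
  proof (rule Bochner_Integration.integral_add[symmetric])
    have "integrable lborel (\<lambda>s. indicator {..<0} (0 + - 1 * s) * k (0 + - 1 * s))"
      by (rule lborel_integrable_real_affine[OF i2]) simp
    also have "(\<lambda>s. indicator {..<0} (0 + - 1 * s) * k (0 + - 1 * s)) = (\<lambda>s::real. indicator {0<..} s * k (- s))"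
      by (auto simp: indicator_def)
    finally show "integrable lborel (\<lambda>s. indicator {0<..} s * k (- s))" .
  qed (rule i1)
  finally show ?thesis by (simp add: distrib_left)
qed

text \<open>Substitute t = x - s and fold onto s > 0. As the truncation is symmetric, the odd kernel
  1 / s leaves the difference of \<open>logr a b\<close> at x - s and x + s, which regroups into the
  kernels belonging to x - b and x - a.\<close>

lemma trunc_logr:
  assumes e: "\<epsilon> > 0" and x: "x \<noteq> a" "x \<noteq> b"
  shows "trunc \<epsilon> (\<lambda>t. of_real (logr a b t)) x = of_real (logk_int \<epsilon> (x - b) - logk_int \<epsilon> (x - a))"
proof -
  let ?k = "\<lambda>s. logr a b (x - s) * itrunc \<epsilon> s"
  have "integrable lborel (\<lambda>t. complex_of_real (logr a b t) * of_real (itrunc \<epsilon> (x - t)))"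
    by (rule trunc_integrable[OF logr_L2 e])
  then have h: "integrable lborel (\<lambda>t. logr a b t * itrunc \<epsilon> (x - t))"
    by (subst (asm) of_real_mult[symmetric]) (simp only: complex_of_real_integrable_eq)
  have k: "integrable lborel ?k"
    using lborel_integrable_real_affine[OF h, of "-1" x] by simp
  have "trunc \<epsilon> (\<lambda>t. of_real (logr a b t)) x = of_real (LINT t|lborel. logr a b t * itrunc \<epsilon> (x - t))"
    unfolding trunc_def by (simp only: of_real_mult[symmetric] integral_complex_of_real)
  also have "(LINT t|lborel. logr a b t * itrunc \<epsilon> (x - t)) = integral\<^sup>L lborel ?k"
    using lborel_integral_real_affine[of "-1" "\<lambda>t. logr a b t * itrunc \<epsilon> (x - t)" x] by simp
  also have "\<dots> = (LINT s|lborel. indicator {0<..} s * (?k s + ?k (- s)))"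
    by (rule integral_fold[OF k])
  also have "\<dots> = (LINT s|lborel. indicator {\<epsilon><..} s * (logk (x - b) s / s) - indicator {\<epsilon><..} s * (logk (x - a) s / s))"
  proof (intro Bochner_Integration.integral_cong refl)
    fix s :: real
    show "indicator {0<..} s * (?k s + ?k (- s)) = indicator {\<epsilon><..} s * (logk (x - b) s / s) - indicator {\<epsilon><..} s * (logk (x - a) s / s)"
    proof (cases "s > \<epsilon>")
      case True
      have "logr a b (x - s) - logr a b (x - (- s)) = logk (x - b) s - logk (x - a) s"
        unfolding logr_def logk_def by (simp add: algebra_simps)
      then have "logr a b (x - s) / s - logr a b (x - (- s)) / s = logk (x - b) s / s - logk (x - a) s / s"
        by (simp only: diff_divide_distrib[symmetric])
      then show ?thesis
        using True e by (simp add: itrunc_def)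
    next
      case False
      then show ?thesis using e by (auto simp: itrunc_def indicator_def)
    qed
  qed
  also have "\<dots> = logk_int \<epsilon> (x - b) - logk_int \<epsilon> (x - a)"
    unfolding logk_int_def using logk_int_integrable[of "x - a" \<epsilon>] logk_int_integrable[of "x - b" \<epsilon>] e x by simp
  finally show ?thesis .
qed

lemma trunc_logr_bound:
  assumes "\<epsilon> > 0" "x \<noteq> a" "x \<noteq> b"
  shows "cmod (trunc \<epsilon> (\<lambda>t. of_real (logr a b t)) x) \<le> pi\<^sup>2"
  unfolding trunc_logr[OF assms] norm_of_real
  using logk_int_bound[of "x - a" \<epsilon>] logk_int_bound[of "x - b" \<epsilon>] assms by simp

text \<open>Each part tends to a sign times pi^2 / 2. The signs of x - b and x - a differ exactly
  for x between \<open>a\<close> and \<open>b\<close>, where the total is -pi^2: this is the twofold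
  Hilbert transform of a box before normalization by 1 / pi^2.\<close>

lemma trunc_logr_tendsto:
  assumes "a \<le> b" "x \<noteq> a" "x \<noteq> b"
  shows "((\<lambda>\<epsilon>. trunc \<epsilon> (\<lambda>t. of_real (logr a b t)) x) \<longlongrightarrow> - of_real (pi\<^sup>2) * ibox a b x) (at_right 0)"
proof -
  have "((\<lambda>\<epsilon>. logk_int \<epsilon> (x - b) - logk_int \<epsilon> (x - a)) \<longlongrightarrow> sgn (x - b) * (pi\<^sup>2 / 2) - sgn (x - a) * (pi\<^sup>2 / 2)) (at_right 0)"
    using assms by (intro tendsto_diff logk_int_tendsto) auto
  then have lim: "((\<lambda>\<epsilon>. complex_of_real (logk_int \<epsilon> (x - b) - logk_int \<epsilon> (x - a))) \<longlongrightarrow> of_real (sgn (x - b) * (pi\<^sup>2 / 2) - sgn (x - a) * (pi\<^sup>2 / 2))) (at_right 0)"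
    by (rule tendsto_of_real)
  have val: "complex_of_real (sgn (x - b) * (pi\<^sup>2 / 2) - sgn (x - a) * (pi\<^sup>2 / 2)) = - of_real (pi\<^sup>2) * ibox a b x"
    using assms by (auto simp: ibox_def indicator_def sgn_if)
  have "\<forall>\<^sub>F \<epsilon> in at_right 0. complex_of_real (logk_int \<epsilon> (x - b) - logk_int \<epsilon> (x - a)) = trunc \<epsilon> (\<lambda>t. of_real (logr a b t)) x"
    using trunc_logr assms by (intro eventually_at_rightI[where b = 1]) auto
  from Lim_transform_eventually[OF lim this] show ?thesis
    unfolding val .
qed

section \<open>Antisymmetry and isometry of the Hilbert transform on boxes\<close>

lemma itrunc_minus: "itrunc \<epsilon> (- v) = - itrunc \<epsilon> v"
  by (simp add: itrunc_def)

lemma trunc_measurable: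
  assumes [measurable]: "f \<in> borel_measurable borel"
  shows "trunc \<epsilon> f \<in> borel_measurable borel"
  unfolding trunc_def[abs_def] by measurable

text \<open>With the truncated kernel the double integral converges absolutely, the kernel being
  bounded by a multiple of 1 / (1 + |t|) uniformly over [c, d] and \<open>f\<close> being square
  integrable. Integrating over [c, d] first yields \<open>logr_trunc\<close>; integrating against
  \<open>f\<close> first yields \<open>trunc\<close>, with a minus sign because the kernel is
  odd.\<close>

lemma trunc_Fubini:
  assumes f: "f \<in> L2" and e: "\<epsilon> > 0" and cd: "c \<le> d"
  shows "(LINT t|lborel. f t * of_real (logr_trunc \<epsilon> c d t)) = - (LINT u|lborel. ibox c d u * trunc \<epsilon> f u)"
proof -
  have [measurable]: "f \<in> borel_measurable borel"
    using f by (rule L2_measurable)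
  define M where "M = \<bar>c\<bar> + \<bar>d\<bar>"
  define W where "W = (1 + M) / \<epsilon> + 1"
  have W: "W \<ge> 0" using e by (simp add: W_def M_def)
  let ?F = "\<lambda>t u. f t * complex_of_real (indicator {c..d} u * itrunc \<epsilon> (t - u))"
  have b: "\<bar>indicator {c..d} u * itrunc \<epsilon> (t - u)\<bar> \<le> W / (1 + \<bar>t\<bar>) * indicator {c..d} u" for t u
  proof (cases "u \<in> {c..d}")
    case True
    then have "\<bar>itrunc \<epsilon> (u - t)\<bar> \<le> W / (1 + \<bar>t\<bar>)"
      unfolding W_def using e by (intro itrunc_bound) (auto simp: M_def)
    then show ?thesis
      using True itrunc_minus[of \<epsilon> "u - t"] by simp
  qed simp
  have ii: "integrable lborel (\<lambda>u. C * indicator {c..d} u :: real)" for C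
    by (intro integrable_mult_right integrable_real_indicator) (auto simp: emeasure_lborel_Icc_eq)
  have i2: "integrable lborel (\<lambda>u. indicator {c..d} u * itrunc \<epsilon> (t - u))" for t
    using integral_itrunc[OF e cd] by (simp add: has_bochner_integral_iff)
  have WL: "(\<lambda>t. complex_of_real (W / (1 + \<bar>t\<bar>))) \<in> L2"
  proof (rule L2_dominated[OF _ inverse_one_plus_abs_power2_integrable[of W]])
    show "AE t in lborel. cmod (complex_of_real (W / (1 + \<bar>t\<bar>))) \<le> W / (1 + \<bar>t\<bar>)"
      unfolding norm_of_real using W by (intro AE_I2) simp
  qed auto
  have int: "integrable (lborel \<Otimes>\<^sub>M lborel) (case_prod ?F)"
  proof (rule lborel_pair.Fubini_integrable)
    show "AE t in lborel. integrable lborel (\<lambda>u. case_prod ?F (t, u))"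
      using i2 by (intro AE_I2) (auto intro!: integrable_mult_right integrable_of_real simp del: of_real_mult)
    show "integrable lborel (\<lambda>t. LINT u|lborel. norm (case_prod ?F (t, u)))"
    proof (rule Bochner_Integration.integrable_bound)
      show "integrable lborel (\<lambda>t. (d - c) * cmod (f t * complex_of_real (W / (1 + \<bar>t\<bar>))))"
        by (intro integrable_mult_right integrable_norm L2_mult_integrable[OF f WL])
      show "AE t in lborel. norm (LINT u|lborel. norm (case_prod ?F (t, u))) \<le> norm ((d - c) * cmod (f t * complex_of_real (W / (1 + \<bar>t\<bar>))))"
      proof (rule AE_I2)
        fix t
        have "(LINT u|lborel. norm (case_prod ?F (t, u))) = cmod (f t) * (LINT u|lborel. \<bar>indicator {c..d} u * itrunc \<epsilon> (t - u)\<bar>)"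
          by (simp only: case_prod_conv norm_mult norm_of_real) simp
        also have "(LINT u|lborel. \<bar>indicator {c..d} u * itrunc \<epsilon> (t - u)\<bar>) \<le> (LINT u|lborel. W / (1 + \<bar>t\<bar>) * indicator {c..d} u)"
          by (rule integral_mono[OF integrable_abs[OF i2] ii b])
        also have "\<dots> = W / (1 + \<bar>t\<bar>) * (d - c)"
          using cd by simp
        finally have "(LINT u|lborel. norm (case_prod ?F (t, u))) \<le> cmod (f t) * (W / (1 + \<bar>t\<bar>) * (d - c))"
          by (simp add: mult_left_mono)
        moreover have "(LINT u|lborel. norm (case_prod ?F (t, u))) \<ge> 0"
          by (rule Bochner_Integration.integral_nonneg) simp
        moreover have "norm ((d - c) * cmod (f t * complex_of_real (W / (1 + \<bar>t\<bar>)))) = cmod (f t) * (W / (1 + \<bar>t\<bar>) * (d - c))"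
        proof -
          have "norm ((d - c) * cmod (f t * complex_of_real k)) = cmod (f t) * (k * (d - c))" if "k \<ge> 0" for k
            using that cd by (simp add: norm_mult mult_ac)
          moreover have "W / (1 + \<bar>t\<bar>) \<ge> 0" using W by simp
          ultimately show ?thesis .
        qed
        ultimately show "norm (LINT u|lborel. norm (case_prod ?F (t, u))) \<le> norm ((d - c) * cmod (f t * complex_of_real (W / (1 + \<bar>t\<bar>))))"
          by simp
      qed
    qed measurable
  qed measurable
  have "(LINT t|lborel. f t * of_real (logr_trunc \<epsilon> c d t)) = (LINT t|lborel. LINT u|lborel. ?F t u)"
  proof (intro Bochner_Integration.integral_cong refl)
    fix t
    have "(LINT u|lborel. ?F t u) = f t * of_real (LINT u|lborel. indicator {c..d} u * itrunc \<epsilon> (t - u))"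
      by (simp only: integral_mult_right_zero integral_complex_of_real)
    then show "f t * of_real (logr_trunc \<epsilon> c d t) = (LINT u|lborel. ?F t u)"
      unfolding has_bochner_integral_integral_eq[OF integral_itrunc[OF e cd]] by (rule sym)
  qed
  also have "\<dots> = (LINT u|lborel. LINT t|lborel. ?F t u)"
    by (rule lborel_pair.Fubini_integral[OF int, symmetric])
  also have "\<dots> = (LINT u|lborel. - (ibox c d u * trunc \<epsilon> f u))"
  proof (intro Bochner_Integration.integral_cong refl)
    fix u
    have "?F t u = - ibox c d u * (f t * of_real (itrunc \<epsilon> (u - t)))" for t
      using itrunc_minus[of \<epsilon> "u - t"] by (simp add: ibox_def)
    then show "(LINT t|lborel. ?F t u) = - (ibox c d u * trunc \<epsilon> f u)"
      by (simp add: trunc_def)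
  qed
  finally show ?thesis by simp
qed

text \<open>The limit of \<open>trunc_Fubini\<close> as the truncation disappears. The left side is
  dominated by the product of \<open>f\<close> and \<open>logr\<close> for every \<open>f\<close> in
  L2; on the right, the limit \<open>l\<close> and the majorant \<open>w\<close> depend on
  \<open>f\<close> and are supplied by the caller.\<close>

lemma trunc_limit_Fubini:
  assumes f: "f \<in> L2" and cd: "c \<le> d" and l: "l \<in> borel_measurable borel"
    and lim: "AE u in lborel. ((\<lambda>\<epsilon>. trunc \<epsilon> f u) \<longlongrightarrow> l u) (at_right 0)"
    and bd: "\<And>\<epsilon>. \<epsilon> > 0 \<Longrightarrow> AE u in lborel. cmod (trunc \<epsilon> f u) \<le> w u"
    and w: "integrable lborel (\<lambda>u. indicator {c..d} u * w u)"
  shows "(LINT t|lborel. f t * of_real (logr c d t)) = - (LINT u|lborel. ibox c d u * l u)"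
proof -
  have [measurable]: "f \<in> borel_measurable borel"
    using f by (rule L2_measurable)
  define \<epsilon> where "\<epsilon> = (\<lambda>k::nat. 1 / real (Suc k))"
  have e: "\<epsilon> k > 0" for k by (simp add: \<epsilon>_def)
  have el: "filterlim \<epsilon> (at_right 0) sequentially"
    unfolding \<epsilon>_def by real_asymp
  have tm: "trunc (\<epsilon> k) f \<in> borel_measurable borel" for k
    by (rule trunc_measurable) simp
  have im: "ibox c d \<in> borel_measurable borel"
    using ibox_L2 by (rule L2_measurable)
  have "(\<lambda>k. LINT t|lborel. f t * of_real (logr_trunc (\<epsilon> k) c d t)) \<longlonglongrightarrow> (LINT t|lborel. f t * of_real (logr c d t))"
  proof (rule integral_dominated_convergence)
    show "integrable lborel (\<lambda>t. cmod (f t * of_real (logr c d t)))"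
      by (intro integrable_norm L2_mult_integrable f logr_L2)
    show "AE t in lborel. (\<lambda>k. f t * of_real (logr_trunc (\<epsilon> k) c d t)) \<longlonglongrightarrow> f t * of_real (logr c d t)"
      using AE_lborel_singleton[of c] AE_lborel_singleton[of d]
    proof eventually_elim
      case (elim t)
      show ?case
        by (intro tendsto_intros filterlim_compose[OF logr_trunc_tendsto el]) (use elim in auto)
    qed
    show "AE t in lborel. norm (f t * of_real (logr_trunc (\<epsilon> k) c d t)) \<le> cmod (f t * of_real (logr c d t))" for k
      using AE_lborel_singleton[of c] AE_lborel_singleton[of d]
    proof eventually_elim
      case (elim t)
      then show ?case
        using logr_trunc_le_logr[of t c d "\<epsilon> k"] e[of k] by (auto simp: norm_mult intro!: mult_left_mono)
    qed
  qed measurable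
  moreover have "(\<lambda>k. - (LINT u|lborel. ibox c d u * trunc (\<epsilon> k) f u)) \<longlonglongrightarrow> - (LINT u|lborel. ibox c d u * l u)"
  proof (intro tendsto_minus, rule integral_dominated_convergence[OF _ _ w])
    show "AE u in lborel. (\<lambda>k. ibox c d u * trunc (\<epsilon> k) f u) \<longlonglongrightarrow> ibox c d u * l u"
      using lim
    proof eventually_elim
      case (elim u)
      show ?case
        by (intro tendsto_intros filterlim_compose[OF elim el])
    qed
    show "AE u in lborel. norm (ibox c d u * trunc (\<epsilon> k) f u) \<le> indicator {c..d} u * w u" for k
      using bd[OF e[of k]] by eventually_elim (auto simp: norm_mult ibox_def indicator_def)
  qed (use im l tm in auto)
  ultimately show ?thesis
    unfolding trunc_Fubini[OF f e cd] by (rule LIMSEQ_unique)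
qed

definition Hbox :: "real \<Rightarrow> real \<Rightarrow> real \<Rightarrow> complex" where
  "Hbox a b x = of_real (logr a b x / pi)"

lemma Hbox_eq: "Hbox a b = (\<lambda>x. of_real (1 / pi) * of_real (logr a b x))"
  by (auto simp: Hbox_def)

lemma Hbox_L2: "Hbox a b \<in> L2"
  unfolding Hbox_eq by (rule L2_scale[OF logr_L2])

lemma AE_neq2: "AE x in lborel. x \<noteq> a \<and> x \<noteq> (b::real)"
  using AE_lborel_singleton[of a] AE_lborel_singleton[of b] by eventually_elim auto

text \<open>Antisymmetry applied to the transform of a box, whose own transform is minus the box:
  (Hf, Hg) = - (HHf, g) = (f, g), computed with \<open>logr\<close> and the factor pi^2 in place of
  normalized transforms.\<close>

lemma ip_Hbox:
  assumes "a \<le> b" "c \<le> d"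
  shows "ip (Hbox a b) (Hbox c d) = ip (ibox a b) (ibox c d)"
proof -
  have "ip (Hbox a b) (Hbox c d) = (LINT x|lborel. of_real (1 / pi\<^sup>2) * (of_real (logr a b x) * of_real (logr c d x)))"
    unfolding ip_def Hbox_def by (intro Bochner_Integration.integral_cong) (auto simp: power2_eq_square)
  also have "\<dots> = of_real (1 / pi\<^sup>2) * (LINT x|lborel. of_real (logr a b x) * of_real (logr c d x))"
    by simp
  also have "(LINT x|lborel. complex_of_real (logr a b x) * of_real (logr c d x)) 
      = - (LINT u|lborel. ibox c d u * (- of_real (pi\<^sup>2) * ibox a b u))"
  proof (rule trunc_limit_Fubini[OF logr_L2 assms(2), where w = "\<lambda>_. pi\<^sup>2"])
    show "AE u in lborel. ((\<lambda>\<epsilon>. trunc \<epsilon> (\<lambda>t. complex_of_real (logr a b t)) u) \<longlongrightarrow> - of_real (pi\<^sup>2) * ibox a b u) (at_right 0)"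
      using AE_neq2[of a b] by eventually_elim (rule trunc_logr_tendsto, use assms in auto)
    show "AE u in lborel. cmod (trunc \<epsilon> (\<lambda>t. complex_of_real (logr a b t)) u) \<le> pi\<^sup>2" if "\<epsilon> > 0" for \<epsilon>
      using AE_neq2[of a b] by eventually_elim (use that in \<open>auto intro!: trunc_logr_bound\<close>)
    show "integrable lborel (\<lambda>u. indicator {c..d} u * pi\<^sup>2 :: real)"
      by (intro integrable_mult_left integrable_real_indicator) (auto simp: emeasure_lborel_Icc_eq)
  qed (use L2_measurable[OF ibox_L2] in auto)
  also have "(LINT u|lborel. ibox c d u * (- of_real (pi\<^sup>2) * ibox a b u)) = (LINT u|lborel. - of_real (pi\<^sup>2) * (ibox c d u * ibox a b u))"
    by (intro Bochner_Integration.integral_cong) auto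
  also have "- \<dots> = of_real (pi\<^sup>2) * (LINT u|lborel. ibox c d u * ibox a b u)"
    by simp
  also have "of_real (1 / pi\<^sup>2) * (of_real (pi\<^sup>2) * (LINT u|lborel. ibox c d u * ibox a b u)) = ip (ibox a b) (ibox c d)"
    by (simp add: ip_def ibox_def mult.commute)
  finally show ?thesis .
qed

text \<open>Antisymmetry for two boxes. The truncated integrals of the first box are dominated by
  |logr a b|, which is integrable over the second.\<close>

lemma ip_ibox_Hbox:
  assumes "a \<le> b" "c \<le> d"
  shows "ip (ibox a b) (Hbox c d) = - ip (Hbox a b) (ibox c d)"
proof -
  have "ip (ibox a b) (Hbox c d) = (LINT x|lborel. of_real (1 / pi) * (ibox a b x * of_real (logr c d x)))"
    unfolding ip_def Hbox_def by (intro Bochner_Integration.integral_cong) auto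
  also have "\<dots> = of_real (1 / pi) * (LINT x|lborel. ibox a b x * of_real (logr c d x))"
    by simp
  also have "(LINT x|lborel. ibox a b x * of_real (logr c d x)) = - (LINT u|lborel. ibox c d u * of_real (logr a b u))"
  proof (rule trunc_limit_Fubini[OF ibox_L2 assms(2), where w = "\<lambda>u. \<bar>logr a b u\<bar>"])
    show "AE u in lborel. ((\<lambda>\<epsilon>. trunc \<epsilon> (ibox a b) u) \<longlongrightarrow> of_real (logr a b u)) (at_right 0)"
      using AE_neq2[of a b]
    proof eventually_elim
      case (elim u)
      then have "((\<lambda>\<epsilon>. complex_of_real (logr_trunc \<epsilon> a b u)) \<longlongrightarrow> of_real (logr a b u)) (at_right 0)"
        by (intro tendsto_of_real logr_trunc_tendsto) auto
      moreover have "\<forall>\<^sub>F \<epsilon> in at_right 0. complex_of_real (logr_trunc \<epsilon> a b u) = trunc \<epsilon> (ibox a b) u"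
        using trunc_ibox assms by (intro eventually_at_rightI[where b = 1]) auto
      ultimately show ?case
        by (rule Lim_transform_eventually)
    qed
    show "AE u in lborel. cmod (trunc \<epsilon> (ibox a b) u) \<le> \<bar>logr a b u\<bar>" if "\<epsilon> > 0" for \<epsilon>
      using AE_neq2[of a b] by eventually_elim (use that assms logr_trunc_le_logr in \<open>auto simp: trunc_ibox\<close>)
    have "integrable lborel (\<lambda>u. cmod (ibox c d u * of_real (logr a b u)))"
      by (intro integrable_norm L2_mult_integrable ibox_L2 logr_L2)
    then show "integrable lborel (\<lambda>u. indicator {c..d} u * \<bar>logr a b u\<bar>)"
      by (simp add: ibox_def norm_mult)
  qed auto
  also have "of_real (1 / pi) * - (LINT u|lborel. ibox c d u * of_real (logr a b u)) = - (LINT u|lborel. of_real (1 / pi) * (ibox c d u * of_real (logr a b u)))"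
    by simp
  also have "(LINT u|lborel. of_real (1 / pi) * (ibox c d u * of_real (logr a b u))) = ip (Hbox a b) (ibox c d)"
    unfolding ip_def Hbox_def by (intro Bochner_Integration.integral_cong) (auto simp: ibox_def)
  finally show ?thesis .
qed

text \<open>\<open>hilbert\<close> is an unconditional \<open>Lim\<close>, which is informative only
  if the limit exists. The relation records existence together with the value and is stable under
  linear combinations.\<close>

definition has_hilbert :: "(real \<Rightarrow> complex) \<Rightarrow> real \<Rightarrow> complex \<Rightarrow> bool" where
  "has_hilbert f x l \<longleftrightarrow> ((\<lambda>\<epsilon>. of_real (1 / pi) * trunc \<epsilon> f x) \<longlongrightarrow> l) (at_right 0)"

lemma has_hilbert_hilbert: "has_hilbert f x l \<Longrightarrow> hilbert f x = l"
  unfolding hilbert_trunc has_hilbert_def by (intro tendsto_Lim) auto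

lemma hilbert_cong_AE:
  assumes "f \<in> borel_measurable borel" "g \<in> borel_measurable borel" "AE t in lborel. f t = g t"
  shows "hilbert f = hilbert g"
  unfolding hilbert_trunc[abs_def] trunc_cong_AE[OF assms] ..

lemma has_hilbert_lincomb:
  assumes "f \<in> L2" "g \<in> L2" "has_hilbert f x l" "has_hilbert g x m"
  shows "has_hilbert (\<lambda>t. c * f t + g t) x (c * l + m)"
proof -
  have "((\<lambda>\<epsilon>. c * (of_real (1 / pi) * trunc \<epsilon> f x) + of_real (1 / pi) * trunc \<epsilon> g x) \<longlongrightarrow> c * l + m) (at_right 0)"
    using assms(3,4) unfolding has_hilbert_def by (intro tendsto_intros)
  moreover have "\<forall>\<^sub>F \<epsilon> in at_right 0. c * (of_real (1 / pi) * trunc \<epsilon> f x) + of_real (1 / pi) * trunc \<epsilon> g x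
      = of_real (1 / pi) * trunc \<epsilon> (\<lambda>t. c * f t + g t) x"
    using trunc_lincomb[OF assms(1,2)] by (intro eventually_at_rightI[where b = 1]) (auto simp: algebra_simps)
  ultimately show ?thesis
    unfolding has_hilbert_def by (rule Lim_transform_eventually)
qed

lemma has_hilbert_zero: "has_hilbert (\<lambda>t. 0) x 0"
  by (simp add: has_hilbert_def trunc_def)

lemma has_hilbert_ibox:
  assumes "a \<le> b" "x \<noteq> a" "x \<noteq> b"
  shows "has_hilbert (ibox a b) x (Hbox a b x)"
proof -
  have "((\<lambda>\<epsilon>. of_real (1 / pi) * complex_of_real (logr_trunc \<epsilon> a b x)) \<longlongrightarrow> of_real (1 / pi) * of_real (logr a b x)) (at_right 0)"
    using assms by (intro tendsto_intros logr_trunc_tendsto) auto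
  moreover have "\<forall>\<^sub>F \<epsilon> in at_right 0. of_real (1 / pi) * complex_of_real (logr_trunc \<epsilon> a b x) = of_real (1 / pi) * trunc \<epsilon> (ibox a b) x"
    using trunc_ibox assms by (intro eventually_at_rightI[where b = 1]) auto
  ultimately show ?thesis
    unfolding has_hilbert_def Hbox_eq by (rule Lim_transform_eventually)
qed

lemma has_hilbert_Hbox:
  assumes "a \<le> b" "x \<noteq> a" "x \<noteq> b"
  shows "has_hilbert (Hbox a b) x (- ibox a b x)"
proof -
  have "((\<lambda>\<epsilon>. of_real (1 / pi) * (of_real (1 / pi) * trunc \<epsilon> (\<lambda>t. of_real (logr a b t)) x)) \<longlongrightarrow>
      of_real (1 / pi) * (of_real (1 / pi) * (- of_real (pi\<^sup>2) * ibox a b x))) (at_right 0)"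
    by (intro tendsto_intros trunc_logr_tendsto assms)
  moreover have "of_real (1 / pi) * trunc \<epsilon> (\<lambda>t. of_real (logr a b t)) x = trunc \<epsilon> (Hbox a b) x" for \<epsilon>
    unfolding Hbox_eq trunc_def by (simp add: mult.assoc)
  moreover have "complex_of_real (1 / pi) * (of_real (1 / pi) * (- of_real (pi\<^sup>2) * ibox a b x)) = - ibox a b x"
    by (simp add: power2_eq_square)
  ultimately show ?thesis
    unfolding has_hilbert_def by (simp only:)
qed

lemma ip_even_odd:
  assumes "\<And>x. f (- x) = f x" "\<And>x. g (- x) = - g x"
  shows "ip f g = 0"
proof -
  have "ip f g = (LINT x|lborel. f (- x) * cnj (g (- x)))"
    unfolding ip_def using lborel_integral_real_affine[of "-1" "\<lambda>x. f x * cnj (g x)" 0] by simp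
  also have "\<dots> = - ip f g"
    by (simp add: ip_def assms)
  finally show ?thesis by simp
qed

lemma ebox_eq_ibox: "ebox a = ibox (- a) a"
  by (auto simp: ebox_def ibox_def)

lemma Hbox_odd: "Hbox (- a) a (- x) = - Hbox (- a) a x"
proof -
  have "logr (- a) a (- x) = - logr (- a) a x"
    by (simp add: logr_def abs_minus_commute add.commute)
  then show ?thesis by (simp add: Hbox_def)
qed

text \<open>The pairs \<open>(f, \<H>f)\<close> and \<open>(\<H>f, - f)\<close> for \<open>f\<close> a box have equal Gram matrices; hence
  \<open>\<parallel>h + \<H>g\<parallel> = \<parallel>\<H>h - g\<parallel>\<close> for step functions \<open>h\<close> and \<open>g\<close>, so that approximating \<open>- \<H>g\<close> by even step functions \<open>h\<close>
  approximates the odd step function \<open>g\<close> by \<open>\<H>h\<close>.\<close>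

definition Hpairs :: "((real \<Rightarrow> complex) \<times> (real \<Rightarrow> complex)) set" where
  "Hpairs = {(ibox a b, Hbox a b) | a b. a \<le> b} \<union> {(Hbox a b, \<lambda>x. - ibox a b x) | a b. a \<le> b}"

lemma Hpairs_L2: "Hpairs \<subseteq> L2 \<times> L2"
  by (auto simp: Hpairs_def ibox_L2 Hbox_L2 L2_uminus)

lemma ip_uminus_left: "ip (\<lambda>x. - f x) g = - ip f g"
  by (simp add: ip_def)

lemma ip_uminus_right: "ip f (\<lambda>x. - g x) = - ip f g"
  by (simp add: ip_def)

lemma Hpairs_gram:
  assumes "(f, g) \<in> Hpairs" "(f', g') \<in> Hpairs"
  shows "ip g g' = ip f f'"
proof -
  have "ip (Hbox a b) (\<lambda>x. - ibox c d x) = ip (ibox a b) (Hbox c d)" if "a \<le> b" "c \<le> d" for a b c d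
    using ip_ibox_Hbox[OF that] by (simp add: ip_uminus_right)
  moreover have "ip (\<lambda>x. - ibox a b x) (Hbox c d) = ip (Hbox a b) (ibox c d)" if "a \<le> b" "c \<le> d" for a b c d
    using ip_ibox_Hbox[OF that] by (simp add: ip_uminus_left)
  moreover have "ip (\<lambda>x. - ibox a b x) (\<lambda>x. - ibox c d x) = ip (Hbox a b) (Hbox c d)" if "a \<le> b" "c \<le> d" for a b c d
    using ip_Hbox[OF that] by (simp add: ip_uminus_left ip_uminus_right)
  ultimately show ?thesis
    using assms ip_Hbox by (auto simp: Hpairs_def)
qed

lemma (in dense_pos) hilbert_dense:
  assumes a: "a \<in> D"
  shows "(\<lambda>x. of_real (sgn x) * ebox a x) \<in> clspan ((\<lambda>a. Hbox (- a) a) ` D)"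
proof -
  let ?HD = "(\<lambda>a. Hbox (- a) a) ` D"
  have a0: "a > 0" using pos a by simp
  have S: "?HD \<subseteq> L2" using Hbox_L2 by auto
  \<comment> \<open>The odd box with end point \<open>a\<close>, split at 0 because the generators
    are indicators of intervals. Its transform \<open>g'\<close> is even, so that
    \<open>- g'\<close> can be approximated by symmetric boxes.\<close>
  define g where "g = (\<lambda>x. - 1 * ibox (- a) 0 x + ibox 0 a x)"
  define g' where "g' = (\<lambda>x. - 1 * Hbox (- a) 0 x + Hbox 0 a x)"
  have "(ibox (- a) 0, Hbox (- a) 0) \<in> rspan Hpairs" "(ibox 0 a, Hbox 0 a) \<in> rspan Hpairs"
    "(Hbox (- a) 0, \<lambda>x. - ibox (- a) 0 x) \<in> rspan Hpairs" "(Hbox 0 a, \<lambda>x. - ibox 0 a x) \<in> rspan Hpairs"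
    using a0 by (intro rspan_base; force simp: Hpairs_def)+
  then have g1: "(g', \<lambda>x. - 1 * - ibox (- a) 0 x + - ibox 0 a x) \<in> rspan Hpairs"
    unfolding g'_def by (intro rspan_lincomb)
  have "(\<lambda>x. - 1 * - ibox (- a) 0 x + - ibox 0 a x) = (\<lambda>x. - g x)"
    by (auto simp: g_def)
  with g1 have gg: "(g', \<lambda>x. - g x) \<in> rspan Hpairs" by simp
  have gL: "g \<in> L2" "g' \<in> L2"
    unfolding g_def g'_def by (intro L2_lincomb ibox_L2 Hbox_L2)+
  have even: "- g' (- x) = - g' x" for x
  proof -
    have "logr 0 a (- x) = - logr (- a) 0 x" "logr (- a) 0 (- x) = - logr 0 a x"
      by (simp_all add: logr_def abs_minus_commute add.commute)
    then show ?thesis by (simp add: g'_def Hbox_def)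
  qed
  have "(\<lambda>x. - g' x) \<in> clspan (ebox ` D)"
    by (rule even_dense[OF L2_uminus[OF gL(2)] even])
  have step: "\<exists>v. (u, v) \<in> rspan Hpairs \<and> v \<in> cspan ?HD" if "u \<in> cspan (ebox ` D)" for u
    using that
  proof (induction rule: cspan.induct)
    case cspan_zero
    then show ?case using rspan_zero cspan.cspan_zero by blast
  next
    case (cspan_step f u c)
    then obtain d v where d: "d \<in> D" "f = ebox d" and v: "(u, v) \<in> rspan Hpairs" "v \<in> cspan ?HD"
      by blast
    have "(f, Hbox (- d) d) \<in> Hpairs"
      using pos[OF d(1)] unfolding d(2) ebox_eq_ibox Hpairs_def by force
    then have "(\<lambda>x. c * f x + u x, \<lambda>x. c * Hbox (- d) d x + v x) \<in> rspan Hpairs"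
      using v(1) by (rule rspan_step)
    moreover have "(\<lambda>x. c * Hbox (- d) d x + v x) \<in> cspan ?HD"
      using d(1) v(2) by (intro cspan.cspan_step) auto
    ultimately show ?case by blast
  qed
  have "\<exists>v\<in>cspan ?HD. ldist v g < e" if "e > 0" for e
  proof -
    obtain u where u: "u \<in> cspan (ebox ` D)" "ldist u (\<lambda>x. - g' x) < e"
      using \<open>(\<lambda>x. - g' x) \<in> clspan (ebox ` D)\<close> \<open>e > 0\<close> by (rule lclE)
    obtain v where v: "(u, v) \<in> rspan Hpairs" "v \<in> cspan ?HD"
      using step[OF u(1)] by blast
    have "(\<lambda>x. 1 * u x + g' x, \<lambda>x. 1 * v x + - g x) \<in> rspan Hpairs"
      by (rule rspan_lincomb[OF v(1) gg])
    from rspan_isometric[OF Hpairs_L2 Hpairs_gram this] have "ldist v g = ldist u (\<lambda>x. - g' x)"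
      by simp
    then show ?thesis using u(2) by (intro bexI[OF _ v(2)]) simp
  qed
  then have "g \<in> clspan ?HD"
    using gL by (simp add: lcl_def)
  then show ?thesis
  proof (rule lcl_cong_AE)
    show "AE x in lborel. g x = of_real (sgn x) * ebox a x"
      using AE_lborel_singleton[of "0::real"]
      by eventually_elim (use a0 in \<open>auto simp: g_def ibox_def ebox_def indicator_def sgn_if\<close>)
  qed (use cspan_L2[OF S] L2_measurable[OF ebox_L2] in auto)
qed

lemma (in dense_pos) ebox_Hbox_total:
  "clspan (ebox ` D \<union> (\<lambda>a. Hbox (- a) a) ` D) = L2"
proof (rule total_if_even_odd)
  show S: "ebox ` D \<union> (\<lambda>a. Hbox (- a) a) ` D \<subseteq> L2"
    using ebox_L2 Hbox_L2 by auto
  show "ebox a \<in> clspan (ebox ` D \<union> (\<lambda>a. Hbox (- a) a) ` D)" if "a \<in> D" for a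
    using that by (intro clspan_base[OF S]) auto
  have "clspan ((\<lambda>a. Hbox (- a) a) ` D) \<subseteq> clspan (ebox ` D \<union> (\<lambda>a. Hbox (- a) a) ` D)"
    by (intro clspan_subset[OF S]) (auto intro: clspan_base[OF S])
  then show "(\<lambda>x. of_real (sgn x) * ebox a x) \<in> clspan (ebox ` D \<union> (\<lambda>a. Hbox (- a) a) ` D)" if "a \<in> D" for a
    using hilbert_dense[OF that] by blast
qed

subsection \<open>The unitary extension\<close>

lemma L2_bounded_linear_Lipschitz:
  assumes T: "L2_bounded_linear T"
  obtains C where "C \<ge> 0" "\<And>u f. u \<in> L2 \<Longrightarrow> f \<in> L2 \<Longrightarrow> ldist (T u) (T f) \<le> C * ldist u f"
proof -
  obtain C where C: "\<forall>f\<in>L2. L2norm (T f) \<le> C * L2norm f"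
    using T by (auto simp: L2_bounded_linear_def)
  have "ldist (T u) (T f) \<le> max C 0 * ldist u f" if L: "u \<in> L2" "f \<in> L2" for u f
  proof -
    have TL: "T g \<in> L2" if "g \<in> L2" for g
      using T that by (simp add: L2_bounded_linear_def)
    have "AE x in lborel. T (\<lambda>t. 1 * u t + - 1 * f t) x = 1 * T u x + - 1 * T f x"
      using T L unfolding L2_bounded_linear_def by blast
    then have "L2norm (T (\<lambda>t. u t - f t)) = ldist (T u) (T f)"
      using L by (intro L2norm_cong_AE L2_measurable L2_diff TL) auto
    moreover have "L2norm (T (\<lambda>t. u t - f t)) \<le> C * ldist u f"
      using C L2_diff[OF L] by blast
    moreover have "C * ldist u f \<le> max C 0 * ldist u f"
      by (intro mult_right_mono) auto
    ultimately show ?thesis by linarith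
  qed
  then show ?thesis
    by (intro that[of "max C 0"]) auto
qed

lemma L2_bounded_linear_agree:
  assumes T: "L2_bounded_linear T" and T': "L2_bounded_linear T'" and A: "A \<subseteq> L2"
    and eq: "\<And>f. f \<in> A \<Longrightarrow> AE x in lborel. T f x = T' f x"
    and f: "f \<in> clspan A"
  shows "AE x in lborel. T f x = T' f x"
proof -
  have TL: "T g \<in> L2" "T' g \<in> L2" if "g \<in> L2" for g
    using T T' that by (auto simp: L2_bounded_linear_def)
  have lin: "AE x in lborel. T (\<lambda>t. a * f t + b * g t) x = a * T f x + b * T g x"
    "AE x in lborel. T' (\<lambda>t. a * f t + b * g t) x = a * T' f x + b * T' g x"
    if "f \<in> L2" "g \<in> L2" for f g a b
    using T T' that by (auto simp: L2_bounded_linear_def)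
  have span: "AE x in lborel. T u x = T' u x" if "u \<in> cspan A" for u
    using that
  proof (induction rule: cspan.induct)
    case cspan_zero
    show ?case
      using lin(1)[OF L2_zero L2_zero, of 0 0] lin(2)[OF L2_zero L2_zero, of 0 0]
      by eventually_elim simp
  next
    case (cspan_step f g c)
    then have L: "f \<in> L2" "g \<in> L2" using A cspan_L2[OF A] by auto
    show ?case
      using lin(1)[OF L, of c 1] lin(2)[OF L, of c 1] eq[OF cspan_step.hyps(1)] cspan_step.IH
      by eventually_elim simp
  qed
  have fL: "f \<in> L2" using f lcl_L2 by blast
  obtain C where C: "C \<ge> 0" "\<And>u f. u \<in> L2 \<Longrightarrow> f \<in> L2 \<Longrightarrow> ldist (T u) (T f) \<le> C * ldist u f"
    using L2_bounded_linear_Lipschitz[OF T] by blast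
  obtain C' where C': "C' \<ge> 0" "\<And>u f. u \<in> L2 \<Longrightarrow> f \<in> L2 \<Longrightarrow> ldist (T' u) (T' f) \<le> C' * ldist u f"
    using L2_bounded_linear_Lipschitz[OF T'] by blast
  have "ldist (T f) (T' f) \<le> e" if "e > 0" for e
  proof -
    define K where "K = C + C' + 1"
    have K: "K > 0" using C C' by (simp add: K_def)
    then have "e / K > 0" using that by simp
    then obtain u where u: "u \<in> cspan A" "ldist u f < e / K"
      using f lclE by metis
    have uL: "u \<in> L2" using u cspan_L2[OF A] by blast
    have "ldist (T u) (T' u) = 0"
      using span[OF u(1)] TL[OF uL] by (intro ldist_AE_zeroI) (auto intro: L2_measurable)
    then have "ldist (T f) (T' f) \<le> ldist (T u) (T f) + ldist (T' u) (T' f)"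
      using ldist_triangle[OF TL(1)[OF fL] TL(1)[OF uL] TL(2)[OF fL]]
        ldist_triangle[OF TL(1)[OF uL] TL(2)[OF uL] TL(2)[OF fL]] ldist_commute[of "T f" "T u"] by linarith
    also have "\<dots> \<le> C * ldist u f + C' * ldist u f"
      by (intro add_mono C C' uL fL)
    also have "\<dots> \<le> K * ldist u f"
      by (simp add: K_def distrib_right)
    also have "\<dots> \<le> e"
      using u(2) K by (simp add: pos_less_divide_eq mult.commute less_imp_le)
    finally show ?thesis .
  qed
  then have "ldist (T f) (T' f) = 0"
    by (metis L2norm_nonneg antisym dense_ge)
  then have "AE x in lborel. T f x - T' f x = 0"
    by (intro L2norm_eq_0D L2_diff TL fL)
  then show ?thesis by simp
qed

lemma L2_mult_bounded:
  assumes f: "f \<in> L2" and [measurable]: "m \<in> borel_measurable borel" and m: "\<And>x. cmod (m x) \<le> 1"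
  shows "(\<lambda>x. m x * f x) \<in> L2" "L2norm (\<lambda>x. m x * f x) \<le> L2norm f"
proof -
  have [measurable]: "f \<in> borel_measurable borel" using f by (rule L2_measurable)
  have le: "cmod (m x * f x) \<le> cmod (f x)" for x
    using mult_right_mono[OF m[of x] norm_ge_zero[of "f x"]] by (simp add: norm_mult)
  show L: "(\<lambda>x. m x * f x) \<in> L2"
    by (rule L2_dominated[OF _ L2_integrable[OF f]]) (use le in auto)
  have "(LINT x|lborel. (cmod (m x * f x))\<^sup>2) \<le> (LINT x|lborel. (cmod (f x))\<^sup>2)"
    using le by (intro integral_mono L2_integrable L f power_mono) auto
  then show "L2norm (\<lambda>x. m x * f x) \<le> L2norm f"
    by (simp add: L2norm_def)
qed

text \<open>Multiplication by a function bounded by 1 is a contraction and hence compatible with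
  closures. It is used with the sign function, which carries density from the even images to the odd
  ones.\<close>

lemma clspan_mult:
  assumes A: "A \<subseteq> L2" and m: "m \<in> borel_measurable borel" "\<And>x. cmod (m x) \<le> 1"
    and f: "f \<in> clspan A"
  shows "(\<lambda>x. m x * f x) \<in> clspan ((\<lambda>f x. m x * f x) ` A)"
proof -
  let ?M = "\<lambda>f x. m x * f x"
  have fL: "f \<in> L2" using f lcl_L2 by blast
  have span: "?M u \<in> cspan (?M ` A)" if "u \<in> cspan A" for u
    using that
  proof (induction rule: cspan.induct)
    case cspan_zero
    then show ?case using cspan.cspan_zero by simp
  next
    case (cspan_step f u c)
    have "(\<lambda>x. c * (m x * f x) + m x * u x) \<in> cspan (?M ` A)"
      using cspan_step by (intro cspan.cspan_step) auto
    then show ?case by (simp add: algebra_simps)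
  qed
  have "\<exists>v\<in>cspan (?M ` A). ldist v (?M f) < e" if "e > 0" for e
  proof -
    obtain u where u: "u \<in> cspan A" "ldist u f < e"
      using f \<open>e > 0\<close> by (rule lclE)
    have "ldist (?M u) (?M f) = L2norm (\<lambda>x. m x * (u x - f x))"
      by (simp add: algebra_simps)
    also have "\<dots> \<le> ldist u f"
      using u(1) cspan_L2[OF A] fL by (intro L2_mult_bounded m L2_diff) auto
    finally show ?thesis
      using u span by (intro bexI[of _ "?M u"]) auto
  qed
  moreover have "?M f \<in> L2"
    by (intro L2_mult_bounded m fL)
  ultimately show ?thesis by (simp add: lcl_def)
qed

section \<open>Haar step functions in terms of symmetric boxes\<close>

definition dyadics :: "real set" where
  "dyadics = {real m / 2 ^ k | m k. m > 0}"

lemma dense_pos_dyadics: "dense_pos dyadics"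
proof
  show "d > 0" if "d \<in> dyadics" for d
    using that by (auto simp: dyadics_def)
  show "\<exists>d\<in>dyadics. \<bar>d - x\<bar> < e" if "x > 0" "e > 0" for x e
  proof -
    obtain k where k: "(1 / 2) ^ k < e"
      using real_arch_pow_inv[OF \<open>e > 0\<close>, of "1 / 2"] by auto
    define m where "m = nat \<lceil>x * 2 ^ k\<rceil>"
    have c: "x * 2 ^ k > 0" using that by simp
    then have m: "m > 0" by (simp add: m_def)
    have "real m = of_int \<lceil>x * 2 ^ k\<rceil>"
      using c by (simp add: m_def)
    then have "x * 2 ^ k \<le> real m" "real m < x * 2 ^ k + 1"
      by linarith+
    then have "x \<le> real m / 2 ^ k" "real m / 2 ^ k < x + (1 / 2) ^ k"
      by (simp_all add: field_simps power_divide)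
    then have "\<bar>real m / 2 ^ k - x\<bar> < e" using k by linarith
    then show ?thesis using m by (auto simp: dyadics_def)
  qed
qed

lemma dense_pos_greaterThan: "dense_pos {0<..}"
  by unfold_locales (auto intro!: bexI)

lemma haar_phi_ibox:
  assumes "q > 0"
  shows "complex_of_real (haar_phi (q * t - k)) = ibox (k / q) ((k + 1) / q) t"
proof -
  have "0 \<le> q * t - k \<longleftrightarrow> k / q \<le> t" "q * t - k \<le> 1 \<longleftrightarrow> t \<le> (k + 1) / q"
    using assms by (auto simp: field_simps)
  then show ?thesis
    by (simp add: haar_phi_def ibox_def indicator_def)
qed

text \<open>Up to end points the even part of a box is half the difference of two symmetric boxes;
  \<open>\<alpha> = 0\<close> is separate because \<open>ebox 0\<close> is not among the
  generators.\<close>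

lemma ibox_symmetrized:
  assumes "0 \<le> \<alpha>" "\<alpha> < \<beta>"
  shows "\<exists>u\<in>cspan (ebox ` {0<..}). AE t in lborel. (ibox \<alpha> \<beta> t + ibox \<alpha> \<beta> (- t)) / 2 = u t"
proof (cases "\<alpha> = 0")
  case True
  have "(\<lambda>t. 1 / 2 * ebox \<beta> t + 0) \<in> cspan (ebox ` {0<..})"
    using assms by (intro cspan_step cspan_zero) auto
  moreover have "AE t in lborel. (ibox \<alpha> \<beta> t + ibox \<alpha> \<beta> (- t)) / 2 = 1 / 2 * ebox \<beta> t + 0"
    using AE_lborel_singleton[of "0::real"]
    by eventually_elim (use assms True in \<open>auto simp: ibox_def ebox_def indicator_def\<close>)
  ultimately show ?thesis by (intro bexI[where x = "\<lambda>t. 1 / 2 * ebox \<beta> t + 0"])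
next
  case False
  have "(\<lambda>t. 1 / 2 * ebox \<beta> t + (- 1 / 2 * ebox \<alpha> t + 0)) \<in> cspan (ebox ` {0<..})"
    using assms False by (intro cspan_step cspan_zero) auto
  moreover have "AE t in lborel. (ibox \<alpha> \<beta> t + ibox \<alpha> \<beta> (- t)) / 2 = 1 / 2 * ebox \<beta> t + (- 1 / 2 * ebox \<alpha> t + 0)"
    using AE_lborel_singleton[of \<alpha>] AE_lborel_singleton[of "- \<alpha>"]
    by eventually_elim (use assms False in \<open>auto simp: ibox_def ebox_def indicator_def\<close>)
  ultimately show ?thesis
    by (intro bexI[where x = "\<lambda>t. 1 / 2 * ebox \<beta> t + (- 1 / 2 * ebox \<alpha> t + 0)"])
qed

text \<open>An even function equals its even part, so every Haar box in the sum may be replaced by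
  its own even part, although the single boxes are not even. Boxes to the left of 0 are reflections
  of boxes to the right.\<close>

lemma Vplus_ebox:
  assumes h: "h \<in> Vplus j"
  shows "h \<in> borel_measurable borel" "\<exists>u\<in>cspan (ebox ` {0<..}). AE t in lborel. h t = u t"
proof -
  define q where "q = 2 powr real_of_int j"
  have q: "q > 0" by (simp add: q_def)
  obtain K and a :: "int \<Rightarrow> complex" where K: "finite K"
    and hK: "h = (\<lambda>t. \<Sum>k\<in>K. a k * complex_of_real (haar_phi (q * t - real_of_int k)))"
    and even: "\<And>t. h (- t) = h t"
    using h by (auto simp: Vplus_def Vspace_def q_def)
  let ?b = "\<lambda>k. ibox (real_of_int k / q) ((real_of_int k + 1) / q)"
  have hb: "h t = (\<Sum>k\<in>K. a k * ?b k t)" for t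
    unfolding hK haar_phi_ibox[OF q] ..
  have [measurable]: "ibox \<alpha> \<beta> \<in> borel_measurable borel" for \<alpha> \<beta>
    using ibox_L2 by (rule L2_measurable)
  show "h \<in> borel_measurable borel"
    unfolding hb[abs_def] by measurable
  have sym: "\<exists>u\<in>cspan (ebox ` {0<..}). AE t in lborel. (?b k t + ?b k (- t)) / 2 = u t" for k
  proof (cases "k \<ge> 0")
    case True
    then show ?thesis
      using q by (intro ibox_symmetrized) (auto simp: divide_strict_right_mono)
  next
    case False
    let ?\<alpha> = "- (real_of_int k + 1) / q" and ?\<beta> = "- real_of_int k / q"
    have "real_of_int k + 1 \<le> 0" using False by linarith
    then have "0 \<le> ?\<alpha>"
      using q by (intro divide_nonneg_pos) auto
    moreover have "?\<alpha> < ?\<beta>"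
      using q by (intro divide_strict_right_mono) auto
    moreover have "?b k t = ibox ?\<alpha> ?\<beta> (- t)" for t
    proof -
      have "?\<alpha> \<le> - t \<longleftrightarrow> t \<le> (real_of_int k + 1) / q" "- t \<le> ?\<beta> \<longleftrightarrow> real_of_int k / q \<le> t"
        unfolding minus_divide_left[symmetric] by (rule neg_le_iff_le)+
      then show ?thesis
        by (auto simp: ibox_def indicator_def simp del: minus_add_distrib)
    qed
    ultimately show ?thesis
      using ibox_symmetrized[of ?\<alpha> ?\<beta>] by (simp add: add.commute)
  qed
  have "\<exists>u\<in>cspan (ebox ` {0<..}). AE t in lborel. (\<Sum>k\<in>L. a k * ((?b k t + ?b k (- t)) / 2)) = u t" if "finite L" for L
    using that
  proof (induction L rule: finite_induct)
    case empty
    show ?case by (rule bexI[OF _ cspan_zero]) simp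
  next
    case (insert k L)
    obtain u where u: "u \<in> cspan (ebox ` {0<..})" "AE t in lborel. (\<Sum>k\<in>L. a k * ((?b k t + ?b k (- t)) / 2)) = u t"
      using insert.IH by blast
    obtain v where v: "v \<in> cspan (ebox ` {0<..})" "AE t in lborel. (?b k t + ?b k (- t)) / 2 = v t"
      using sym[of k] by blast
    have "AE t in lborel. (\<Sum>k\<in>insert k L. a k * ((?b k t + ?b k (- t)) / 2)) = a k * v t + u t"
      using u(2) v(2) by eventually_elim (use insert.hyps in simp)
    then show ?case
      by (rule bexI[OF _ cspan_lincomb[OF v(1) u(1), of "a k"]])
  qed
  from this[OF K] obtain u where u: "u \<in> cspan (ebox ` {0<..})"
    "AE t in lborel. (\<Sum>k\<in>K. a k * ((?b k t + ?b k (- t)) / 2)) = u t" by blast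
  have "h t = (\<Sum>k\<in>K. a k * ((?b k t + ?b k (- t)) / 2))" for t
  proof -
    have "h t = (h t + h (- t)) / 2" by (simp add: even)
    also have "\<dots> = (\<Sum>k\<in>K. a k * ((?b k t + ?b k (- t)) / 2))"
      unfolding hb sum.distrib[symmetric] sum_divide_distrib
      by (intro sum.cong) (auto simp: algebra_simps add_divide_distrib)
    finally show ?thesis .
  qed
  then show "\<exists>u\<in>cspan (ebox ` {0<..}). AE t in lborel. h t = u t"
    using u by auto
qed

text \<open>The witness is the sum of the 2m boxes with indices from -m to m - 1. The closed Haar
  boxes overlap at the grid points, so it equals \<open>ebox d\<close> only almost everywhere; its
  evenness is exact, since reflection exchanges the indices \<open>i\<close> and
  \<open>- i - 1\<close>.\<close>

lemma dyadic_ebox_Vplus: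
  assumes "d \<in> dyadics"
  shows "\<exists>j. \<exists>e\<in>Vplus j. AE t in lborel. e t = ebox d t"
proof -
  obtain m k where d: "d = real m / 2 ^ k" "m > 0"
    using assms by (auto simp: dyadics_def)
  define q where "q = (2::real) ^ k"
  have q: "q > 0" "2 powr real_of_int (int k) = q"
    by (simp_all add: q_def powr_realpow)
  define e where "e = (\<lambda>t. \<Sum>i\<in>{- int m..<int m}. 1 * complex_of_real (haar_phi (2 powr real_of_int (int k) * t - real_of_int i)))"
  have "e \<in> Vspace (int k)"
    unfolding Vspace_def e_def by (intro CollectI exI[of _ "{- int m..<int m}"] exI[of _ "\<lambda>_. 1"]) simp
  moreover have "e (- t) = e t" for t
    unfolding e_def
  proof (rule sum.reindex_bij_witness[where i = "\<lambda>i. - i - 1" and j = "\<lambda>i. - i - 1"])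
    show "1 * complex_of_real (haar_phi (2 powr real_of_int (int k) * t - real_of_int (- i - 1)))
        = 1 * complex_of_real (haar_phi (2 powr real_of_int (int k) * - t - real_of_int i))" for i
      unfolding haar_phi_def by (auto simp: indicator_def)
  qed auto
  ultimately have "e \<in> Vplus (int k)" by (simp add: Vplus_def)
  moreover have "AE t in lborel. e t = ebox d t"
  proof -
    have "countable (range (\<lambda>i::int. real_of_int i / q))" by simp
    then have "AE t in lborel. t \<notin> range (\<lambda>i::int. real_of_int i / q)"
      by (intro AE_not_in countable_imp_null_set_lborel)
    then show ?thesis
    proof eventually_elim
      case (elim t)
      have ni: "q * t \<noteq> real_of_int i" for i
        using elim q(1) by (auto simp: field_simps)
      have h: "haar_phi (q * t - real_of_int i) = (if i = \<lfloor>q * t\<rfloor> then 1 else 0)" for i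
      proof -
        have "0 \<le> q * t - real_of_int i \<and> q * t - real_of_int i \<le> 1 \<longleftrightarrow> i = \<lfloor>q * t\<rfloor>"
          using ni[of "i + 1"] ni[of i] floor_unique[of i "q * t"] by (auto simp: not_le le_less) linarith+
        then show ?thesis by (simp add: haar_phi_def indicator_def)
      qed
      have "e t = (\<Sum>i\<in>{- int m..<int m}. if i = \<lfloor>q * t\<rfloor> then 1 else 0)"
        unfolding e_def q(2) h by (intro sum.cong) auto
      also have "\<dots> = (if \<lfloor>q * t\<rfloor> \<in> {- int m..<int m} then 1 else 0)"
        by (simp add: sum.delta)
      also have "\<lfloor>q * t\<rfloor> \<in> {- int m..<int m} \<longleftrightarrow> t \<in> {- d..d}"
      proof -
        have "\<lfloor>q * t\<rfloor> \<in> {- int m..<int m} \<longleftrightarrow> - real m \<le> q * t \<and> q * t < real m"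
          by (simp add: le_floor_iff floor_less_iff)
        also have "\<dots> \<longleftrightarrow> - real m \<le> q * t \<and> q * t \<le> real m"
          using ni[of "int m"] by auto
        also have "\<dots> \<longleftrightarrow> t \<in> {- d..d}"
          using q(1) unfolding d(1) q_def[symmetric] by (auto simp: field_simps)
        finally show ?thesis .
      qed
      finally show ?case by (simp add: ebox_def indicator_def)
    qed
  qed
  ultimately show ?thesis by blast
qed

lemma (in kernel) Phi_even_cong_AE:
  assumes "f \<in> borel_measurable borel" "g \<in> borel_measurable borel" "AE t in lborel. f t = g t"
  shows "Phi_even n f = Phi_even n g"
proof
  fix \<omega>
  show "Phi_even n f \<omega> = Phi_even n g \<omega>"
    unfolding Phi_even_def by (rule integral_cong_AE) (use assms in \<open>auto elim!: eventually_mono\<close>)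
qed

section \<open>The isometric relation on even boxes and their Hilbert transforms\<close>

context kernel
begin

definition even_pairs :: "((real \<Rightarrow> complex) \<times> (real \<Rightarrow> complex)) set" where
  "even_pairs = {(ebox a, Phi_even n (ebox a)) | a. a > 0}"

definition Phi_conj :: "(real \<Rightarrow> complex) \<Rightarrow> real \<Rightarrow> complex" where
  "Phi_conj f \<omega> = - \<i> * of_real (sgn \<omega>) * Phi_even n f \<omega>"

definition Phi_pairs :: "((real \<Rightarrow> complex) \<times> (real \<Rightarrow> complex)) set" where
  "Phi_pairs = even_pairs \<union> {(Hbox (- a) a, Phi_conj (ebox a)) | a. a > 0}"

lemma even_pairs_L2: "even_pairs \<subseteq> L2 \<times> L2"
  by (auto simp: even_pairs_def ebox_L2 Phi_ebox_L2)

lemma Phi_conj_L2: "Phi_even n f \<in> L2 \<Longrightarrow> Phi_conj f \<in> L2"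
  unfolding Phi_conj_def[abs_def] by (intro L2_mult_bounded) (auto simp: norm_mult sgn_if)

lemma Phi_pairs_L2: "Phi_pairs \<subseteq> L2 \<times> L2"
  using even_pairs_L2 by (auto simp: Phi_pairs_def Hbox_L2 Phi_conj_L2 Phi_ebox_L2)

lemma Phi_conj_odd: "Phi_conj f (- \<omega>) = - Phi_conj f \<omega>"
  by (simp add: Phi_conj_def Phi_even_even sgn_minus)

lemma ip_Phi_conj:
  assumes "Phi_even n f \<in> L2" "Phi_even n g \<in> L2"
  shows "ip (Phi_conj f) (Phi_conj g) = ip (Phi_even n f) (Phi_even n g)"
  unfolding ip_def
proof (rule integral_cong_AE)
  have *: "- (\<i> * z * (\<i> * w)) = z * w" for z w
  proof -
    have "\<i> * z * (\<i> * w) = (\<i> * \<i>) * (z * w)"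
      by (simp only: mult_ac)
    then show ?thesis by simp
  qed
  show "AE \<omega> in lborel. Phi_conj f \<omega> * cnj (Phi_conj g \<omega>) = Phi_even n f \<omega> * cnj (Phi_even n g \<omega>)"
    using AE_lborel_singleton[of "0::real"]
    by eventually_elim (auto simp: Phi_conj_def sgn_if *)
qed (use L2_mult_integrable[OF _ L2_cnj] assms Phi_conj_L2 in \<open>auto dest: borel_measurable_integrable\<close>)

lemma ebox_even: "ebox a (- x) = ebox a x"
  by (auto simp: ebox_def indicator_def)

text \<open>Within each family this is the isometry of \<Phi> and of the Hilbert transform, the
  factor -i sgn having modulus 1 almost everywhere. Mixed products vanish on both sides, being
  products of an even and an odd function.\<close>

lemma Phi_pairs_gram:
  assumes "(f, g) \<in> Phi_pairs" "(f', g') \<in> Phi_pairs"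
  shows "ip g g' = ip f f'"
proof -
  have ee: "ip (Phi_even n (ebox a)) (Phi_even n (ebox b)) = ip (ebox a) (ebox b)" if "a > 0" "b > 0" for a b
    by (rule ip_Phi_ebox[OF that])
  have oo: "ip (Phi_conj (ebox a)) (Phi_conj (ebox b)) = ip (Hbox (- a) a) (Hbox (- b) b)" if "a > 0" "b > 0" for a b
    using that by (simp add: ip_Phi_conj Phi_ebox_L2 ee ip_Hbox ebox_eq_ibox[symmetric])
  have eo: "ip (Phi_even n (ebox a)) (Phi_conj (ebox b)) = 0" "ip (ebox a) (Hbox (- b) b) = 0" for a b
    by (rule ip_even_odd, rule Phi_even_even, rule Phi_conj_odd) (rule ip_even_odd, rule ebox_even, rule Hbox_odd)
  have oe: "ip (Phi_conj (ebox b)) (Phi_even n (ebox a)) = 0" "ip (Hbox (- b) b) (ebox a) = 0" for a b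
    using eo[of a b] ip_cnj[of "Phi_conj (ebox b)" "Phi_even n (ebox a)"] ip_cnj[of "Hbox (- b) b" "ebox a"] by simp_all
  show ?thesis
    using assms unfolding Phi_pairs_def even_pairs_def by (auto simp: ee oo eo oe)
qed

lemma Phi_pairs_domain: "clspan (Domain Phi_pairs) = L2"
proof -
  have "Domain Phi_pairs = ebox ` {0<..} \<union> (\<lambda>a. Hbox (- a) a) ` {0<..}"
    unfolding Phi_pairs_def even_pairs_def by auto
  then show ?thesis
    using dense_pos.ebox_Hbox_total[OF dense_pos_greaterThan] by simp
qed

lemma rspan_mono:
  assumes "A \<subseteq> B" "(u, v) \<in> rspan A" shows "(u, v) \<in> rspan B"
  using assms(2) by induction (use assms(1) in \<open>auto intro: rspan.intros\<close>)

text \<open>Places combinations of boxes in the same closed relation as the Gaussians, so that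
  isometry applies to differences between the two kinds.\<close>

lemma rspan_even_pairs_rcl: "(u, v) \<in> rspan even_pairs \<Longrightarrow> (u, v) \<in> rcl (rspan Gauss_pairs)"
proof (induction rule: rspan.induct)
  case rspan_zero
  then show ?case
    using subset_rcl[OF rspan_L2[OF Gauss_pairs_L2]] rspan.rspan_zero by blast
next
  case (rspan_step f g u v c)
  then have "(f, g) \<in> rcl (rspan Gauss_pairs)"
    using ebox_Phi(1) by (auto simp: even_pairs_def)
  then show ?case
    using rspan_step.IH by (rule rcl_lincomb[OF Gauss_pairs_L2])
qed

text \<open>\<open>G s\<close> is even, hence approximated by combinations of symmetric boxes. By
  isometry of the common closed relation their images approximate the image of \<open>G s\<close>
  equally well.\<close>

lemma Phi_G_range:
  assumes s: "s > 0"
  shows "Phi_even n (G s) \<in> clspan (Range even_pairs)"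
proof -
  have gL: "Phi_even n (G s) \<in> L2"
    using Phi_G_rcl[OF s] rcl_L2 by auto
  have ge: "G s \<in> clspan (ebox ` {0<..})"
    by (rule dense_pos.even_dense[OF dense_pos_greaterThan G_L2[OF s]]) (simp add: G_def)
  have "\<exists>v\<in>cspan (Range even_pairs). ldist v (Phi_even n (G s)) < e" if "e > 0" for e
  proof -
    obtain u where u: "u \<in> cspan (ebox ` {0<..})" "ldist u (G s) < e"
      using ge \<open>e > 0\<close> by (rule lclE)
    have "ebox ` {0<..} = Domain even_pairs"
      unfolding even_pairs_def by auto
    then obtain v where v: "(u, v) \<in> rspan even_pairs"
      using cspan_Domain[of u even_pairs] u(1) by auto
    have "(\<lambda>x. - 1 * G s x + u x, \<lambda>x. - 1 * Phi_even n (G s) x + v x) \<in> rcl (rspan Gauss_pairs)"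
      by (rule rcl_lincomb[OF Gauss_pairs_L2 Phi_G_rcl[OF s] rspan_even_pairs_rcl[OF v]])
    from rcl_rspan_isometric[OF Gauss_pairs_L2 Gauss_pairs_gram this] have "ldist v (Phi_even n (G s)) = ldist u (G s)"
      by simp
    moreover have "v \<in> cspan (Range even_pairs)"
      using v unfolding Range_rspan[symmetric] by blast
    ultimately show ?thesis
      using u(2) by (intro bexI[of _ v]) auto
  qed
  then show ?thesis
    using gL by (simp add: lcl_def)
qed

text \<open>The map s -> 1 / (4 n^2 s) is an involution, so every Gaussian is a multiple of the
  image of the Gaussian with the dual parameter; and boxes lie in the closed span of the
  Gaussians.\<close>

lemma ebox_range:
  assumes a: "a > 0"
  shows "ebox a \<in> clspan (Range even_pairs)"
proof -
  have S: "Range even_pairs \<subseteq> L2" using even_pairs_L2 by auto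
  have "G s \<in> clspan (Range even_pairs)" if s: "s > 0" for s
  proof -
    define r where "r = 1 / (4 * (real n)\<^sup>2 * s)"
    have r: "r > 0" unfolding r_def by (rule inverse_scale_pos[OF s])
    have rs: "1 / (4 * (real n)\<^sup>2 * r) = s"
      using s n by (simp add: r_def)
    define c where "c = (2 * n * r) powr - p"
    have c: "c \<noteq> 0" using r n by (simp add: c_def)
    have "(\<lambda>\<omega>. of_real (1 / c) * Phi_even n (G r) \<omega>) \<in> clspan (Range even_pairs)"
      by (rule clspan_scale[OF S Phi_G_range[OF r]])
    moreover have "(\<lambda>\<omega>. of_real (1 / c) * Phi_even n (G r) \<omega>) = G s"
      unfolding Phi_G[OF r] rs c_def[symmetric] using c by (simp add: mult.assoc[symmetric])
    ultimately show ?thesis by simp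
  qed
  then have "Gauss \<subseteq> clspan (Range even_pairs)"
    by (auto simp: Gauss_def)
  then have "clspan Gauss \<subseteq> clspan (Range even_pairs)"
    by (rule clspan_subset[OF S])
  then show ?thesis
    using ebox_Phi(2)[OF a] by blast
qed

text \<open>The even boxes are reached by \<open>ebox_range\<close>. The sign function times the
  image of an even box is i times a \<open>Phi_conj\<close>, so multiplying approximations of even
  boxes by the sign function reaches the odd boxes as well.\<close>

lemma Phi_pairs_range: "clspan (Range Phi_pairs) = L2"
proof (rule dense_pos.total_if_even_odd[OF dense_pos_greaterThan])
  show S: "Range Phi_pairs \<subseteq> L2" using Phi_pairs_L2 by auto
  have even_pairs: "Range even_pairs \<subseteq> L2" using even_pairs_L2 by auto
  have "Range even_pairs \<subseteq> clspan (Range Phi_pairs)"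
    using clspan_base[OF S] unfolding Phi_pairs_def by blast
  from clspan_subset[OF S this]
  show "ebox a \<in> clspan (Range Phi_pairs)" if "a \<in> {0<..}" for a
    using ebox_range that by auto
  let ?M = "\<lambda>f x. complex_of_real (sgn x) * f x"
  have "?M ` Range even_pairs \<subseteq> clspan (Range Phi_pairs)"
  proof
    fix f assume "f \<in> ?M ` Range even_pairs"
    then obtain a where a: "a > 0" "f = ?M (Phi_even n (ebox a))"
      by (auto simp: even_pairs_def)
    have "f = (\<lambda>x. \<i> * Phi_conj (ebox a) x)"
      unfolding a(2) by (simp add: Phi_conj_def fun_eq_iff mult.assoc)
    moreover have "Phi_conj (ebox a) \<in> Range Phi_pairs"
      using a(1) unfolding Phi_pairs_def by blast
    ultimately show "f \<in> clspan (Range Phi_pairs)"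
      using clspan_scale[OF S clspan_base[OF S]] by blast
  qed
  from clspan_subset[OF S this]
  have "clspan (?M ` Range even_pairs) \<subseteq> clspan (Range Phi_pairs)" .
  moreover have "?M (ebox a) \<in> clspan (?M ` Range even_pairs)" if "a > 0" for a
    by (rule clspan_mult[OF even_pairs _ _ ebox_range[OF that]]) (auto simp: sgn_if)
  ultimately show "?M (ebox a) \<in> clspan (Range Phi_pairs)" if "a \<in> {0<..}" for a
    using that by auto
qed

lemma Phi_even_lincomb_ebox:
  assumes "\<And>\<omega>. integrable lborel (\<lambda>t. complex_of_real (cn n (\<omega> * t)) * u t)"
  shows "Phi_even n (\<lambda>x. c * ebox a x + u x) = (\<lambda>\<omega>. c * Phi_even n (ebox a) \<omega> + Phi_even n u \<omega>)"
    "integrable lborel (\<lambda>t. complex_of_real (cn n (\<omega> * t)) * (c * ebox a t + u t))"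
proof -
  have eq: "complex_of_real (cn n (\<omega> * t)) * (c * ebox a t + u t)
      = c * (complex_of_real (cn n (\<omega> * t)) * ebox a t) + complex_of_real (cn n (\<omega> * t)) * u t" for \<omega> t
    by (simp add: algebra_simps)
  show "Phi_even n (\<lambda>x. c * ebox a x + u x) = (\<lambda>\<omega>. c * Phi_even n (ebox a) \<omega> + Phi_even n u \<omega>)"
    unfolding Phi_even_def eq using integrable_cn_ebox assms by simp
  show "integrable lborel (\<lambda>t. complex_of_real (cn n (\<omega> * t)) * (c * ebox a t + u t))"
    unfolding eq using integrable_cn_ebox assms by simp
qed

lemma step_even:
  assumes "u \<in> cspan (ebox ` {0<..})"
  shows "(u, Phi_even n u) \<in> rspan even_pairs \<and> (\<forall>\<omega>. integrable lborel (\<lambda>t. complex_of_real (cn n (\<omega> * t)) * u t))"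
  using assms
proof (induction rule: cspan.induct)
  case cspan_zero
  then show ?case
    using rspan_zero by (simp add: Phi_even_def[abs_def])
next
  case (cspan_step f u c)
  then obtain a where a: "a > 0" "f = ebox a" by auto
  then have "(f, Phi_even n f) \<in> even_pairs" by (auto simp: even_pairs_def)
  then have "(\<lambda>x. c * f x + u x, \<lambda>x. c * Phi_even n f x + Phi_even n u x) \<in> rspan even_pairs"
    using cspan_step.IH by (intro rspan_step) auto
  then show ?case
    using Phi_even_lincomb_ebox[where u = u and c = c and a = a] cspan_step.IH unfolding a(2) by simp
qed

text \<open>\<open>N\<close> collects the end points of the boxes that occur. Keeping it explicit
  and finite lets the pointwise formulas for the transform and for its second transform pass through
  linear combinations.\<close>

lemma step_odd:
  assumes "u \<in> cspan (ebox ` {0<..})"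
  shows "\<exists>v N. finite N \<and> (v, Phi_conj u) \<in> rspan Phi_pairs \<and> (\<forall>x. x \<notin> N \<longrightarrow> has_hilbert u x (v x) \<and> has_hilbert v x (- u x))"
  using assms
proof (induction rule: cspan.induct)
  case cspan_zero
  have "Phi_conj (\<lambda>x. 0) = (\<lambda>x. 0)"
    by (simp add: Phi_conj_def[abs_def] Phi_even_def)
  then show ?case
    using rspan_zero[of Phi_pairs] has_hilbert_zero by (intro exI[of _ "\<lambda>x. 0"] exI[of _ "{}"]) simp
next
  case (cspan_step f u c)
  then obtain a where a: "a > 0" "f = ebox a" by auto
  obtain v N where v: "finite N" "(v, Phi_conj u) \<in> rspan Phi_pairs"
    "\<And>x. x \<notin> N \<Longrightarrow> has_hilbert u x (v x) \<and> has_hilbert v x (- u x)"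
    using cspan_step.IH by blast
  have L: "u \<in> L2" "v \<in> L2"
    using cspan_step.hyps(2) cspan_L2[of "ebox ` {0<..}"] ebox_L2 v(2) rspan_L2[OF Phi_pairs_L2] by auto
  have "(Hbox (- a) a, Phi_conj (ebox a)) \<in> Phi_pairs"
    using a(1) by (auto simp: Phi_pairs_def)
  then have "(\<lambda>x. c * Hbox (- a) a x + v x, \<lambda>x. c * Phi_conj (ebox a) x + Phi_conj u x) \<in> rspan Phi_pairs"
    using v(2) by (rule rspan_step)
  moreover have "(\<lambda>x. c * Phi_conj (ebox a) x + Phi_conj u x) = Phi_conj (\<lambda>x. c * f x + u x)"
  proof -
    have P: "Phi_even n (\<lambda>x. c * ebox a x + u x) = (\<lambda>\<omega>. c * Phi_even n (ebox a) \<omega> + Phi_even n u \<omega>)"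
      by (rule Phi_even_lincomb_ebox(1)) (use step_even[OF cspan_step.hyps(2)] in blast)
    show ?thesis
      unfolding a(2) Phi_conj_def[abs_def] P by (simp add: algebra_simps)
  qed
  moreover have "has_hilbert (\<lambda>x. c * f x + u x) x (c * Hbox (- a) a x + v x) \<and>
      has_hilbert (\<lambda>x. c * Hbox (- a) a x + v x) x (- (c * f x + u x))" if "x \<notin> N \<union> {a, - a}" for x
  proof
    show "has_hilbert (\<lambda>x. c * f x + u x) x (c * Hbox (- a) a x + v x)"
      unfolding a(2) ebox_eq_ibox
      by (rule has_hilbert_lincomb[OF ibox_L2 L(1)]) (use that a(1) v(3) in \<open>auto intro!: has_hilbert_ibox\<close>)
    have "has_hilbert (\<lambda>x. c * Hbox (- a) a x + v x) x (c * - ibox (- a) a x + - u x)"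
      by (rule has_hilbert_lincomb[OF Hbox_L2 L(2)]) (use that a(1) v(3) in \<open>auto intro!: has_hilbert_Hbox\<close>)
    then show "has_hilbert (\<lambda>x. c * Hbox (- a) a x + v x) x (- (c * f x + u x))"
      unfolding a(2) ebox_eq_ibox by (simp add: algebra_simps)
  qed
  ultimately show ?case
    using v(1) by (intro exI[of _ "\<lambda>x. c * Hbox (- a) a x + v x"] exI[of _ "N \<union> {a, - a}"]) auto
qed

lemma borel_measurable_finite_difference:
  assumes "f \<in> borel_measurable borel" "finite N" "\<And>x. x \<notin> N \<Longrightarrow> f x = g x"
  shows "g \<in> borel_measurable (borel :: real measure)"
  by (rule measurable_discrete_difference[OF assms(1), of N]) (use assms in \<open>auto intro: countable_finite\<close>)

lemma Vplus_even_rcl: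
  assumes h: "h \<in> Vplus j"
  shows "(h, Phi_even n h) \<in> rcl (rspan Phi_pairs)"
proof -
  obtain u where u: "u \<in> cspan (ebox ` {0<..})" "AE t in lborel. h t = u t"
    using Vplus_ebox(2)[OF h] by blast
  have uP: "(u, Phi_even n u) \<in> rspan Phi_pairs"
    using step_even[OF u(1)] by (auto simp: Phi_pairs_def intro: rspan_mono)
  then have L: "u \<in> L2" "Phi_even n u \<in> L2" using rspan_L2[OF Phi_pairs_L2] by auto
  have eq: "Phi_even n h = Phi_even n u"
    by (rule Phi_even_cong_AE[OF Vplus_ebox(1)[OF h] L2_measurable[OF L(1)] u(2)])
  have "(u, Phi_even n u) \<in> rcl (rspan Phi_pairs)"
    using subset_rcl[OF rspan_L2[OF Phi_pairs_L2]] uP by blast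
  then show ?thesis
    unfolding eq
  proof (rule rcl_cong_AE[OF rspan_L2[OF Phi_pairs_L2]])
    show "AE x in lborel. u x = h x" using u(2) by eventually_elim simp
  qed (use Vplus_ebox(1)[OF h] L2_measurable[OF L(2)] in auto)
qed

text \<open>Since \<open>\<H>\<H>h = - h\<close>, the operator \<open>Phi_odd\<close> sends \<open>\<H>h\<close> to \<open>- i sgn \<Phi>h\<close>.\<close>

lemma Vplus_odd_rcl:
  assumes h: "h \<in> Vplus j"
  shows "(hilbert h, Phi_odd n (hilbert h)) \<in> rcl (rspan Phi_pairs)"
proof -
  obtain u where u: "u \<in> cspan (ebox ` {0<..})" "AE t in lborel. h t = u t"
    using Vplus_ebox(2)[OF h] by blast
  obtain v N where v: "finite N" "(v, Phi_conj u) \<in> rspan Phi_pairs"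
    "\<And>x. x \<notin> N \<Longrightarrow> has_hilbert u x (v x) \<and> has_hilbert v x (- u x)"
    using step_odd[OF u(1)] by blast
  have L: "u \<in> L2" "v \<in> L2" "Phi_conj u \<in> L2"
    using u(1) cspan_L2[of "ebox ` {0<..}"] ebox_L2 v(2) rspan_L2[OF Phi_pairs_L2] by auto
  have um: "u \<in> borel_measurable borel" and vm: "v \<in> borel_measurable borel"
    using L L2_measurable by auto
  have "hilbert h = hilbert u"
    by (rule hilbert_cong_AE[OF Vplus_ebox(1)[OF h] um u(2)])
  then have hv: "v x = hilbert h x" if "x \<notin> N" for x
    using v(3)[OF that] has_hilbert_hilbert by metis
  have AEN: "AE x in lborel. x \<notin> N"
    by (intro AE_not_in finite_imp_null_set_lborel v(1))
  have hm: "hilbert h \<in> borel_measurable borel"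
    by (rule borel_measurable_finite_difference[OF vm v(1) hv])
  have hv_AE: "AE x in lborel. v x = hilbert h x"
    using AEN by eventually_elim (rule hv)
  \<comment> \<open>\<open>v\<close> equals the inner transform only off \<open>N\<close>, but the
    truncated integrals do not see null sets; so the outer transforms are equal at every
    point.\<close>
  have "hilbert (hilbert h) = hilbert v"
    using hilbert_cong_AE[OF vm hm hv_AE] by simp
  then have hh: "- u x = hilbert (hilbert h) x" if "x \<notin> N" for x
    using v(3)[OF that] has_hilbert_hilbert by metis
  have hhm: "hilbert (hilbert h) \<in> borel_measurable borel"
    by (rule borel_measurable_finite_difference[OF _ v(1) hh]) (use um in auto)
  have hh_AE: "AE x in lborel. hilbert (hilbert h) x = - u x"
    using AEN by eventually_elim (simp add: hh)
  have "Phi_odd n (hilbert h) = Phi_conj u"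
  proof
    fix \<omega>
    have "(LINT t|lborel. complex_of_real (cn n (\<omega> * t)) * hilbert (hilbert h) t) = (LINT t|lborel. - (complex_of_real (cn n (\<omega> * t)) * u t))"
      by (rule integral_cong_AE) (use um hhm hh_AE in \<open>auto elim!: eventually_mono\<close>)
    then show "Phi_odd n (hilbert h) \<omega> = Phi_conj u \<omega>"
      by (simp add: Phi_odd_def Phi_conj_def Phi_even_def)
  qed
  moreover have "(v, Phi_conj u) \<in> rcl (rspan Phi_pairs)"
    using subset_rcl[OF rspan_L2[OF Phi_pairs_L2]] v(2) by blast
  then have "(hilbert h, Phi_conj u) \<in> rcl (rspan Phi_pairs)"
    by (rule rcl_cong_AE[OF rspan_L2[OF Phi_pairs_L2]]) (use hm hv_AE L2_measurable[OF L(3)] in auto)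
  ultimately show ?thesis by simp
qed

lemma hilbert_ebox_AE:
  assumes a: "a > 0" and e: "e \<in> Vplus j" "AE t in lborel. e t = ebox a t"
  shows "AE x in lborel. hilbert e x = Hbox (- a) a x"
proof -
  have eq: "hilbert e = hilbert (ibox (- a) a)"
    by (rule hilbert_cong_AE[OF Vplus_ebox(1)[OF e(1)] L2_measurable[OF ibox_L2]])
       (use e(2) in \<open>simp add: ebox_eq_ibox\<close>)
  show ?thesis
    unfolding eq using AE_neq2[of "- a" a] by eventually_elim (use a in \<open>simp add: has_hilbert_hilbert has_hilbert_ibox\<close>)
qed

lemma extension_exists:
  obtains T where "L2_bounded_linear T" "L2_unitary T" "extends_Phi n T"
proof -
  obtain T where T: "L2_bounded_linear T" "L2_unitary T"
    "\<And>f g. (f, g) \<in> rcl (rspan Phi_pairs) \<Longrightarrow> AE x in lborel. T f x = g x"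
    using unitary_extension[OF Phi_pairs_L2 Phi_pairs_gram Phi_pairs_domain Phi_pairs_range] by blast
  have "extends_Phi n T"
    unfolding extends_Phi_def using T(3)[OF Vplus_even_rcl] T(3)[OF Vplus_odd_rcl] by blast
  with T(1,2) show ?thesis by (rule that)
qed

text \<open>\<open>extends_Phi\<close> prescribes values only on the spaces \<open>Vplus j\<close>
  and their transforms, hence the dyadic end points. Members of these spaces coincide with dyadic
  boxes almost everywhere, bounded operators respect this, and the boxes together with their
  transforms have dense span.\<close>

lemma extension_unique:
  assumes T: "L2_bounded_linear T" "extends_Phi n T" and T': "L2_bounded_linear T'" "extends_Phi n T'"
    and f: "f \<in> L2"
  shows "AE x in lborel. T f x = T' f x"
proof -
  let ?A = "ebox ` dyadics \<union> (\<lambda>a. Hbox (- a) a) ` dyadics"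
  have pos: "d > 0" if "d \<in> dyadics" for d
    using that dense_pos.pos[OF dense_pos_dyadics] by blast
  have agree: "AE x in lborel. T g x = T' g x"
    if "g \<in> L2" "w \<in> L2" "AE x in lborel. w x = g x" "AE x in lborel. T w x = T' w x" for g w
  proof -
    have "AE x in lborel. T w x = T g x" "AE x in lborel. T' w x = T' g x"
      using T(1) T'(1) that unfolding L2_bounded_linear_def by blast+
    with that(4) show ?thesis by eventually_elim simp
  qed
  have "AE x in lborel. T g x = T' g x" if g: "g \<in> ?A" for g
  proof -
    obtain d where d: "d \<in> dyadics" "g = ebox d \<or> g = Hbox (- d) d"
      using g by blast
    obtain j e where e: "e \<in> Vplus j" "AE t in lborel. e t = ebox d t"
      using dyadic_ebox_Vplus[OF d(1)] by blast
    have L: "e \<in> L2" "hilbert e \<in> L2"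
      using Vplus_even_rcl[OF e(1)] Vplus_odd_rcl[OF e(1)] rcl_L2 by auto
    have "AE x in lborel. T e x = Phi_even n e x" "AE x in lborel. T' e x = Phi_even n e x"
      "AE x in lborel. T (hilbert e) x = Phi_odd n (hilbert e) x" "AE x in lborel. T' (hilbert e) x = Phi_odd n (hilbert e) x"
      using T(2) T'(2) e(1) unfolding extends_Phi_def by blast+
    then have eq: "AE x in lborel. T e x = T' e x" "AE x in lborel. T (hilbert e) x = T' (hilbert e) x"
      by (eventually_elim, simp)+
    show ?thesis
      using d(2) agree[OF ebox_L2 L(1) e(2) eq(1)]
        agree[OF Hbox_L2 L(2) hilbert_ebox_AE[OF pos[OF d(1)] e] eq(2)] by auto
  qed
  moreover have "f \<in> clspan ?A"
    using f dense_pos.ebox_Hbox_total[OF dense_pos_dyadics] by simp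
  moreover have "?A \<subseteq> L2"
    using ebox_L2 Hbox_L2 by auto
  ultimately show ?thesis
    using L2_bounded_linear_agree[OF T(1) T'(1)] by blast
qed

end

text \<open>The existence clause keeps the universal clause from being vacuous. Every extension
  agrees almost everywhere with the unitary one, and both conditions of \<open>L2_unitary\<close>
  are insensitive to such a change.\<close>

theorem theorem3:
  fixes n :: nat
  assumes "n \<ge> 1"
  shows "(\<exists>T. L2_bounded_linear T \<and> extends_Phi n T) \<and>
         (\<forall>T. L2_bounded_linear T \<and> extends_Phi n T \<longrightarrow> L2_unitary T)"
proof -
  interpret kernel n by unfold_locales (rule assms)
  obtain U where U: "L2_bounded_linear U" "L2_unitary U" "extends_Phi n U"
    using extension_exists .
  have "L2_unitary T" if T: "L2_bounded_linear T" "extends_Phi n T" for T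
  proof -
    have eq: "AE x in lborel. T f x = U f x" if "f \<in> L2" for f
      by (rule extension_unique[OF T U(1,3) that])
    have L: "T f \<in> L2" "U f \<in> L2" if "f \<in> L2" for f
      using T(1) U(1) that by (auto simp: L2_bounded_linear_def)
    have "L2norm (T f) = L2norm f" if "f \<in> L2" for f
    proof -
      have "L2norm (T f) = L2norm (U f)"
        by (rule L2norm_cong_AE[OF L2_measurable[OF L(1)[OF that]] L2_measurable[OF L(2)[OF that]] eq[OF that]])
      then show ?thesis
        using U(2) that by (simp add: L2_unitary_def)
    qed
    moreover have "\<exists>f\<in>L2. AE x in lborel. T f x = g x" if "g \<in> L2" for g
    proof -
      obtain f where f: "f \<in> L2" "AE x in lborel. U f x = g x"
        using U(2) \<open>g \<in> L2\<close> by (auto simp: L2_unitary_def)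
      have "AE x in lborel. T f x = g x"
        using eq[OF f(1)] f(2) by eventually_elim simp
      with f(1) show ?thesis by blast
    qed
    ultimately show ?thesis
      by (simp add: L2_unitary_def)
  qed
  with U(1,3) show ?thesis by blast
qed

end
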